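(* Let $X$ be a smooth connected projective curve over $\mathbb{C}$ of genus $g$, $e,\infty\in X(\mathbb{C})$ distinct points, $n\ge2$, and let $\alpha_i,d_i,\omega_i,\beta_i$ ($1\le i\le 2g$) be as in the context. Let $\xi\in(H^1)^{\otimes 2n-2}$ be a Hodge class with $\xi=\sum_I\lambda_I(\xi)d_I$, and for $c\in H^1_{\mathbb C}$ let $$f_\xi(c)=\sum_{j}\sum_{I}p_j(c)\,\lambda_I(\xi)\int_{(\beta_{i_{n+1}}-1)\cdots(\beta_{i_{2n-2}}-1)(\beta_j-1)}\omega_{i_1}\cdots\omega_{i_n},$$ where $1\le j\le 2g$ and $I=(i_1,\dots,i_{2n-2})\in\{1,\dots,2g\}^{2n-2}$. For $i,j,k\le 2g$ let $$\mu'_{ijk}(\xi;c)=\sum_{r=1}^{n-1}\ \sum_{\substack{i_1,\dots,i_{2n-1}\le2g\\(i_r,i_{r+1},i_{r+n})=(i,j,k)}}\lambda_{(i_1,\dots,i_{2n-2})}(\xi)\,p_{i_{2n-1}}(c)\prod_{l=1}^{r-1}\int_{\beta_{i_{l+n}}}\omega_{i_l}\ \prod_{l=r+2}^{n}\int_{\beta_{i_{l+n-1}}}\omega_{i_l}.$$ Then $$f_\xi(c)=\sum_{i,j,k\le2g}\mu'_{ijk}(\xi;c)\int_{\beta_k}\omega_i\omega_j.$$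
   Context: $U=X-\{\infty\}$, $H^1=H^1(X)=H^1(U)$ (identified by restriction). $\alpha_1,\dots,\alpha_g$ are holomorphic 1-forms on $X$; $\alpha_{g+1},\dots,\alpha_{2g}$ are meromorphic 1-forms on $X$ holomorphic on $U$; the classes of $\alpha_1,\dots,\alpha_{2g}$ form a basis of $H^1_{\mathbb C}$. $d_1,\dots,d_{2g}$ is a basis of $H^1_{\mathbb Z}$, and $d_I=d_{i_1}\otimes\cdots\otimes d_{i_m}$ for $I=(i_1,\dots,i_m)$. $\omega_i$ is the unique representative of $d_i$ in $\sum_j\mathbb{C}\alpha_j$. $\beta_i\in\pi_1(U,e)$ satisfies $\int_{\beta_i}-=\int_Xd_i\wedge-$ on $H^1$. For $c\in H^1_{\mathbb C}$, $c=\sum_ip_i(c)d_i$. For a loop $\gamma$ at $e$ with $\gamma^*\omega_i=f_i(t)dt$, $\int_\gamma\omega_1\cdots\omega_r=\int_{0\le t_1\le\cdots\le t_r\le1}f_1(t_1)\cdots f_r(t_r)\,dt_1\cdots dt_r$ (homotopy invariant when the $\omega_i$ are holomorphic on $U$), extended linearly to $\mathbb{Z}[\pi_1(U,e)]$; the product $\alpha\beta$ in $\pi_1$ means $\alpha$ first, then $\beta$. *)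

theory Defs
  imports
    "HOL-Analysis.Analysis"
    "HOL-Complex_Analysis.Complex_Analysis"
    "HOL-Homology.Homology"
begin

section \<open>Projective space and smooth projective curves\<close>

text \<open>Complex projective space of dimension \<open>CARD('n) - 1\<close>: the lines through the origin,
  with the quotient topology of the punctured affine space.\<close>

typedef (overloaded) ('n::finite) proj =
  "{L. \<exists>v :: complex ^ 'n. v \<noteq> 0 \<and> L = range (\<lambda>c. c *s v)}"
proof -
  have "((\<chi> i. 1) :: complex ^ 'n) \<noteq> 0" by (simp add: vec_eq_iff)
  then show ?thesis by blast
qed

definition proj_pt :: "complex ^ 'n \<Rightarrow> ('n::finite) proj" where
  "proj_pt v = Abs_proj (range (\<lambda>c. c *s v))"

instantiation proj :: (finite) topological_space
begin

definition open_proj :: "'a proj set \<Rightarrow> bool" where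
  "open_proj S \<longleftrightarrow> open {v. v \<noteq> 0 \<and> proj_pt v \<in> S}"

instance
proof
  show "open (UNIV :: 'a proj set)"
  proof -
    have "{v :: complex ^ 'a. v \<noteq> 0 \<and> proj_pt v \<in> UNIV} = - {0}" by auto
    then show ?thesis by (simp add: open_proj_def open_Compl)
  qed
next
  fix S T :: "'a proj set"
  assume "open S" "open T"
  moreover have "{v :: complex ^ 'a. v \<noteq> 0 \<and> proj_pt v \<in> S \<inter> T}
      = {v. v \<noteq> 0 \<and> proj_pt v \<in> S} \<inter> {v. v \<noteq> 0 \<and> proj_pt v \<in> T}" by auto
  ultimately show "open (S \<inter> T)" by (simp add: open_proj_def open_Int)
next
  fix K :: "'a proj set set"
  assume "\<forall>S\<in>K. open S"
  moreover have "{v :: complex ^ 'a. v \<noteq> 0 \<and> proj_pt v \<in> \<Union>K}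
      = (\<Union>S\<in>K. {v. v \<noteq> 0 \<and> proj_pt v \<in> S})" by auto
  ultimately show "open (\<Union>K)" by (simp add: open_proj_def open_UN)
qed

end

definition homogeneous_polynomial :: "nat \<Rightarrow> (complex ^ 'n \<Rightarrow> complex) \<Rightarrow> bool" where
  "homogeneous_polynomial m F \<longleftrightarrow>
     (\<exists>a. F = (\<lambda>v. \<Sum>k | (\<Sum>i\<in>UNIV. k i) = m. a k * (\<Prod>i\<in>UNIV. (v $ i) ^ k i)))"

definition projective_algebraic_set :: "('n::finite) proj set \<Rightarrow> bool" where
  "projective_algebraic_set X \<longleftrightarrow>
     (\<exists>\<F>. finite \<F> \<and> (\<forall>F\<in>\<F>. \<exists>m. homogeneous_polynomial m F) \<and>
          (\<forall>v. v \<noteq> 0 \<longrightarrow> (proj_pt v \<in> X \<longleftrightarrow> (\<forall>F\<in>\<F>. F v = 0))))"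

text \<open>A chart is a pair of a domain and a coordinate function.\<close>

type_synonym 'n chart = "'n proj set \<times> ('n proj \<Rightarrow> complex)"

definition chart_inv :: "('n::finite) chart \<Rightarrow> complex \<Rightarrow> 'n proj" where
  "chart_inv k = inv_into (fst k) (snd k)"

text \<open>The local holomorphic coordinates of a one-dimensional complex submanifold \<open>X\<close> of
  projective space. In homogeneous coordinates the inverse of a chart has local holomorphic
  lifts \<open>F\<close>; it is an immersion into projective space iff \<open>F\<close> and its derivative
  are linearly independent at each point.\<close>

definition charts :: "('n::finite) proj set \<Rightarrow> 'n chart set" where
  "charts X =
     {k. openin (top_of_set X) (fst k) \<and> open (snd k ` fst k) \<and>
         homeomorphism (fst k) (snd k ` fst k) (snd k) (chart_inv k) \<and>
         (\<forall>\<zeta>\<in>snd k ` fst k. \<exists>D F. open D \<and> \<zeta> \<in> D \<and> D \<subseteq> snd k ` fst k \<and>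
            (\<forall>i. (\<lambda>x. F x $ i) holomorphic_on D) \<and>
            (\<forall>x\<in>D. chart_inv k x = proj_pt (F x) \<and>
               (\<forall>a b. a *s F x + b *s (\<chi> i. deriv (\<lambda>y. F y $ i) x) = 0
                  \<longrightarrow> a = 0 \<and> b = 0)))}"

definition smooth_connected_projective_curve :: "('n::finite) proj set \<Rightarrow> bool" where
  "smooth_connected_projective_curve X \<longleftrightarrow>
     projective_algebraic_set X \<and> connected X \<and> (\<Union>k\<in>charts X. fst k) = X"


section \<open>Differential forms\<close>

text \<open>A complex valued 1-form \<open>\<omega>\<close> is given by its expressions in charts: \<open>\<omega> k p\<close> is the
  real-linear functional on tangent vectors at \<open>p\<close>, which are identified with complex
  numbers by the chart \<open>k\<close>. For example \<open>h dz\<close> is \<open>\<lambda>v. h p * v\<close>.\<close>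

type_synonym 'n form = "'n chart \<Rightarrow> 'n proj \<Rightarrow> complex \<Rightarrow> complex"

definition one_form :: "('n::finite) proj set \<Rightarrow> 'n proj set \<Rightarrow> 'n form \<Rightarrow> bool" where
  "one_form X S \<omega> \<longleftrightarrow>
     (\<forall>k\<in>charts X. \<forall>p\<in>fst k \<inter> S. linear (\<omega> k p)) \<and>
     (\<forall>k\<in>charts X. \<forall>l\<in>charts X. \<forall>p\<in>fst k \<inter> fst l \<inter> S. \<forall>v.
        \<omega> k p v = \<omega> l p (deriv (snd l \<circ> chart_inv k) (snd k p) * v))"

definition form_eq :: "('n::finite) proj set \<Rightarrow> 'n proj set \<Rightarrow> 'n form \<Rightarrow> 'n form \<Rightarrow> bool" where
  "form_eq X S \<omega> \<eta> \<longleftrightarrow> (\<forall>k\<in>charts X. \<forall>p\<in>fst k \<inter> S. \<omega> k p = \<eta> k p)"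

definition form_comb :: "nat \<Rightarrow> (nat \<Rightarrow> complex) \<Rightarrow> (nat \<Rightarrow> ('n::finite) form) \<Rightarrow> 'n form" where
  "form_comb N a \<omega> = (\<lambda>k p v. \<Sum>i\<in>{1..N}. a i * \<omega> i k p v)"

definition holomorphic_form :: "('n::finite) proj set \<Rightarrow> 'n proj set \<Rightarrow> 'n form \<Rightarrow> bool" where
  "holomorphic_form X S \<omega> \<longleftrightarrow> one_form X S \<omega> \<and>
     (\<forall>k\<in>charts X. (\<forall>p\<in>fst k \<inter> S. \<forall>v. \<omega> k p v = \<omega> k p 1 * v) \<and>
        (\<lambda>\<zeta>. \<omega> k (chart_inv k \<zeta>) 1) holomorphic_on (snd k ` (fst k \<inter> S)))"

definition antiholomorphic_form :: "('n::finite) proj set \<Rightarrow> 'n proj set \<Rightarrow> 'n form \<Rightarrow> bool" where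
  "antiholomorphic_form X S \<omega> \<longleftrightarrow> holomorphic_form X S (\<lambda>k p v. cnj (\<omega> k p v))"

definition meromorphic_form :: "('n::finite) proj set \<Rightarrow> 'n form \<Rightarrow> bool" where
  "meromorphic_form X \<omega> \<longleftrightarrow>
     (\<exists>P\<subseteq>X. (\<forall>p\<in>X. \<not> p islimpt P) \<and> holomorphic_form X (X - P) \<omega>) \<and>
     (\<forall>k\<in>charts X. (\<lambda>\<zeta>. \<omega> k (chart_inv k \<zeta>) 1) meromorphic_on (snd k ` fst k))"

text \<open>The genus is the dimension of the space of global holomorphic 1-forms.\<close>

definition has_genus :: "('n::finite) proj set \<Rightarrow> nat \<Rightarrow> bool" where
  "has_genus X g \<longleftrightarrow>
     (\<exists>\<eta>. (\<forall>i\<in>{1..g}. holomorphic_form X X (\<eta> i)) \<and>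
          (\<forall>\<omega>. holomorphic_form X X \<omega> \<longrightarrow>
             (\<exists>!a. (\<forall>i. i \<notin> {1..g} \<longrightarrow> a i = 0) \<and> form_eq X X \<omega> (form_comb g a \<eta>))))"


section \<open>De Rham cohomology\<close>

primrec Ck_on :: "nat \<Rightarrow> (complex \<Rightarrow> complex) \<Rightarrow> complex set \<Rightarrow> bool" where
  "Ck_on 0 f T = continuous_on T f"
| "Ck_on (Suc k) f T =
     ((\<forall>x\<in>T. f differentiable (at x)) \<and> (\<forall>v. Ck_on k (\<lambda>x. frechet_derivative f (at x) v) T))"

definition smooth_on :: "(complex \<Rightarrow> complex) \<Rightarrow> complex set \<Rightarrow> bool" where
  "smooth_on f T \<longleftrightarrow> (\<forall>k. Ck_on k f T)"

text \<open>With \<open>\<omega> = P dx + Q dy\<close> in the coordinate \<open>x + \<i> y\<close>, the values of \<open>\<omega>\<close> on \<open>1\<close> and \<open>\<i>\<close>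
  are \<open>P\<close> and \<open>Q\<close>.\<close>

definition closed_form :: "('n::finite) proj set \<Rightarrow> 'n proj set \<Rightarrow> 'n form \<Rightarrow> bool" where
  "closed_form X S \<omega> \<longleftrightarrow> one_form X S \<omega> \<and>
     (\<forall>k\<in>charts X.
        (\<forall>v. smooth_on (\<lambda>\<zeta>. \<omega> k (chart_inv k \<zeta>) v) (snd k ` (fst k \<inter> S))) \<and>
        (\<forall>\<zeta>\<in>snd k ` (fst k \<inter> S).
           frechet_derivative (\<lambda>x. \<omega> k (chart_inv k x) \<i>) (at \<zeta>) 1 =
           frechet_derivative (\<lambda>x. \<omega> k (chart_inv k x) 1) (at \<zeta>) \<i>))"

definition exact_form :: "('n::finite) proj set \<Rightarrow> 'n proj set \<Rightarrow> 'n form \<Rightarrow> bool" where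
  "exact_form X S \<omega> \<longleftrightarrow>
     (\<exists>f. \<forall>k\<in>charts X. smooth_on (f \<circ> chart_inv k) (snd k ` (fst k \<inter> S)) \<and>
        (\<forall>p\<in>fst k \<inter> S. \<omega> k p = frechet_derivative (f \<circ> chart_inv k) (at (snd k p))))"

text \<open>Equality of classes in the first de Rham cohomology of \<open>S\<close> with complex coefficients.
  Cohomology classes are represented throughout by closed forms.\<close>

definition cohomologous :: "('n::finite) proj set \<Rightarrow> 'n proj set \<Rightarrow> 'n form \<Rightarrow> 'n form \<Rightarrow> bool" where
  "cohomologous X S \<omega> \<eta> \<longleftrightarrow> exact_form X S (\<lambda>k p v. \<omega> k p v - \<eta> k p v)"

definition cohomology_basis ::
    "('n::finite) proj set \<Rightarrow> 'n proj set \<Rightarrow> nat \<Rightarrow> (nat \<Rightarrow> 'n form) \<Rightarrow> bool" where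
  "cohomology_basis X S N \<alpha> \<longleftrightarrow>
     (\<forall>i\<in>{1..N}. closed_form X S (\<alpha> i)) \<and>
     (\<forall>\<eta>. closed_form X S \<eta> \<longrightarrow>
        (\<exists>!a. (\<forall>i. i \<notin> {1..N} \<longrightarrow> a i = 0) \<and> cohomologous X S \<eta> (form_comb N a \<alpha>)))"

text \<open>The coordinates \<open>p\<^sub>i(c)\<close> of the class of \<open>c\<close> in the first cohomology of \<open>X\<close> with respect
  to the basis \<open>d\<close>.\<close>

definition coords :: "('n::finite) proj set \<Rightarrow> nat \<Rightarrow> (nat \<Rightarrow> 'n form) \<Rightarrow> 'n form \<Rightarrow> nat \<Rightarrow> complex" where
  "coords X N d c =
     (THE a. (\<forall>i. i \<notin> {1..N} \<longrightarrow> a i = 0) \<and> cohomologous X X c (form_comb N a d))"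


section \<open>Iterated integrals\<close>

text \<open>Continuous paths that are, on each piece of a finite subdivision, continuously
  differentiable up to and including the end points of the piece.\<close>

definition piecewise_C1_path :: "('n::finite) proj set \<Rightarrow> (real \<Rightarrow> 'n proj) \<Rightarrow> bool" where
  "piecewise_C1_path X \<gamma> \<longleftrightarrow> path \<gamma> \<and> path_image \<gamma> \<subseteq> X \<and>
     (\<exists>N s. s 0 = 0 \<and> s N = 1 \<and>
        (\<forall>j<N. s j < s (Suc j) \<and>
           (\<forall>k\<in>charts X. \<exists>D.
              (\<forall>t\<in>{s j..s (Suc j)} \<inter> \<gamma> -` fst k.
                 (snd k \<circ> \<gamma> has_vector_derivative D t) (at t within {s j..s (Suc j)})) \<and>
              continuous_on ({s j..s (Suc j)} \<inter> \<gamma> -` fst k) D)))"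

text \<open>The coefficient \<open>f(t)\<close> in \<open>\<gamma>\<^sup>*\<omega> = f(t) dt\<close>. It does not depend on the chart; its values at
  the finitely many break points of \<open>\<gamma>\<close> are irrelevant.\<close>

definition pullback :: "('n::finite) proj set \<Rightarrow> (real \<Rightarrow> 'n proj) \<Rightarrow> 'n form \<Rightarrow> real \<Rightarrow> complex" where
  "pullback X \<gamma> \<omega> t =
     (let k = (SOME k. k \<in> charts X \<and> \<gamma> t \<in> fst k)
      in \<omega> k (\<gamma> t) (vector_derivative (snd k \<circ> \<gamma>) (at t)))"

definition iterated_integral ::
    "('n::finite) proj set \<Rightarrow> 'n form list \<Rightarrow> (real \<Rightarrow> 'n proj) \<Rightarrow> complex" where
  "iterated_integral X \<omega>s \<gamma> =
     (LINT t : {t. (\<forall>i<length \<omega>s. 0 \<le> t i \<and> t i \<le> 1) \<and>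
                   (\<forall>j<length \<omega>s. \<forall>i<j. t i \<le> t j)}
             | (\<Pi>\<^sub>M i\<in>{..<length \<omega>s}. lborel).
        (\<Prod>i<length \<omega>s. pullback X \<gamma> (\<omega>s ! i) (t i)))"

text \<open>The fundamental group; the product of two classes runs through the first path first.\<close>

definition fundamental_group ::
    "'a::topological_space set \<Rightarrow> 'a \<Rightarrow> (real \<Rightarrow> 'a) set monoid" where
  "fundamental_group U e =
     \<lparr>carrier = {Collect (homotopic_paths U p) | p.
                  path p \<and> path_image p \<subseteq> U \<and> pathstart p = e \<and> pathfinish p = e},
      monoid.mult = (\<lambda>A B. {r. \<exists>p\<in>A. \<exists>q\<in>B. homotopic_paths U (p +++ q) r}),
      one = Collect (homotopic_paths U (\<lambda>_. e))\<rparr>"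

text \<open>The value on a homotopy class is the common value on its piecewise \<open>C\<^sup>1\<close> members.\<close>

definition class_integral ::
    "('n::finite) proj set \<Rightarrow> 'n form list \<Rightarrow> (real \<Rightarrow> 'n proj) set \<Rightarrow> complex" where
  "class_integral X \<omega>s \<Gamma> =
     (THE I. \<forall>\<gamma>\<in>\<Gamma>. piecewise_C1_path X \<gamma> \<longrightarrow> iterated_integral X \<omega>s \<gamma> = I)"

text \<open>The integral group ring of a group \<open>G\<close>, with underlying additive group the free abelian
  group on the elements of \<open>G\<close>.\<close>

definition group_ring_mult ::
    "('a, 'b) monoid_scheme \<Rightarrow> ('a \<Rightarrow>\<^sub>0 int) \<Rightarrow> ('a \<Rightarrow>\<^sub>0 int) \<Rightarrow> ('a \<Rightarrow>\<^sub>0 int)" where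
  "group_ring_mult G x y =
     frag_extend (\<lambda>a. frag_extend (\<lambda>b. frag_of (a \<otimes>\<^bsub>G\<^esub> b)) y) x"

definition group_ring_prod ::
    "('a, 'b) monoid_scheme \<Rightarrow> ('a \<Rightarrow>\<^sub>0 int) list \<Rightarrow> ('a \<Rightarrow>\<^sub>0 int)" where
  "group_ring_prod G xs = foldr (group_ring_mult G) xs (frag_of \<one>\<^bsub>G\<^esub>)"

definition group_ring_integral ::
    "('n::finite) proj set \<Rightarrow> 'n form list \<Rightarrow> ((real \<Rightarrow> 'n proj) set \<Rightarrow>\<^sub>0 int) \<Rightarrow> complex" where
  "group_ring_integral X \<omega>s x =
     (\<Sum>\<Gamma>\<in>Poly_Mapping.keys x. of_int (Poly_Mapping.lookup x \<Gamma>) * class_integral X \<omega>s \<Gamma>)"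


section \<open>Integral structure, intersection pairing and Hodge classes\<close>

text \<open>A class in the complex cohomology of \<open>X\<close> is integral iff its periods along all loops are
  integers.\<close>

definition integral_form :: "('n::finite) proj set \<Rightarrow> 'n form \<Rightarrow> bool" where
  "integral_form X \<omega> \<longleftrightarrow> closed_form X X \<omega> \<and>
     (\<forall>\<gamma>. piecewise_C1_path X \<gamma> \<and> pathfinish \<gamma> = pathstart \<gamma> \<longrightarrow>
          iterated_integral X [\<omega>] \<gamma> \<in> \<int>)"

definition integral_cohomology_basis ::
    "('n::finite) proj set \<Rightarrow> nat \<Rightarrow> (nat \<Rightarrow> 'n form) \<Rightarrow> bool" where
  "integral_cohomology_basis X N d \<longleftrightarrow>
     (\<forall>i\<in>{1..N}. integral_form X (d i)) \<and>
     (\<forall>\<eta>. integral_form X \<eta> \<longrightarrow>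
        (\<exists>!a. (\<forall>i. i \<notin> {1..N} \<longrightarrow> a i = 0) \<and> (\<forall>i. a i \<in> \<int>) \<and>
              cohomologous X X \<eta> (form_comb N a d)))"

text \<open>A 2-form is given by its density with respect to \<open>dx \<and> dy\<close> in each chart, and is
  integrated by means of a partition of unity.\<close>

definition wedge :: "('n::finite) form \<Rightarrow> 'n form \<Rightarrow> 'n chart \<Rightarrow> 'n proj \<Rightarrow> complex" where
  "wedge \<omega> \<eta> k p = \<omega> k p 1 * \<eta> k p \<i> - \<omega> k p \<i> * \<eta> k p 1"

definition partition_of_unity ::
    "('n::finite) proj set \<Rightarrow> nat \<Rightarrow> (nat \<Rightarrow> 'n chart) \<Rightarrow> (nat \<Rightarrow> 'n proj \<Rightarrow> real) \<Rightarrow> bool" where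
  "partition_of_unity X N k \<rho> \<longleftrightarrow>
     (\<forall>j<N. k j \<in> charts X \<and> continuous_on X (\<rho> j) \<and> (\<forall>p\<in>X. 0 \<le> \<rho> j p) \<and>
        X \<inter> closure {p \<in> X. \<rho> j p \<noteq> 0} \<subseteq> fst (k j)) \<and>
     (\<forall>p\<in>X. (\<Sum>j<N. \<rho> j p) = 1)"

definition surface_integral ::
    "('n::finite) proj set \<Rightarrow> ('n chart \<Rightarrow> 'n proj \<Rightarrow> complex) \<Rightarrow> complex" where
  "surface_integral X \<Omega> =
     (THE I. \<exists>N k \<rho>. partition_of_unity X N k \<rho> \<and>
        I = (\<Sum>j<N. LINT \<zeta> : snd (k j) ` fst (k j) | lborel.
               of_real (\<rho> j (chart_inv (k j) \<zeta>)) * \<Omega> (k j) (chart_inv (k j) \<zeta>)))"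

text \<open>A tensor in the \<open>m\<close>-th tensor power of the first cohomology is given by its coordinates
  \<open>\<lambda>\<^sub>I\<close> with respect to the basis of all \<open>d\<^sub>I\<close>, where \<open>I\<close> is a function on \<open>{1..m}\<close>; so the pure
  tensor of \<open>a\<^sub>1, \<dots>, a\<^sub>m\<close> has the coordinates \<open>\<Prod>\<^sub>k p\<^bsub>I k\<^esub>(a\<^sub>k)\<close>. The tensor is a Hodge class
  if it is rational and of type \<open>(m/2, m/2)\<close>, i.e. a complex linear combination of pure tensors
  with \<open>m/2\<close> factors of type \<open>(1,0)\<close> and \<open>m/2\<close> factors of type \<open>(0,1)\<close>.\<close>

definition multi_indices :: "nat \<Rightarrow> nat \<Rightarrow> (nat \<Rightarrow> nat) set" where
  "multi_indices m N = {1..m} \<rightarrow>\<^sub>E {1..N}"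

definition hodge_class ::
    "('n::finite) proj set \<Rightarrow> nat \<Rightarrow> (nat \<Rightarrow> 'n form) \<Rightarrow> nat \<Rightarrow> ((nat \<Rightarrow> nat) \<Rightarrow> complex) \<Rightarrow> bool" where
  "hodge_class X N d m \<xi> \<longleftrightarrow> even m \<and>
     (\<forall>I\<in>multi_indices m N. \<xi> I \<in> \<rat>) \<and>
     (\<exists>M b T a.
        (\<forall>s<(M::nat). T s \<subseteq> {1..m} \<and> card (T s) = m div 2 \<and>
           (\<forall>k\<in>T s. holomorphic_form X X (a s k)) \<and>
           (\<forall>k\<in>{1..m} - T s. antiholomorphic_form X X (a s k))) \<and>
        (\<forall>I\<in>multi_indices m N.
           \<xi> I = (\<Sum>s<M. b s * (\<Prod>k\<in>{1..m}. coords X N d (a s k) (I k)))))"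


section \<open>The two sides of the formula\<close>

text \<open>Here \<open>p = coords X (2 * g) d c\<close>, and \<open>\<xi>\<close> is the family of coordinates \<open>\<lambda>\<^sub>I(\<xi>)\<close>.\<close>

definition f_xi ::
    "('n::finite) proj set \<Rightarrow> 'n proj set \<Rightarrow> 'n proj \<Rightarrow> nat \<Rightarrow> nat \<Rightarrow> (nat \<Rightarrow> 'n form) \<Rightarrow>
     (nat \<Rightarrow> 'n form) \<Rightarrow> (nat \<Rightarrow> (real \<Rightarrow> 'n proj) set) \<Rightarrow> ((nat \<Rightarrow> nat) \<Rightarrow> complex) \<Rightarrow> 'n form \<Rightarrow> complex"
  where
  "f_xi X U e g n d \<omega> \<beta> \<xi> c =
     (let G = fundamental_group U e; aug = (\<lambda>b. frag_of b - frag_of \<one>\<^bsub>G\<^esub>) in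
      \<Sum>j\<in>{1..2*g}. \<Sum>I\<in>multi_indices (2*n-2) (2*g).
        coords X (2*g) d c j * \<xi> I *
        group_ring_integral X (map (\<lambda>l. \<omega> (I l)) [1..<n+1])
          (group_ring_prod G (map (\<lambda>l. aug (\<beta> (I l))) [n+1..<2*n-1] @ [aug (\<beta> j)])))"

definition mu' ::
    "('n::finite) proj set \<Rightarrow> nat \<Rightarrow> nat \<Rightarrow> (nat \<Rightarrow> 'n form) \<Rightarrow> (nat \<Rightarrow> 'n form) \<Rightarrow>
     (nat \<Rightarrow> (real \<Rightarrow> 'n proj) set) \<Rightarrow> ((nat \<Rightarrow> nat) \<Rightarrow> complex) \<Rightarrow> 'n form \<Rightarrow>
     nat \<Rightarrow> nat \<Rightarrow> nat \<Rightarrow> complex"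
  where
  "mu' X g n d \<omega> \<beta> \<xi> c i j k =
     (\<Sum>r\<in>{1..n-1}.
        \<Sum>I\<in>{I \<in> multi_indices (2*n-1) (2*g). I r = i \<and> I (r+1) = j \<and> I (r+n) = k}.
          \<xi> (restrict I {1..2*n-2}) * coords X (2*g) d c (I (2*n-1)) *
          (\<Prod>l\<in>{1..r-1}. class_integral X [\<omega> (I l)] (\<beta> (I (l+n)))) *
          (\<Prod>l\<in>{r+2..n}. class_integral X [\<omega> (I l)] (\<beta> (I (l+n-1)))))"

end

theory Submission
  imports Defs
begin

text \<open>For holomorphic forms \<open>\<eta>\<^sub>0, \<eta>\<^sub>1, \<dots>\<close> on \<open>U\<close>, a flat section is a sequence of functions with
  \<open>Y\<^sub>0\<close> constant and \<open>dY\<^bsub>i+1\<^esub> = Y\<^sub>i \<eta>\<^sub>i\<close>; such sections form a local system. Its parallel transport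
  along a path computes the iterated integrals of the path, is invariant under homotopy, and gives
  the coproduct formula
  \<open>\<integral>\<^bsub>ab\<^esub> \<omega>\<^sub>1 \<cdots> \<omega>\<^sub>r = \<Sum>\<^sub>j \<integral>\<^sub>a \<omega>\<^sub>1 \<cdots> \<omega>\<^sub>j \<integral>\<^sub>b \<omega>\<^bsub>j+1\<^esub> \<cdots> \<omega>\<^sub>r\<close>.
  Hence in the integral of \<open>n\<close> forms over a product of \<open>n - 1\<close> factors \<open>b - 1\<close> every factor receives
  at least one form, so exactly one factor receives two consecutive forms and every other factor
  receives one. Sorting the terms by the position \<open>r\<close> of the distinguished factor gives the claim.\<close>

section \<open>Charts of a projective curve\<close>

text \<open>\<open>class_integral\<close> is a definite description: it has a meaning only once all
  piecewise C^1 members of a homotopy class have the same integral and at least one such member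
  exists. The homotopies between members are merely continuous, so neither Stokes' theorem nor
  differentiation along a homotopy is available. Transport avoids this: it is defined for continuous
  paths by local agreement with flat sections, is carried over paths and homotopies by connectedness
  of the unit interval, and meets derivatives only when it is compared with
  \<open>iterated_integral\<close> on a piecewise C^1 path. Chart discs are the local domains,
  because there primitives exist and one value determines a flat section. Sections have infinitely
  many components, a finite word being continued by zero forms; the tail
  \<open>\<eta> (j + i)\<close> of a word is then again such a sequence, and the coproduct formula
  is the product of two unipotent transport matrices.\<close>

lemma Rep_proj_pt: "v \<noteq> 0 \<Longrightarrow> Rep_proj (proj_pt v) = range (\<lambda>c. c *s v)"
  unfolding proj_pt_def by (rule Abs_proj_inverse) blast

lemma proj_pt_eqE:
  assumes "v \<noteq> 0" "w \<noteq> 0" "proj_pt v = proj_pt w"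
  obtains c where "c \<noteq> 0" "v = c *s w"
proof -
  have "v = 1 *s v" by simp
  then have "v \<in> Rep_proj (proj_pt v)" unfolding Rep_proj_pt[OF assms(1)] by blast
  then have "v \<in> range (\<lambda>c. c *s w)" using assms Rep_proj_pt by metis
  then obtain c where c: "v = c *s w" by blast
  moreover have "c \<noteq> 0" using c assms(1) by auto
  ultimately show ?thesis using that by blast
qed

lemma proj_pt_exhaust: obtains v where "v \<noteq> 0" "L = proj_pt v"
proof -
  obtain v where "v \<noteq> 0" "Rep_proj L = range (\<lambda>c. c *s v)" using Rep_proj[of L] by blast
  then show ?thesis using that Rep_proj_pt Rep_proj_inject by metis
qed

text \<open>Proportionality to \<open>w\<close> is detected by the 2 x 2 minors that involve one
  coordinate \<open>i\<close> with \<open>w $ i \<noteq> 0\<close>, so away from the point the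
  vectors are given by open conditions. Puncturing the curve at \<open>infty\<close> thus leaves an
  open \<open>U\<close>.\<close>

lemma closed_proj_point: "closed {L :: ('n::finite) proj}"
proof -
  obtain w where w: "w \<noteq> 0" "L = proj_pt w" by (rule proj_pt_exhaust)
  obtain i where i: "w $ i \<noteq> 0" using w(1) by (auto simp: vec_eq_iff)
  have "{v :: complex ^ 'n. v \<noteq> 0 \<and> proj_pt v \<in> - {L}} = {v. v \<noteq> 0} \<inter> (\<Union>j. {v. v $ j * w $ i \<noteq> v $ i * w $ j})"
  proof (intro equalityI subsetI)
    fix v :: "complex ^ 'n" assume v: "v \<in> {v. v \<noteq> 0 \<and> proj_pt v \<in> - {L}}"
    have "\<exists>j. v $ j * w $ i \<noteq> v $ i * w $ j"
    proof (rule ccontr)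
      assume "\<not> ?thesis"
      then have "v = (v $ i / w $ i) *s w" using i by (simp add: vec_eq_iff field_simps)
      moreover from this have "v $ i / w $ i \<noteq> 0" using v by auto
      ultimately obtain c where c: "c \<noteq> 0" "v = c *s w" by blast
      have "range (\<lambda>a. a *s v) = range (\<lambda>a. a *s w)"
      proof (intro equalityI subsetI)
        fix x assume "x \<in> range (\<lambda>a. a *s v)"
        then show "x \<in> range (\<lambda>a. a *s w)" using c by (auto simp: vector_smult_assoc)
      next
        fix x assume "x \<in> range (\<lambda>a. a *s w)"
        then obtain a where "x = a *s w" by blast
        then have "x = (a / c) *s v" using c by (simp add: vector_smult_assoc)
        then show "x \<in> range (\<lambda>a. a *s v)" by blast
      qed
      then have "proj_pt v = L" using w by (simp add: proj_pt_def)
      then show False using v by auto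
    qed
    then show "v \<in> {v. v \<noteq> 0} \<inter> (\<Union>j. {v. v $ j * w $ i \<noteq> v $ i * w $ j})" using v by auto
  next
    fix v :: "complex ^ 'n" assume v: "v \<in> {v. v \<noteq> 0} \<inter> (\<Union>j. {v. v $ j * w $ i \<noteq> v $ i * w $ j})"
    have "proj_pt v \<noteq> L"
    proof
      assume "proj_pt v = L"
      then obtain c where "v = c *s w" using w v by (auto elim: proj_pt_eqE)
      then show False using v by auto
    qed
    then show "v \<in> {v. v \<noteq> 0 \<and> proj_pt v \<in> - {L}}" using v by auto
  qed
  moreover have "open ({v. v \<noteq> 0} \<inter> (\<Union>j. {v :: complex ^ 'n. v $ j * w $ i \<noteq> v $ i * w $ j}))"
    by (intro open_Int open_UN ballI open_Collect_neq continuous_intros)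
  ultimately show ?thesis by (simp add: closed_def open_proj_def)
qed

section \<open>Topology of charts\<close>

lemma chartD:
  assumes "k \<in> charts X"
  shows chart_openin: "openin (top_of_set X) (fst k)"
    and chart_open_image: "open (snd k ` fst k)"
    and chart_homeomorphism: "homeomorphism (fst k) (snd k ` fst k) (snd k) (chart_inv k)"
    and chart_subset: "fst k \<subseteq> X"
  using assms openin_imp_subset unfolding charts_def by blast+

lemma chart_inv_left [simp]: "k \<in> charts X \<Longrightarrow> p \<in> fst k \<Longrightarrow> chart_inv k (snd k p) = p"
  using chart_homeomorphism by (fastforce simp: homeomorphism_def)

lemma chart_inv_right [simp]:
  "k \<in> charts X \<Longrightarrow> \<zeta> \<in> snd k ` fst k \<Longrightarrow> snd k (chart_inv k \<zeta>) = \<zeta>"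
  using chart_homeomorphism by (fastforce simp: homeomorphism_def)

lemma chart_inv_in: "k \<in> charts X \<Longrightarrow> \<zeta> \<in> snd k ` fst k \<Longrightarrow> chart_inv k \<zeta> \<in> fst k"
  by auto

lemma chart_continuous: "k \<in> charts X \<Longrightarrow> continuous_on (fst k) (snd k)"
  using chart_homeomorphism homeomorphism_cont1 by blast

lemma chart_inv_continuous: "k \<in> charts X \<Longrightarrow> continuous_on (snd k ` fst k) (chart_inv k)"
  using chart_homeomorphism homeomorphism_cont2 by blast

lemma chart_image_open:
  assumes k: "k \<in> charts X" and W: "openin (top_of_set X) W"
  shows "open (snd k ` (fst k \<inter> W))"
proof -
  have "openin (top_of_set (fst k)) (fst k \<inter> W)"
    using W chart_subset[OF k] by (metis inf.commute inf.absorb_iff1 openin_subtopology_Int2 subtopology_subtopology)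
  then show ?thesis
    using homeomorphism_imp_open_map[OF chart_homeomorphism[OF k]] chart_open_image[OF k]
    by (metis open_openin openin_open_eq)
qed

lemma chart_inv_image_openin:
  assumes k: "k \<in> charts X" and B: "open B" "B \<subseteq> snd k ` fst k"
  shows "openin (top_of_set X) (chart_inv k ` B)"
proof -
  have "openin (top_of_set (snd k ` fst k)) B"
    using B openin_open_eq[OF chart_open_image[OF k], of B] by blast
  then have "openin (top_of_set (fst k)) (chart_inv k ` B)"
    using homeomorphism_imp_open_map[OF homeomorphism_symD[OF chart_homeomorphism[OF k]]] by blast
  then show ?thesis using chart_openin[OF k] openin_trans by blast
qed

text \<open>The local data over which \<open>charts\<close> quantifies existentially, named so that
  a lift can be fixed near a point; the last clause is the immersion condition.\<close>

definition homogeneous_lift :: "('n::finite) chart \<Rightarrow> complex set \<Rightarrow> (complex \<Rightarrow> complex ^ 'n) \<Rightarrow> bool" where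
  "homogeneous_lift k D F \<longleftrightarrow> open D \<and> D \<subseteq> snd k ` fst k \<and> (\<forall>i. (\<lambda>x. F x $ i) holomorphic_on D) \<and>
     (\<forall>x\<in>D. chart_inv k x = proj_pt (F x) \<and>
        (\<forall>a b. a *s F x + b *s (\<chi> i. deriv (\<lambda>y. F y $ i) x) = 0 \<longrightarrow> a = 0 \<and> b = 0))"

lemma homogeneous_lift_exists:
  assumes "k \<in> charts X" "\<zeta> \<in> snd k ` fst k"
  obtains D F where "homogeneous_lift k D F" "\<zeta> \<in> D"
proof -
  obtain p where p: "p \<in> fst k" "\<zeta> = snd k p" using assms(2) by blast
  with assms(1) have "\<exists>D F. homogeneous_lift k D F \<and> \<zeta> \<in> D"
    unfolding charts_def homogeneous_lift_def by (simp add: conj_ac)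
  then show ?thesis using that by blast
qed

lemma homogeneous_liftD:
  fixes F :: "complex \<Rightarrow> complex ^ 'n::finite"
  assumes "homogeneous_lift k D F"
  shows "open D" "D \<subseteq> snd k ` fst k" "(\<lambda>x. F x $ i) holomorphic_on D"
    "x \<in> D \<Longrightarrow> chart_inv k x = proj_pt (F x)"
    "x \<in> D \<Longrightarrow> a *s F x + b *s (\<chi> i. deriv (\<lambda>y. F y $ i) x) = 0 \<Longrightarrow> a = 0 \<and> b = 0"
  using assms unfolding homogeneous_lift_def by simp_all

text \<open>Wherever \<open>G\<^sub>i \<noteq> 0\<close>, the immersion condition makes some quotient \<open>G\<^sub>j / G\<^sub>i\<close> of
  homogeneous coordinates a local coordinate.\<close>

lemma chart_transition_differentiable:
  fixes X :: "('n::finite) proj set"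
  assumes k: "k \<in> charts X" and l: "l \<in> charts X" and p: "p \<in> fst k" "p \<in> fst l"
  shows "(snd l \<circ> chart_inv k) field_differentiable (at (snd k p))"
proof -
  define z w where "z = snd k p" and "w = snd l p"
  define \<phi> where "\<phi> = snd l \<circ> chart_inv k"
  have z: "z \<in> snd k ` fst k" "chart_inv k z = p" and w: "w \<in> snd l ` fst l" "chart_inv l w = p"
    using p k l by (auto simp: z_def w_def)
  obtain D F where DF: "homogeneous_lift k D F" "z \<in> D"
    using homogeneous_lift_exists[OF k z(1)] .
  note D = homogeneous_liftD(1)[OF DF(1)] DF(2) homogeneous_liftD(2)[OF DF(1)]
    and holF = homogeneous_liftD(3)[OF DF(1)] and F = homogeneous_liftD(4)[OF DF(1)]
    and F' = homogeneous_liftD(5)[OF DF(1)]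
  obtain E G where EG: "homogeneous_lift l E G" "w \<in> E"
    using homogeneous_lift_exists[OF l w(1)] .
  note E = homogeneous_liftD(1)[OF EG(1)] EG(2) homogeneous_liftD(2)[OF EG(1)]
    and holG = homogeneous_liftD(3)[OF EG(1)] and G = homogeneous_liftD(4)[OF EG(1)]
    and G' = homogeneous_liftD(5)[OF EG(1)]
  \<comment> \<open>The immersion condition with coefficients 1 and 0 already says that a lift does
    not vanish.\<close>
  have Fnz: "F x \<noteq> 0" if "x \<in> D" for x
    using F'[OF that, of 1 0] by auto
  have Gnz: "G x \<noteq> 0" if "x \<in> E" for x
    using G'[OF that, of 1 0] by auto
  obtain i where i: "G w $ i \<noteq> 0" using Gnz[OF E(2)] by (auto simp: vec_eq_iff)
  \<comment> \<open>If all these Wronskians vanished, \<open>G\<close> and its derivative would be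
    dependent at \<open>w\<close>, the coefficient of the derivative being \<open>G w $ i\<close>,
    which is nonzero.\<close>
  have "\<exists>j. deriv (\<lambda>y. G y $ j) w * G w $ i \<noteq> G w $ j * deriv (\<lambda>y. G y $ i) w"
  proof (rule ccontr)
    assume "\<not> ?thesis"
    then have "(- deriv (\<lambda>y. G y $ i) w) *s G w + (G w $ i) *s (\<chi> j. deriv (\<lambda>y. G y $ j) w) = 0"
      by (simp add: vec_eq_iff algebra_simps)
    then show False using G'[OF E(2)] i by blast
  qed
  then obtain j where j: "deriv (\<lambda>y. G y $ j) w * G w $ i \<noteq> G w $ j * deriv (\<lambda>y. G y $ i) w" by blast
  define E1 where "E1 = {x \<in> E. G x $ i \<noteq> 0}"
  have E1: "open E1" "w \<in> E1" "E1 \<subseteq> E"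
  proof -
    have "E1 = E \<inter> (\<lambda>x. G x $ i) -` (- {0})" by (auto simp: E1_def)
    then show "open E1"
      using continuous_open_preimage[OF holomorphic_on_imp_continuous_on[OF holG[of i]] E(1)] by auto
  qed (use E i in \<open>auto simp: E1_def\<close>)
  define h where "h = (\<lambda>x. G x $ j / G x $ i)"
  have holh: "h holomorphic_on E1"
    unfolding h_def using E1
    by (intro holomorphic_on_divide holomorphic_on_subset[OF holG]) (auto simp: E1_def)
  have "deriv h w = (deriv (\<lambda>y. G y $ j) w * G w $ i - G w $ j * deriv (\<lambda>y. G y $ i) w) / (G w $ i)^2"
    unfolding h_def
    by (rule deriv_divide) (use holG E i in \<open>auto intro: holomorphic_on_imp_differentiable_at\<close>)
  then have "deriv h w \<noteq> 0" using i j by simp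
  then obtain r where r: "r > 0" "ball w r \<subseteq> E1" "inj_on h (ball w r)"
    using has_complex_derivative_locally_invertible[OF holh E1(2,1)] by blast
  obtain g where g: "g holomorphic_on (h ` ball w r)"
    "\<And>y. y \<in> ball w r \<Longrightarrow> deriv h y * deriv g (h y) = 1" "\<And>y. y \<in> ball w r \<Longrightarrow> g (h y) = y"
    by (rule holomorphic_has_inverse[OF holomorphic_on_subset[OF holh r(2)] open_ball r(3)])
      (rule that; simp)
  have opI: "open (h ` ball w r)"
    using open_mapping_thm3[OF holomorphic_on_subset[OF holh r(2)] open_ball r(3)] .
  define V where "V = snd k ` (fst k \<inter> fst l)"
  have V: "open V" unfolding V_def by (rule chart_image_open[OF k chart_openin[OF l]])
  have zV: "z \<in> V" using p by (auto simp: V_def z_def)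
  have VD: "chart_inv k x \<in> fst l" if "x \<in> V" for x using that k by (auto simp: V_def)
  have cont: "continuous_on V \<phi>"
    unfolding \<phi>_def
    by (rule continuous_on_compose[OF continuous_on_subset[OF chart_inv_continuous[OF k]]
          continuous_on_subset[OF chart_continuous[OF l]]]) (use VD in \<open>auto simp: V_def\<close>)
  have \<phi>z: "\<phi> z = w" by (simp add: \<phi>_def z w_def)
  \<comment> \<open>Only continuity of \<open>\<phi>\<close> is known here; it makes
    \<open>N\<close> a neighbourhood of \<open>z\<close> on which \<open>\<phi>\<close> stays in the
    domain where \<open>h\<close> is invertible.\<close>
  define N where "N = D \<inter> (V \<inter> \<phi> -` ball w r)"
  have N: "open N" "z \<in> N"
    using continuous_open_preimage[OF cont V open_ball[of w r]] D zV r(1) \<phi>z by (auto simp: N_def)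
  define H where "H = (\<lambda>x. F x $ j / F x $ i)"
  have key: "F x $ i \<noteq> 0 \<and> H x = h (\<phi> x)" if x: "x \<in> N" for x
  proof -
    have xE: "\<phi> x \<in> E1" "x \<in> D" using x r(2) by (auto simp: N_def)
    have "chart_inv l (\<phi> x) = chart_inv k x" using x VD[of x] l by (simp add: N_def \<phi>_def)
    then have "proj_pt (F x) = proj_pt (G (\<phi> x))" using F[of x] G[of "\<phi> x"] xE E1(3) by auto
    then obtain c where "c \<noteq> 0" "F x = c *s G (\<phi> x)"
      using Fnz Gnz xE E1(3) by (metis proj_pt_eqE subsetD)
    then show ?thesis using xE by (simp add: H_def h_def E1_def)
  qed
  have holH: "H holomorphic_on N"
    unfolding H_def
    by (intro holomorphic_on_divide holomorphic_on_subset[OF holF]) (use key in \<open>auto simp: N_def\<close>)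
  have imH: "H ` N \<subseteq> h ` ball w r" using key by (auto simp: N_def)
  \<comment> \<open>Ratios of homogeneous coordinates do not see the factor between two lifts, so
    \<open>H = h \<circ> \<phi>\<close> on \<open>N\<close>; with the inverse \<open>g\<close> of
    \<open>h\<close> this exhibits \<open>\<phi>\<close> as the holomorphic function
    \<open>g \<circ> H\<close>.\<close>
  have "(g \<circ> H) holomorphic_on N"
    by (rule holomorphic_on_compose[OF holH holomorphic_on_subset[OF g(1) imH]])
  then have "\<phi> holomorphic_on N"
    by (rule holomorphic_transform) (use key g(3) in \<open>auto simp: N_def\<close>)
  then show ?thesis
    using N holomorphic_on_imp_differentiable_at unfolding \<phi>_def z_def by blast
qed

lemma chart_transition_deriv:
  assumes "k \<in> charts X" "l \<in> charts X" "p \<in> fst k" "p \<in> fst l"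
  shows "((snd l \<circ> chart_inv k) has_field_derivative deriv (snd l \<circ> chart_inv k) (snd k p)) (at (snd k p))"
  using chart_transition_differentiable[OF assms] by (simp add: DERIV_deriv_iff_field_differentiable)

section \<open>Flat sections and parallel transport\<close>

text \<open>Horizontal sections of the unipotent connection whose matrix carries the
  \<open>\<eta> i\<close> next to the diagonal. The derivative at \<open>snd k p\<close> looks at a
  full neighbourhood, so the condition is meant for open \<open>W\<close>. The sequence is infinite
  so that a shift of the forms does not change the shape of the condition.\<close>

definition flat :: "('n::finite) proj set \<Rightarrow> (nat \<Rightarrow> 'n form) \<Rightarrow> 'n proj set \<Rightarrow> ('n proj \<Rightarrow> nat \<Rightarrow> complex) \<Rightarrow> bool" where
  "flat X \<eta> W Y \<longleftrightarrow> (\<exists>c. \<forall>p\<in>W. Y p 0 = c) \<and>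
     (\<forall>k\<in>charts X. \<forall>p\<in>W \<inter> fst k. \<forall>i.
        ((\<lambda>\<zeta>. Y (chart_inv k \<zeta>) (Suc i)) has_field_derivative Y p i * \<eta> i k p 1) (at (snd k p)))"

text \<open>Convexity of the disc in one coordinate supplies primitives and makes functions with
  zero derivative constant. Hence a flat section on such a set exists and is fixed by its value at
  one point.\<close>

definition chart_disc :: "('n::finite) proj set \<Rightarrow> 'n proj set \<Rightarrow> 'n proj set \<Rightarrow> bool" where
  "chart_disc X U D \<longleftrightarrow> (\<exists>k\<in>charts X. \<exists>a r. r > 0 \<and> ball a r \<subseteq> snd k ` (fst k \<inter> U) \<and> D = chart_inv k ` ball a r)"

text \<open>\<open>L\<close> is locally a flat section composed with \<open>h\<close>. No derivative
  of \<open>h\<close> enters, so continuous paths and the slices of a continuous homotopy are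
  covered; \<open>S\<close> is arbitrary so that pieces can be restricted and glued.\<close>

definition parallel ::
    "('n::finite) proj set \<Rightarrow> 'n proj set \<Rightarrow> (nat \<Rightarrow> 'n form) \<Rightarrow> real set \<Rightarrow> (real \<Rightarrow> 'n proj) \<Rightarrow> (real \<Rightarrow> nat \<Rightarrow> complex) \<Rightarrow> bool" where
  "parallel X U \<eta> S h L \<longleftrightarrow> (\<forall>t\<in>S. \<exists>D Y N. chart_disc X U D \<and> flat X \<eta> D Y \<and> open N \<and> t \<in> N \<and>
     (\<forall>s\<in>N \<inter> S. h s \<in> D \<and> L s = Y (h s)))"

locale open_curve =
  fixes X U :: "('n::finite) proj set"
  assumes charts_cover: "(\<Union>k\<in>charts X. fst k) = X"
    and open_U: "openin (top_of_set X) U"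
begin

lemma U_subset: "U \<subseteq> X"
  using open_U openin_imp_subset by blast

lemma chart_at:
  assumes "p \<in> U"
  obtains k where "k \<in> charts X" "p \<in> fst k"
  using assms charts_cover U_subset by blast

lemma chart_discE:
  assumes "chart_disc X U D"
  obtains k a r where "k \<in> charts X" "r > 0" "ball a r \<subseteq> snd k ` (fst k \<inter> U)" "D = chart_inv k ` ball a r"
    "\<forall>p\<in>D. p \<in> U \<and> p \<in> fst k \<and> snd k p \<in> ball a r"
proof -
  obtain k a r where k: "k \<in> charts X" "r > 0" "ball a r \<subseteq> snd k ` (fst k \<inter> U)" "D = chart_inv k ` ball a r"
    using assms unfolding chart_disc_def by blast
  have "p \<in> U \<and> p \<in> fst k \<and> snd k p \<in> ball a r" if "p \<in> D" for p
  proof -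
    obtain z where z: "z \<in> ball a r" "p = chart_inv k z" using \<open>p \<in> D\<close> k(4) by blast
    then obtain q where q: "q \<in> fst k \<inter> U" "z = snd k q" using k(3) by blast
    then show ?thesis using z k(1) by simp
  qed
  then show ?thesis by (intro that[OF k]) blast
qed

lemma chart_disc_openin:
  assumes "chart_disc X U D"
  shows "openin (top_of_set X) D"
proof -
  obtain k a r where k: "k \<in> charts X" "r > 0" "ball a r \<subseteq> snd k ` (fst k \<inter> U)" "D = chart_inv k ` ball a r"
    "\<forall>p\<in>D. p \<in> U \<and> p \<in> fst k \<and> snd k p \<in> ball a r"
    using chart_discE[OF assms] .
  have "ball a r \<subseteq> snd k ` fst k" using k(3) by blast
  then show ?thesis using chart_inv_image_openin[OF k(1) open_ball] k(4) by simp
qed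

lemma chart_disc_subset:
  assumes "chart_disc X U D"
  shows "D \<subseteq> U"
proof -
  obtain k a r where "k \<in> charts X" "r > 0" "ball a r \<subseteq> snd k ` (fst k \<inter> U)" "D = chart_inv k ` ball a r"
    and D: "\<forall>p\<in>D. p \<in> U \<and> p \<in> fst k \<and> snd k p \<in> ball a r"
    using chart_discE[OF assms] .
  show ?thesis using D by blast
qed

lemma chart_disc_exists:
  assumes x: "x \<in> W" and W: "openin (top_of_set X) W" "W \<subseteq> U"
  shows "\<exists>D. chart_disc X U D \<and> x \<in> D \<and> D \<subseteq> W"
proof -
  obtain k where k: "k \<in> charts X" "x \<in> fst k" using chart_at x W(2) by blast
  have "open (snd k ` (fst k \<inter> W))" using chart_image_open[OF k(1) W(1)] .
  moreover have "snd k x \<in> snd k ` (fst k \<inter> W)" using k x by blast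
  ultimately obtain r where r: "r > 0" "ball (snd k x) r \<subseteq> snd k ` (fst k \<inter> W)"
    using open_contains_ball by blast
  have "chart_disc X U (chart_inv k ` ball (snd k x) r)"
    unfolding chart_disc_def using k(1) r W(2) by blast
  moreover have "x \<in> chart_inv k ` ball (snd k x) r"
    using k r(1) by (intro image_eqI[of _ _ "snd k x"]) auto
  moreover have "chart_inv k ` ball (snd k x) r \<subseteq> W"
  proof
    fix p assume "p \<in> chart_inv k ` ball (snd k x) r"
    then obtain z where z: "z \<in> ball (snd k x) r" "p = chart_inv k z" by blast
    then obtain q where "q \<in> fst k \<inter> W" "z = snd k q" using r(2) by blast
    then show "p \<in> W" using z k(1) by simp
  qed
  ultimately show ?thesis by blast
qed

section \<open>Local theory of flat sections\<close>

lemma flat_mono: "flat X \<eta> W Y \<Longrightarrow> V \<subseteq> W \<Longrightarrow> flat X \<eta> V Y"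
  unfolding flat_def by blast

lemma holomorphic_formD:
  assumes "holomorphic_form X U \<eta>" "k \<in> charts X"
  shows "\<And>p v. p \<in> fst k \<inter> U \<Longrightarrow> \<eta> k p v = \<eta> k p 1 * v"
    and "(\<lambda>\<zeta>. \<eta> k (chart_inv k \<zeta>) 1) holomorphic_on (snd k ` (fst k \<inter> U))"
    and "\<And>l p v. l \<in> charts X \<Longrightarrow> p \<in> fst k \<inter> fst l \<inter> U \<Longrightarrow>
           \<eta> k p v = \<eta> l p (deriv (snd l \<circ> chart_inv k) (snd k p) * v)"
  using assms unfolding holomorphic_form_def one_form_def by blast+

text \<open>The system is triangular: on a disc each component is a primitive of the previous one
  times a holomorphic coefficient, and the constants of integration realize any value
  \<open>v\<close>. The transformation law of 1-forms carries the equations from the coordinate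
  \<open>k\<close> to all other charts.\<close>

lemma flat_exists:
  assumes \<eta>: "\<forall>i. holomorphic_form X U (\<eta> i)" and D: "chart_disc X U D" and y: "y \<in> D"
  shows "\<exists>Y. flat X \<eta> D Y \<and> Y y = v"
proof -
  obtain k a r where k: "k \<in> charts X" "r > 0" "ball a r \<subseteq> snd k ` (fst k \<inter> U)" "D = chart_inv k ` ball a r"
    and Dk: "\<forall>p\<in>D. p \<in> U \<and> p \<in> fst k \<and> snd k p \<in> ball a r"
    using chart_discE[OF D] .
  define c where "c = (\<lambda>i \<zeta>. \<eta> i k (chart_inv k \<zeta>) 1)"
  have c: "c i holomorphic_on ball a r" for i
    unfolding c_def using holomorphic_on_subset[OF holomorphic_formD(2)[OF \<eta>[rule_format] k(1)] k(3)] .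
  define b where "b = snd k y"
  have b: "b \<in> ball a r" using Dk y by (simp add: b_def)
  \<comment> \<open>The last clause retains, through the dependent choice, that component 0 is
    constant, as \<open>flat\<close> demands.\<close>
  define P where "P = (\<lambda>n f. f holomorphic_on ball a r \<and> f b = v n \<and> (n = 0 \<longrightarrow> f = (\<lambda>_. v 0)))"
  define Q where "Q = (\<lambda>n f g. \<forall>x\<in>ball a r. (g has_field_derivative f x * c n x) (at x))"
  have "\<exists>F. \<forall>n. P n (F n) \<and> Q n (F n) (F (Suc n))"
  proof (rule dependent_nat_choice)
    show "\<exists>f. P 0 f" by (intro exI[of _ "\<lambda>_. v 0"]) (simp add: P_def)
  next
    fix f n assume "P n f"
    then have "(\<lambda>x. f x * c n x) holomorphic_on ball a r"
      using c by (auto simp: P_def intro: holomorphic_on_mult)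
    then obtain g where g: "\<And>x. x \<in> ball a r \<Longrightarrow> (g has_field_derivative f x * c n x) (at x within ball a r)"
      by (rule holomorphic_convex_primitive'[OF convex_ball open_ball]) (rule that, blast)
    define g' where "g' = (\<lambda>x. g x + (v (Suc n) - g b))"
    have g': "(g' has_field_derivative f x * c n x) (at x)" if "x \<in> ball a r" for x
      unfolding g'_def using g[OF that] at_within_open[OF that open_ball]
      by (auto intro!: derivative_eq_intros)
    then have "g' holomorphic_on ball a r"
      unfolding holomorphic_on_open[OF open_ball] by blast
    then have "P (Suc n) g' \<and> Q n f g'" using g' by (simp add: P_def Q_def g'_def)
    then show "\<exists>g. P (Suc n) g \<and> Q n f g" by blast
  qed
  then obtain F where F: "\<And>n. P n (F n)" "\<And>n. Q n (F n) (F (Suc n))" by blast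
  define Y where "Y = (\<lambda>p i. F i (snd k p))"
  have "Y y = v" using F(1) by (auto simp: Y_def P_def b_def)
  moreover have "flat X \<eta> D Y"
    unfolding flat_def
  proof (intro conjI ballI allI)
    show "\<exists>c. \<forall>p\<in>D. Y p 0 = c" using F(1)[of 0] by (auto simp: P_def Y_def)
  next
    fix l p i assume l: "l \<in> charts X" and p: "p \<in> D \<inter> fst l"
    have pk: "p \<in> U" "p \<in> fst k" "snd k p \<in> ball a r" using Dk p by auto
    have 1: "(F (Suc i) has_field_derivative F i (snd k p) * c i (snd k p)) (at ((snd k \<circ> chart_inv l) (snd l p)))"
      using F(2)[of i] pk l p by (simp add: Q_def)
    have "((\<lambda>\<zeta>. F (Suc i) ((snd k \<circ> chart_inv l) \<zeta>)) has_field_derivative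
        F i (snd k p) * c i (snd k p) * deriv (snd k \<circ> chart_inv l) (snd l p)) (at (snd l p))"
      using DERIV_chain2[OF 1 chart_transition_deriv[OF l k(1)]] pk p by blast
    moreover have "\<eta> i l p 1 = c i (snd k p) * deriv (snd k \<circ> chart_inv l) (snd l p)"
      using holomorphic_formD(3)[OF \<eta>[rule_format, of i] l k(1), of p 1] holomorphic_formD(1)[OF \<eta>[rule_format, of i] k(1), of p "deriv (snd k \<circ> chart_inv l) (snd l p)"] pk p k(1)
      by (simp add: c_def)
    ultimately show "((\<lambda>\<zeta>. Y (chart_inv l \<zeta>) (Suc i)) has_field_derivative Y p i * \<eta> i l p 1) (at (snd l p))"
      by (simp add: Y_def mult.assoc)
  qed
  ultimately show ?thesis by blast
qed

text \<open>Once the components \<open>i\<close> agree, the difference of the next components has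
  derivative zero on a convex disc; it is constant and vanishes at \<open>y\<close>.\<close>

lemma flat_unique:
  assumes D: "chart_disc X U D" and Y: "flat X \<eta> D Y" "flat X \<eta> D Y'"
    and y: "y \<in> D" "Y y = Y' y" and p: "p \<in> D"
  shows "Y p = Y' p"
proof
  fix i
  obtain k a r where k: "k \<in> charts X" "r > 0" "ball a r \<subseteq> snd k ` (fst k \<inter> U)" "D = chart_inv k ` ball a r"
    and Dk: "\<forall>p\<in>D. p \<in> U \<and> p \<in> fst k \<and> snd k p \<in> ball a r"
    using chart_discE[OF D] .
  have "\<forall>p\<in>D. Y p i = Y' p i"
  proof (induction i)
    case 0
    show ?case using Y y unfolding flat_def by metis
  next
    case (Suc i)
    define f where "f = (\<lambda>\<zeta>. Y (chart_inv k \<zeta>) (Suc i) - Y' (chart_inv k \<zeta>) (Suc i))"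
    have "(f has_field_derivative 0) (at x within ball a r)" if x: "x \<in> ball a r" for x
    proof -
      define q where "q = chart_inv k x"
      have q: "q \<in> D" "q \<in> fst k" "snd k q = x" using x k Dk by (auto simp: q_def)
      have "(f has_field_derivative Y q i * \<eta> i k q 1 - Y' q i * \<eta> i k q 1) (at (snd k q))"
        unfolding f_def using Y q k(1) by (intro DERIV_diff) (auto simp: flat_def)
      then show ?thesis using Suc q by (auto intro: has_field_derivative_at_within)
    qed
    then obtain c where c: "\<And>x. x \<in> ball a r \<Longrightarrow> f x = c"
      using has_field_derivative_zero_constant[OF convex_ball] by metis
    have "f (snd k p) = f (snd k y)" if "p \<in> D" for p using c Dk that y by metis
    then show ?case using Dk y k(1) by (auto simp: f_def)
  qed
  then show "Y p i = Y' p i" using p by blast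
qed

text \<open>Differentiating the term with index \<open>j\<close> lowers the component
  \<open>m - j\<close> by one and produces the form with number \<open>j + (m - 1 - j)\<close>,
  which does not depend on \<open>j\<close>. This row-times-matrix product is the source of the
  coproduct formula.\<close>

lemma flat_convolution:
  assumes D: "openin (top_of_set X) D" and Z: "\<And>j. flat X (\<lambda>i. \<eta> (j + i)) D (Z j)"
  shows "flat X \<eta> D (\<lambda>p m. \<Sum>j\<le>m. v j * Z j p (m - j))"
  unfolding flat_def
proof (intro conjI ballI allI)
  show "\<exists>c. \<forall>p\<in>D. (\<Sum>j\<le>0. v j * Z j p (0 - j)) = c" using Z[of 0] by (auto simp: flat_def)
next
  fix k p i assume k: "k \<in> charts X" and p: "p \<in> D \<inter> fst k"
  have op: "open (snd k ` (fst k \<inter> D))" by (rule chart_image_open[OF k D])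
  obtain c where c: "\<And>q. q \<in> D \<Longrightarrow> Z (Suc i) q 0 = c" using Z[of "Suc i"] by (auto simp: flat_def)
  \<comment> \<open>The new last term, where \<open>Z\<close> has component 0, is constant on
    \<open>D\<close> only, so its derivative is taken inside the open coordinate image of
    \<open>D\<close>.\<close>
  have 1: "((\<lambda>\<zeta>. Z (Suc i) (chart_inv k \<zeta>) 0) has_field_derivative 0) (at (snd k p))"
    by (rule has_field_derivative_transform_within_open[OF DERIV_const op]) (use c k p in auto)
  have 2: "((\<lambda>\<zeta>. Z j (chart_inv k \<zeta>) (Suc (i - j))) has_field_derivative Z j p (i - j) * \<eta> i k p 1) (at (snd k p))"
    if "j \<le> i" for j
  proof -
    have "((\<lambda>\<zeta>. Z j (chart_inv k \<zeta>) (Suc (i - j))) has_field_derivative Z j p (i - j) * \<eta> (j + (i - j)) k p 1) (at (snd k p))"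
      using Z[of j] k p unfolding flat_def by blast
    then show ?thesis using that by simp
  qed
  have "((\<lambda>\<zeta>. (\<Sum>j\<le>i. v j * Z j (chart_inv k \<zeta>) (Suc (i - j))) + v (Suc i) * Z (Suc i) (chart_inv k \<zeta>) 0)
     has_field_derivative (\<Sum>j\<le>i. v j * (Z j p (i - j) * \<eta> i k p 1)) + v (Suc i) * 0) (at (snd k p))"
    by (intro DERIV_add DERIV_sum DERIV_cmult 1 2) auto
  then show "((\<lambda>\<zeta>. \<Sum>j\<le>Suc i. v j * Z j (chart_inv k \<zeta>) (Suc i - j)) has_field_derivative
      (\<Sum>j\<le>i. v j * Z j p (i - j)) * \<eta> i k p 1) (at (snd k p))"
    by (simp add: sum_distrib_right mult.assoc Suc_diff_le)
qed

section \<open>Continuation of flat sections along paths\<close>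

lemma parallelD:
  assumes "parallel X U \<eta> S h L" "t \<in> S"
  shows "\<exists>D Y N. chart_disc X U D \<and> flat X \<eta> D Y \<and> open N \<and> t \<in> N \<and> (\<forall>s\<in>N \<inter> S. h s \<in> D \<and> L s = Y (h s))"
  using assms unfolding parallel_def by (rule bspec)

lemma parallelI:
  assumes "\<And>t. t \<in> S \<Longrightarrow> \<exists>D Y N. chart_disc X U D \<and> flat X \<eta> D Y \<and> open N \<and> t \<in> N \<and> (\<forall>s\<in>N \<inter> S. h s \<in> D \<and> L s = Y (h s))"
  shows "parallel X U \<eta> S h L"
  using assms unfolding parallel_def by (rule ballI)

lemma parallel_subset:
  assumes "parallel X U \<eta> S h L" "T \<subseteq> S"
  shows "parallel X U \<eta> T h L"
proof (rule parallelI)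
  fix t assume "t \<in> T"
  then have "t \<in> S" using assms(2) by blast
  then obtain D Y N where N: "chart_disc X U D" "flat X \<eta> D Y" "open N" "t \<in> N" "\<forall>s\<in>N \<inter> S. h s \<in> D \<and> L s = Y (h s)"
    using parallelD[OF assms(1)] by metis
  have "\<forall>s\<in>N \<inter> T. h s \<in> D \<and> L s = Y (h s)" using N(5) assms(2) by auto
  then show "\<exists>D Y N. chart_disc X U D \<and> flat X \<eta> D Y \<and> open N \<and> t \<in> N \<and> (\<forall>s\<in>N \<inter> T. h s \<in> D \<and> L s = Y (h s))"
    using N(1-4) by metis
qed

lemma parallel_cong:
  assumes "parallel X U \<eta> S h L" "\<And>s. s \<in> S \<Longrightarrow> h s = h' s" "\<And>s. s \<in> S \<Longrightarrow> L s = L' s"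
  shows "parallel X U \<eta> S h' L'"
proof (rule parallelI)
  fix t assume "t \<in> S"
  then obtain D Y N where N: "chart_disc X U D" "flat X \<eta> D Y" "open N" "t \<in> N" "\<forall>s\<in>N \<inter> S. h s \<in> D \<and> L s = Y (h s)"
    using parallelD[OF assms(1)] by metis
  have "\<forall>s\<in>N \<inter> S. h' s \<in> D \<and> L' s = Y (h' s)" using N(5) assms(2,3) by auto
  then show "\<exists>D Y N. chart_disc X U D \<and> flat X \<eta> D Y \<and> open N \<and> t \<in> N \<and> (\<forall>s\<in>N \<inter> S. h' s \<in> D \<and> L' s = Y (h' s))"
    using N(1-4) by metis
qed

lemma parallel_compose:
  assumes L: "parallel X U \<eta> S h L" and \<phi>: "continuous_on T \<phi>" "\<phi> ` T \<subseteq> S"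
  shows "parallel X U \<eta> T (h \<circ> \<phi>) (L \<circ> \<phi>)"
  unfolding parallel_def
proof
  fix t assume t: "t \<in> T"
  then have "\<phi> t \<in> S" using \<phi>(2) by blast
  then obtain D Y N where N: "chart_disc X U D" "flat X \<eta> D Y" "open N" "\<phi> t \<in> N"
    "\<forall>s\<in>N \<inter> S. h s \<in> D \<and> L s = Y (h s)"
    using parallelD[OF L] by metis
  obtain N' where N': "open N'" "N' \<inter> T = \<phi> -` N \<inter> T"
    using \<phi>(1) N(3) unfolding continuous_on_open_invariant by metis
  show "\<exists>D Y N. chart_disc X U D \<and> flat X \<eta> D Y \<and> open N \<and> t \<in> N \<and>
     (\<forall>s\<in>N \<inter> T. (h \<circ> \<phi>) s \<in> D \<and> (L \<circ> \<phi>) s = Y ((h \<circ> \<phi>) s))"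
  proof (rule exI[of _ D], rule exI[of _ Y], rule exI[of _ N'], intro conjI ballI)
    show "t \<in> N'" using N' t N(4) by blast
    fix s assume "s \<in> N' \<inter> T"
    then have "\<phi> s \<in> N \<inter> S" using N' \<phi>(2) by blast
    then show "(h \<circ> \<phi>) s \<in> D" "(L \<circ> \<phi>) s = Y ((h \<circ> \<phi>) s)" using N(5) by auto
  qed (use N N' in auto)
qed

lemma preimage_nhd:
  assumes h: "continuous_on S h" "h ` S \<subseteq> X" and W: "openin (top_of_set X) W"
  shows "\<exists>N. open N \<and> (\<forall>s\<in>S. s \<in> N \<longleftrightarrow> h s \<in> W)"
proof -
  obtain W' where W': "open W'" "W = X \<inter> W'" using W by (auto simp: openin_open)
  obtain N where "open N" "N \<inter> S = h -` W' \<inter> S"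
    using h(1) W'(1) unfolding continuous_on_open_invariant by metis
  moreover have "\<forall>s\<in>S. s \<in> N \<longleftrightarrow> h s \<in> W" using calculation(2) W'(2) h(2) by auto
  ultimately show ?thesis by blast
qed

text \<open>The local sections defining \<open>L\<close> may live on different discs. Two flat
  sections that agree at one point of a common disc agree on it, so agreement with a single section
  on \<open>D\<close> spreads over the connected set \<open>S\<close>.\<close>

lemma parallel_disc:
  assumes \<eta>: "\<forall>i. holomorphic_form X U (\<eta> i)" and L: "parallel X U \<eta> S h L"
    and S: "connected S" and h: "continuous_on S h" and D: "chart_disc X U D" "h ` S \<subseteq> D"
  shows "\<exists>Y. flat X \<eta> D Y \<and> (\<forall>s\<in>S. L s = Y (h s))"
proof (cases "S = {}")
  case True
  obtain y where "y \<in> D" using D(1) unfolding chart_disc_def by fastforce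
  then obtain Y where "flat X \<eta> D Y" using flat_exists[OF \<eta> D(1), where y = y and v = "\<lambda>_. 0"] by blast
  then show ?thesis using True by blast
next
  case False
  then obtain t where t: "t \<in> S" by blast
  have "h t \<in> D" using D(2) t by blast
  then obtain Y where Y: "flat X \<eta> D Y" "Y (h t) = L t"
    using flat_exists[OF \<eta> D(1), where y = "h t" and v = "L t"] by blast
  have hX: "h ` S \<subseteq> X" using D chart_disc_subset U_subset by blast
  have "L s = Y (h s)" if s: "s \<in> S" for s
  proof (rule connected_induction_simple[OF S t s, where P = "\<lambda>s. L s = Y (h s)"])
    show "L t = Y (h t)" using Y by simp
  next
    fix a assume a: "a \<in> S"
    then obtain D' Y' N where N: "chart_disc X U D'" "flat X \<eta> D' Y'" "open N" "a \<in> N"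
      "\<forall>s\<in>N \<inter> S. h s \<in> D' \<and> L s = Y' (h s)"
      using parallelD[OF L] by metis
    \<comment> \<open>The intersection of two chart discs can be disconnected; the comparison is
      made on a smaller disc \<open>E\<close> around \<open>h a\<close>.\<close>
    have "h a \<in> D \<inter> D'" using a D N by blast
    moreover have "openin (top_of_set X) (D \<inter> D')" using D N chart_disc_openin by blast
    moreover have "D \<inter> D' \<subseteq> U" using D(1) chart_disc_subset by blast
    ultimately obtain E where E: "chart_disc X U E" "h a \<in> E" "E \<subseteq> D \<inter> D'"
      using chart_disc_exists by metis
    obtain M where M: "open M" "\<forall>s\<in>S. s \<in> M \<longleftrightarrow> h s \<in> E"
      using preimage_nhd[OF h hX chart_disc_openin[OF E(1)]] by blast
    have eq: "Y p = Y' p" if "q \<in> E" "p \<in> E" "Y q = Y' q" for p q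
      using flat_unique[OF E(1) flat_mono[OF Y(1)] flat_mono[OF N(2)]] that E by blast
    show "\<exists>T. openin (top_of_set S) T \<and> a \<in> T \<and> (\<forall>x\<in>T. \<forall>y\<in>T. L x = Y (h x) \<longrightarrow> L y = Y (h y))"
    proof (intro exI[of _ "S \<inter> (N \<inter> M)"] conjI ballI impI)
      show "openin (top_of_set S) (S \<inter> (N \<inter> M))" using N(3) M(1) by (intro openin_open_Int open_Int)
      show "a \<in> S \<inter> (N \<inter> M)" using a N M E by blast
      fix x y assume "x \<in> S \<inter> (N \<inter> M)" "y \<in> S \<inter> (N \<inter> M)" "L x = Y (h x)"
      then show "L y = Y (h y)" using N(5) M(2) eq by (metis Int_iff)
    qed
  qed
  then show ?thesis using Y(1) by blast
qed

text \<open>Only the parameter \<open>x\<close> needs an argument: the flat sections on its two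
  sides take the same value at \<open>h x\<close>, hence coincide on a disc inside both
  domains.\<close>

lemma parallel_join:
  assumes L: "parallel X U \<eta> {a..x} h L1" "parallel X U \<eta> {x..b} h L2" and eq: "L1 x = L2 x"
    and x: "a \<le> x" "x \<le> b" and h: "continuous_on {a..b} h"
  shows "parallel X U \<eta> {a..b} h (\<lambda>s. if s \<le> x then L1 s else L2 s)"
  unfolding parallel_def
proof
  fix t assume t: "t \<in> {a..b}"
  have hX: "h ` {a..b} \<subseteq> X"
  proof
    fix q assume "q \<in> h ` {a..b}"
    then obtain s where s: "s \<in> {a..x} \<or> s \<in> {x..b}" "q = h s" by fastforce
    then have "h s \<in> U" using parallelD[OF L(1), of s] parallelD[OF L(2), of s] chart_disc_subset by (meson IntI subsetD)
    then show "q \<in> X" using s U_subset by blast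
  qed
  consider "t < x" | "t > x" | "t = x" by linarith
  then show "\<exists>D Y N. chart_disc X U D \<and> flat X \<eta> D Y \<and> open N \<and> t \<in> N \<and>
     (\<forall>s\<in>N \<inter> {a..b}. h s \<in> D \<and> (if s \<le> x then L1 s else L2 s) = Y (h s))"
  proof cases
    case 1
    then have "t \<in> {a..x}" using t by auto
    then obtain D Y N where N: "chart_disc X U D" "flat X \<eta> D Y" "open N" "t \<in> N"
      "\<forall>s\<in>N \<inter> {a..x}. h s \<in> D \<and> L1 s = Y (h s)"
      using parallelD[OF L(1)] by metis
    show ?thesis
      by (rule exI[of _ D], rule exI[of _ Y], rule exI[of _ "N \<inter> {..<x}"]) (use N 1 in auto)
  next
    case 2
    then have "t \<in> {x..b}" using t by auto
    then obtain D Y N where N: "chart_disc X U D" "flat X \<eta> D Y" "open N" "t \<in> N"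
      "\<forall>s\<in>N \<inter> {x..b}. h s \<in> D \<and> L2 s = Y (h s)"
      using parallelD[OF L(2)] by metis
    show ?thesis
      by (rule exI[of _ D], rule exI[of _ Y], rule exI[of _ "N \<inter> {x<..}"]) (use N 2 in auto)
  next
    case 3
    have "x \<in> {a..x}" "x \<in> {x..b}" using x by auto
    obtain D1 Y1 N1 where N1: "chart_disc X U D1" "flat X \<eta> D1 Y1" "open N1" "x \<in> N1"
      "\<forall>s\<in>N1 \<inter> {a..x}. h s \<in> D1 \<and> L1 s = Y1 (h s)"
      using parallelD[OF L(1) \<open>x \<in> {a..x}\<close>] by metis
    obtain D2 Y2 N2 where N2: "chart_disc X U D2" "flat X \<eta> D2 Y2" "open N2" "x \<in> N2"
      "\<forall>s\<in>N2 \<inter> {x..b}. h s \<in> D2 \<and> L2 s = Y2 (h s)"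
      using parallelD[OF L(2) \<open>x \<in> {x..b}\<close>] by metis
    have hx: "h x \<in> D1 \<inter> D2" using N1(4,5) N2(4,5) x by auto
    obtain E where E: "chart_disc X U E" "h x \<in> E" "E \<subseteq> D1 \<inter> D2"
      using chart_disc_exists[OF hx] chart_disc_openin[OF N1(1)] chart_disc_openin[OF N2(1)] chart_disc_subset[OF N1(1)]
      by (metis inf.coboundedI1 openin_Int)
    obtain M where M: "open M" "\<forall>s\<in>{a..b}. s \<in> M \<longleftrightarrow> h s \<in> E"
      using preimage_nhd[OF h hX chart_disc_openin[OF E(1)]] by blast
    have "Y1 (h x) = L1 x" "Y2 (h x) = L2 x" using N1(4,5) N2(4,5) x by auto
    then have "Y1 (h x) = Y2 (h x)" using eq by simp
    then have Y12: "Y1 p = Y2 p" if "p \<in> E" for p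
      using flat_unique[OF E(1) flat_mono[OF N1(2)] flat_mono[OF N2(2)] E(2)] E(3) that by blast
    have E1: "flat X \<eta> E Y1" using flat_mono[OF N1(2)] E(3) by blast
    show ?thesis
    proof (rule exI[of _ E], rule exI[of _ Y1], rule exI[of _ "N1 \<inter> N2 \<inter> M"], intro conjI ballI)
      show "t \<in> N1 \<inter> N2 \<inter> M" using 3 N1 N2 M E x by auto
      fix s assume s: "s \<in> N1 \<inter> N2 \<inter> M \<inter> {a..b}"
      then show hs: "h s \<in> E" using M by blast
      show "(if s \<le> x then L1 s else L2 s) = Y1 (h s)"
        using s N1(5) N2(5) Y12[OF hs] by auto
    qed (use E E1 N1 N2 M in auto)
  qed
qed

lemma parallel_flat:
  assumes "chart_disc X U D" "flat X \<eta> D Y" "h ` S \<subseteq> D"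
  shows "parallel X U \<eta> S h (\<lambda>s. Y (h s))"
  unfolding parallel_def
proof
  fix t assume "t \<in> S"
  show "\<exists>D Y' N. chart_disc X U D \<and> flat X \<eta> D Y' \<and> open N \<and> t \<in> N \<and> (\<forall>s\<in>N \<inter> S. h s \<in> D \<and> Y (h s) = Y' (h s))"
    by (rule exI[of _ D], rule exI[of _ Y], rule exI[of _ UNIV]) (use assms in auto)
qed

text \<open>The parameters up to which transport exists are compared within an interval whose image
  lies in one disc: transport is restricted when moving back, and prolonged by the flat section on
  that disc with value \<open>L x\<close> at \<open>h x\<close> when moving forward. Connectedness
  of the unit interval does the rest.\<close>

lemma parallel_exists:
  assumes \<eta>: "\<forall>i. holomorphic_form X U (\<eta> i)" and h: "continuous_on {0..1} h" "h ` {0..1} \<subseteq> U"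
  shows "\<exists>L. parallel X U \<eta> {0..1} h L \<and> L 0 = v"
proof -
  have hX: "h ` {0..1} \<subseteq> X" using h U_subset by blast
  have disc: "\<exists>D. chart_disc X U D \<and> p \<in> D" if "p \<in> U" for p
    using chart_disc_exists[OF that open_U] by blast
  show ?thesis
  proof (rule connected_induction_simple[where P = "\<lambda>t. \<exists>L. parallel X U \<eta> {0..t} h L \<and> L 0 = v" and a = 0 and b = 1 and S = "{0..1}"])
    show "connected {0..1::real}" "0 \<in> {0..1::real}" "1 \<in> {0..1::real}" by auto
    obtain D where D: "chart_disc X U D" "h 0 \<in> D" using disc[of "h 0"] h(2) by force
    obtain Y where "flat X \<eta> D Y" "Y (h 0) = v" using flat_exists[OF \<eta> D, where v = v] by blast
    then show "\<exists>L. parallel X U \<eta> {0..0} h L \<and> L 0 = v"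
      using parallel_flat[OF D(1), of \<eta> Y h "{0..0}"] D by auto
  next
    fix a :: real assume a: "a \<in> {0..1}"
    have "h a \<in> U" using h(2) a by blast
    then obtain D where D: "chart_disc X U D" "h a \<in> D" using disc by blast
    obtain M where M: "open M" "\<forall>s\<in>{0..1}. s \<in> M \<longleftrightarrow> h s \<in> D"
      using preimage_nhd[OF h(1) hX chart_disc_openin[OF D(1)]] by blast
    obtain \<epsilon> where \<epsilon>: "\<epsilon> > 0" "ball a \<epsilon> \<subseteq> M" using M a D open_contains_ball by metis
    show "\<exists>T. openin (top_of_set {0..1}) T \<and> a \<in> T \<and> (\<forall>x\<in>T. \<forall>y\<in>T.
       (\<exists>L. parallel X U \<eta> {0..x} h L \<and> L 0 = v) \<longrightarrow> (\<exists>L. parallel X U \<eta> {0..y} h L \<and> L 0 = v))"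
    proof (intro exI[of _ "{0..1} \<inter> ball a \<epsilon>"] conjI ballI impI)
      show "openin (top_of_set {0..1}) ({0..1} \<inter> ball a \<epsilon>)" by (auto simp: openin_open)
      show "a \<in> {0..1} \<inter> ball a \<epsilon>" using a \<epsilon> by auto
      fix x y assume x: "x \<in> {0..1} \<inter> ball a \<epsilon>" and y: "y \<in> {0..1} \<inter> ball a \<epsilon>"
        and "\<exists>L. parallel X U \<eta> {0..x} h L \<and> L 0 = v"
      then obtain L where L: "parallel X U \<eta> {0..x} h L" "L 0 = v" by blast
      show "\<exists>L. parallel X U \<eta> {0..y} h L \<and> L 0 = v"
      proof (cases "y \<le> x")
        case True
        then show ?thesis using parallel_subset[OF L(1), of "{0..y}"] L(2) by auto
      next
        case False
        have hxy: "h ` {x..y} \<subseteq> D"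
        proof
          fix q assume "q \<in> h ` {x..y}"
          then obtain s where s: "s \<in> {x..y}" "q = h s" by blast
          then have "s \<in> ball a \<epsilon>" using x y by (auto simp: dist_real_def)
          then show "q \<in> D" using s \<epsilon> M(2) x y by auto
        qed
        then have "h x \<in> D" using False by auto
        then obtain Y where Y: "flat X \<eta> D Y" "Y (h x) = L x"
          using flat_exists[OF \<eta> D(1), where y = "h x" and v = "L x"] by blast
        have "parallel X U \<eta> {0..y} h (\<lambda>s. if s \<le> x then L s else Y (h s))"
          by (rule parallel_join[OF L(1) parallel_flat[OF D(1) Y(1) hxy]])
            (use Y x y False continuous_on_subset[OF h(1)] in auto)
        then show ?thesis using L(2) x by (intro exI[of _ "\<lambda>s. if s \<le> x then L s else Y (h s)"]) auto
      qed
    qed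
  qed
qed

text \<open>Each \<open>M j\<close> comes with its own discs and neighbourhoods, and there are
  infinitely many \<open>j\<close>. Starting instead from one disc \<open>D\<close> around
  \<open>h t\<close>, \<open>parallel_disc\<close> yields a section on the whole of \<open>D\<close>
  for every \<open>j\<close>, and these can be convolved together.\<close>

lemma parallel_convolution:
  assumes \<eta>: "\<forall>i. holomorphic_form X U (\<eta> i)" and h: "continuous_on {a..b} h" "h ` {a..b} \<subseteq> U"
    and M: "\<And>j. parallel X U (\<lambda>i. \<eta> (j + i)) {a..b} h (M j)"
  shows "parallel X U \<eta> {a..b} h (\<lambda>t m. \<Sum>j\<le>m. v j * M j t (m - j))"
  unfolding parallel_def
proof
  fix t assume t: "t \<in> {a..b}"
  have hX: "h ` {a..b} \<subseteq> X" using h U_subset by blast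
  have "h t \<in> U" using h(2) t by blast
  then obtain D where D: "chart_disc X U D" "h t \<in> D" using chart_disc_exists[OF _ open_U, of "h t"] by blast
  obtain N where N: "open N" "\<forall>s\<in>{a..b}. s \<in> N \<longleftrightarrow> h s \<in> D"
    using preimage_nhd[OF h(1) hX chart_disc_openin[OF D(1)]] by blast
  obtain \<epsilon> where \<epsilon>: "\<epsilon> > 0" "ball t \<epsilon> \<subseteq> N" using N t D open_contains_ball by metis
  have sub: "h ` (ball t \<epsilon> \<inter> {a..b}) \<subseteq> D" using \<epsilon> N by blast
  have conn: "connected (ball t \<epsilon> \<inter> {a..b})" by (intro convex_connected convex_Int convex_ball convex_closed_interval) 
  have "\<exists>Z. flat X (\<lambda>i. \<eta> (j + i)) D Z \<and> (\<forall>s\<in>ball t \<epsilon> \<inter> {a..b}. M j s = Z (h s))" for j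
  proof -
    have "parallel X U (\<lambda>i. \<eta> (j + i)) (ball t \<epsilon> \<inter> {a..b}) h (M j)" by (rule parallel_subset[OF M[of j]]) blast
    moreover have "continuous_on (ball t \<epsilon> \<inter> {a..b}) h" by (rule continuous_on_subset[OF h(1)]) blast
    ultimately show ?thesis using \<eta> by (intro parallel_disc[OF _ _ conn _ D(1) sub]) auto
  qed
  then obtain Z where Z: "\<And>j. flat X (\<lambda>i. \<eta> (j + i)) D (Z j)"
      "\<And>j s. s \<in> ball t \<epsilon> \<inter> {a..b} \<Longrightarrow> M j s = Z j (h s)" by metis
  show "\<exists>D Y N. chart_disc X U D \<and> flat X \<eta> D Y \<and> open N \<and> t \<in> N \<and>
     (\<forall>s\<in>N \<inter> {a..b}. h s \<in> D \<and> (\<lambda>m. \<Sum>j\<le>m. v j * M j s (m - j)) = Y (h s))"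
    by (rule exI[of _ D], rule exI[of _ "\<lambda>p m. \<Sum>j\<le>m. v j * Z j p (m - j)"], rule exI[of _ "ball t \<epsilon>"])
      (use D flat_convolution[OF chart_disc_openin[OF D(1)] Z(1)] Z(2) sub \<epsilon>(1) in auto)
qed

text \<open>Near a given slice, and at a given parameter \<open>t\<close>, the values
  \<open>L s t\<close> are described by one flat section for all neighbouring \<open>s\<close>. This
  description, which is \<open>Q\<close>, holds at \<open>t = 0\<close> because all slices have the
  same start and initial value, and it is carried to \<open>t = 1\<close> disc by disc.\<close>

lemma parallel_homotopy:
  fixes H :: "real \<times> real \<Rightarrow> 'n proj"
  assumes \<eta>: "\<forall>i. holomorphic_form X U (\<eta> i)"
    and H: "continuous_on ({0..1} \<times> {0..1}) H" "H ` ({0..1} \<times> {0..1}) \<subseteq> U"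
    and ends: "\<And>s. s \<in> {0..1} \<Longrightarrow> H (s, 0) = a \<and> H (s, 1) = b"
    and L: "\<And>s. s \<in> {0..1} \<Longrightarrow> parallel X U \<eta> {0..1} (\<lambda>t. H (s, t)) (L s) \<and> L s 0 = v"
  shows "L 0 1 = L 1 1"
proof -
  define Q where "Q = (\<lambda>s0 t. \<exists>D Y N. chart_disc X U D \<and> flat X \<eta> D Y \<and> open N \<and> s0 \<in> N \<and>
      (\<forall>s\<in>N \<inter> {0..1}. H (s, t) \<in> D \<and> L s t = Y (H (s, t))))"
  have HX: "H ` ({0..1} \<times> {0..1}) \<subseteq> X" using H(2) U_subset by blast
  have Q: "Q s0 1" if s0: "s0 \<in> {0..1}" for s0
  proof (rule connected_induction_simple[where P = "Q s0" and a = 0 and b = 1 and S = "{0..1}"])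
    show "connected {0..1::real}" "0 \<in> {0..1::real}" "1 \<in> {0..1::real}" by auto
    have "a \<in> U" using ends[OF s0] H(2) s0 by force
    then obtain D where D: "chart_disc X U D" "a \<in> D" using chart_disc_exists[OF _ open_U, of a] by blast
    obtain Y where Y: "flat X \<eta> D Y" "Y a = v" using flat_exists[OF \<eta> D, where v = v] by blast
    show "Q s0 0"
      unfolding Q_def
      by (rule exI[of _ D], rule exI[of _ Y], rule exI[of _ UNIV]) (use D Y ends L in auto)
  next
    fix t :: real assume t: "t \<in> {0..1}"
    have "H (s0, t) \<in> U" using H(2) t s0 by blast
    then obtain D where D: "chart_disc X U D" "H (s0, t) \<in> D"
      using chart_disc_exists[OF _ open_U, of "H (s0, t)"] by blast
    obtain W where W: "open W" "D = X \<inter> W" using chart_disc_openin[OF D(1)] by (auto simp: openin_open)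
    obtain V where V: "open V" "V \<inter> ({0..1} \<times> {0..1}) = H -` W \<inter> ({0..1} \<times> {0..1})"
      using H(1) W(1) unfolding continuous_on_open_invariant by metis
    have "(s0, t) \<in> V" using V D W s0 t by blast
    \<comment> \<open>A product neighbourhood: for all \<open>s\<close> in \<open>A\<close> at once
      the slice stays in \<open>D\<close> while the parameter runs through \<open>I\<close>.\<close>
    then obtain A B where AB: "open A" "open B" "(s0, t) \<in> A \<times> B" "A \<times> B \<subseteq> V"
      using V(1) open_prod_elim by metis
    obtain \<epsilon> where \<epsilon>: "\<epsilon> > 0" "ball t \<epsilon> \<subseteq> B" using AB open_contains_ball by blast
    define I where "I = ball t \<epsilon> \<inter> {0..1}"
    have I: "connected I" unfolding I_def by (intro convex_connected convex_Int convex_ball convex_closed_interval)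
    have HD: "H (s, u) \<in> D" if "s \<in> A \<inter> {0..1}" "u \<in> I" for s u
    proof -
      have "(s, u) \<in> V \<inter> ({0..1} \<times> {0..1})" using that AB \<epsilon> by (auto simp: I_def)
      then show ?thesis using V(2) W(2) HX by blast
    qed
    show "\<exists>T. openin (top_of_set {0..1}) T \<and> t \<in> T \<and> (\<forall>x\<in>T. \<forall>y\<in>T. Q s0 x \<longrightarrow> Q s0 y)"
    proof (intro exI[of _ I] conjI ballI impI)
      show "openin (top_of_set {0..1}) I" by (auto simp: openin_open I_def)
      show "t \<in> I" using t \<epsilon> by (auto simp: I_def)
      fix x y assume x: "x \<in> I" and y: "y \<in> I" and "Q s0 x"
      then obtain D' Y' N where N: "chart_disc X U D'" "flat X \<eta> D' Y'" "open N" "s0 \<in> N"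
        "\<And>s. s \<in> N \<inter> {0..1} \<Longrightarrow> H (s, x) \<in> D' \<and> L s x = Y' (H (s, x))"
        unfolding Q_def by blast
      have s0A: "s0 \<in> A \<inter> {0..1}" using AB s0 by blast
      obtain Y where Y: "flat X \<eta> D Y" "Y (H (s0, x)) = L s0 x"
        using flat_exists[OF \<eta> D(1) HD[OF s0A x], where v = "L s0 x"] by blast
      have "H (s0, x) \<in> D \<inter> D'" using HD[OF s0A x] N(5)[of s0] N(4) s0 by blast
      then obtain E where E: "chart_disc X U E" "H (s0, x) \<in> E" "E \<subseteq> D \<inter> D'"
        using chart_disc_exists[of "H (s0, x)" "D \<inter> D'"] chart_disc_openin D(1) N(1) chart_disc_subset
        by (metis inf.coboundedI1 openin_Int)
      have eq: "Y p = Y' p" if "p \<in> E" for p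
        using flat_unique[OF E(1) flat_mono[OF Y(1)] flat_mono[OF N(2)] E(2)] E(3) that Y(2) N(4,5) s0 by auto
      have x01: "x \<in> {0..1}" and y01: "y \<in> {0..1}" using x y by (auto simp: I_def)
      have cx: "continuous_on {0..1} (\<lambda>s. H (s, x))"
        by (rule continuous_on_compose2[OF H(1)]) (use x01 in \<open>auto intro!: continuous_intros\<close>)
      have "(\<lambda>s. H (s, x)) ` {0..1} \<subseteq> X" using HX x01 by blast
      then obtain M where M: "open M" "\<forall>s\<in>{0..1}. s \<in> M \<longleftrightarrow> H (s, x) \<in> E"
        using preimage_nhd[OF cx _ chart_disc_openin[OF E(1)]] by blast
      show "Q s0 y"
        unfolding Q_def
      proof (rule exI[of _ D], rule exI[of _ Y], rule exI[of _ "A \<inter> N \<inter> M"], intro conjI ballI)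
        show "open (A \<inter> N \<inter> M)" using AB N M by blast
        show "s0 \<in> A \<inter> N \<inter> M" using AB N M E s0 by blast
        fix s assume s: "s \<in> A \<inter> N \<inter> M \<inter> {0..1}"
        then have sA: "s \<in> A \<inter> {0..1}" by blast
        show "H (s, y) \<in> D" using HD[OF sA y] .
        have cs: "continuous_on I (\<lambda>t. H (s, t))"
          by (rule continuous_on_compose2[OF H(1)]) (use s in \<open>auto intro!: continuous_intros simp: I_def\<close>)
        have ps: "parallel X U \<eta> I (\<lambda>t. H (s, t)) (L s)"
          using parallel_subset[of \<eta> "{0..1}"] L s by (auto simp: I_def)
        have sub: "(\<lambda>t. H (s, t)) ` I \<subseteq> D" using HD[OF sA] by blast
        obtain Z where Z: "flat X \<eta> D Z" "\<And>u. u \<in> I \<Longrightarrow> L s u = Z (H (s, u))"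
          using parallel_disc[OF \<eta> ps I cs D(1) sub] by blast
        have "H (s, x) \<in> E" using s M by blast
        then have "Y (H (s, x)) = L s x" using eq N(5) s by auto
        then have "Y (H (s, x)) = Z (H (s, x))" using Z(2)[OF x] by simp
        then have "Y (H (s, y)) = Z (H (s, y))"
          using flat_unique[OF D(1) Y(1) Z(1) HD[OF sA x] _ HD[OF sA y]] by blast
        then show "L s y = Y (H (s, y))" using Z(2)[OF y] by simp
      qed (use D Y in auto)
    qed
  qed
  \<comment> \<open>At parameter 1 all slices sit at the same point \<open>b\<close>, so the
    description \<open>L s 1 = Y b\<close> makes \<open>L s 1\<close> locally constant in
    \<open>s\<close>.\<close>
  show ?thesis
  proof (rule connected_induction_simple[where P = "\<lambda>s. L 0 1 = L s 1" and a = 0 and b = 1 and S = "{0..1}"])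
    show "connected {0..1::real}" "0 \<in> {0..1::real}" "1 \<in> {0..1::real}" by auto
  next
    fix s0 :: real assume s0: "s0 \<in> {0..1}"
    obtain D Y N where N: "open N" "s0 \<in> N" "\<And>s. s \<in> N \<inter> {0..1} \<Longrightarrow> L s 1 = Y (H (s, 1))"
      using Q[OF s0] unfolding Q_def by blast
    show "\<exists>T. openin (top_of_set {0..1}) T \<and> s0 \<in> T \<and> (\<forall>x\<in>T. \<forall>y\<in>T. L 0 1 = L x 1 \<longrightarrow> L 0 1 = L y 1)"
    proof (intro exI[of _ "{0..1} \<inter> N"] conjI ballI impI)
      show "openin (top_of_set {0..1}) ({0..1} \<inter> N)" using N by (auto simp: openin_open)
      show "s0 \<in> {0..1} \<inter> N" using s0 N by blast
      fix x y assume "x \<in> {0..1} \<inter> N" "y \<in> {0..1} \<inter> N" "L 0 1 = L x 1"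
      then show "L 0 1 = L y 1" using N(3)[of x] N(3)[of y] ends[of x] ends[of y] by auto
    qed
  qed simp
qed

lemma parallel_homotopic_paths:
  assumes \<eta>: "\<forall>i. holomorphic_form X U (\<eta> i)" and pq: "homotopic_paths U p q"
    and L: "parallel X U \<eta> {0..1} p L" "parallel X U \<eta> {0..1} q L'" "L 0 = L' 0"
  shows "L 1 = L' 1"
proof -
  obtain H :: "real \<times> real \<Rightarrow> 'n proj" where H: "continuous_on ({0..1} \<times> {0..1}) H" "H \<in> ({0..1} \<times> {0..1}) \<rightarrow> U"
    and pq': "\<forall>x\<in>{0..1}. H (0, x) = p x" "\<forall>x\<in>{0..1}. H (1, x) = q x"
    and ends: "\<forall>t\<in>{0..1}. pathstart (H \<circ> Pair t) = pathstart p \<and> pathfinish (H \<circ> Pair t) = pathfinish p"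
    using pq unfolding homotopic_paths by blast
  have HU: "H ` ({0..1} \<times> {0..1}) \<subseteq> U" using H(2) by blast
  \<comment> \<open>The given transports are prescribed at \<open>s = 0\<close> and
    \<open>s = 1\<close>: outside the unit interval a transport is arbitrary, so a free choice would
    not return them.\<close>
  have "\<exists>K. (s \<in> {0..1} \<longrightarrow> parallel X U \<eta> {0..1} (\<lambda>t. H (s, t)) K \<and> K 0 = L 0) \<and>
      (s = 0 \<longrightarrow> K = L) \<and> (s = 1 \<longrightarrow> K = L')" for s
  proof -
    consider "s = 0" | "s = 1" | "s \<notin> {0, 1}" by blast
    then show ?thesis
    proof cases
      case 1
      then have "s \<noteq> 1" by simp
      with 1 show ?thesis using parallel_cong[OF L(1), of "\<lambda>t. H (0, t)" L] pq' by (intro exI[of _ L]) auto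
    next
      case 2
      then have "s \<noteq> 0" by simp
      with 2 show ?thesis using parallel_cong[OF L(2), of "\<lambda>t. H (1, t)" L'] pq' L(3) by (intro exI[of _ L']) auto
    next
      case 3
      show ?thesis
      proof (cases "s \<in> {0..1}")
        case True
        have c: "continuous_on {0..1} (\<lambda>t. H (s, t))"
          by (rule continuous_on_compose2[OF H(1)]) (use True in \<open>auto intro!: continuous_intros\<close>)
        have "(\<lambda>t. H (s, t)) ` {0..1} \<subseteq> U" using HU True by blast
        then obtain K where "parallel X U \<eta> {0..1} (\<lambda>t. H (s, t)) K" "K 0 = L 0"
          using parallel_exists[OF \<eta> c, where v = "L 0"] by blast
        then show ?thesis using 3 by blast
      qed (use 3 in auto)
    qed
  qed
  then obtain K where K: "\<And>s. s \<in> {0..1} \<Longrightarrow> parallel X U \<eta> {0..1} (\<lambda>t. H (s, t)) (K s) \<and> K s 0 = L 0"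
    "K 0 = L" "K 1 = L'" by metis
  have "K 0 1 = K 1 1"
    by (rule parallel_homotopy[OF \<eta> H(1) HU _ K(1), where a = "pathstart p" and b = "pathfinish p"])
      (use ends in \<open>auto simp: pathstart_def pathfinish_def\<close>)
  then show ?thesis using K by simp
qed

end

section \<open>Integrals over simplices\<close>

text \<open>Pullback coefficients are uncontrolled at break points and end points. Integrability is
  shown on the open complement, where continuity gives measurability, and is then carried to the
  closed interval by a change at finitely many points.\<close>

lemma set_integrable_bounded_continuous_except_finite:
  fixes f :: "real \<Rightarrow> complex"
  assumes S: "finite S" and f: "continuous_on ({a<..<b} - S) f" "\<And>t. t \<in> {a<..<b} - S \<Longrightarrow> norm (f t) \<le> B"
  shows "set_integrable lborel {a..b} f"
proof -
  define O' where "O' = {a<..<b} - S"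
  have opO: "open O'" unfolding O'_def using S by (intro open_Diff finite_imp_closed) auto
  have "set_integrable lborel {a..b} (\<lambda>_. B)"
    by (rule borel_integrable_atLeastAtMost') (rule continuous_on_const)
  then have 1: "set_integrable lborel O' (\<lambda>_. B)"
    by (rule set_integrable_subset) (use opO in \<open>auto simp: O'_def\<close>)
  have "set_borel_measurable lborel O' f"
    unfolding set_borel_measurable_def using borel_measurable_continuous_on_indicator[of O' f] opO f(1)
    by (simp add: O'_def)
  then have "set_integrable lborel O' f"
    using f(2) by (intro set_integrable_bound[OF 1]) (auto simp: O'_def intro: order_trans[OF _ abs_ge_self])
  then have 2: "integrable lborel (\<lambda>x. indicator O' x *\<^sub>R f x)" by (simp add: set_integrable_def)
  have "integrable lborel (\<lambda>x. indicator O' x *\<^sub>R f x) \<longleftrightarrow> integrable lborel (\<lambda>x. indicator {a..b} x *\<^sub>R f x)"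
  proof (rule integrable_discrete_difference[of "S \<union> {a, b}"])
    show "countable (S \<union> {a, b})" using S by (simp add: countable_finite)
    fix x assume "x \<notin> S \<union> {a, b}"
    then have "x \<in> O' \<longleftrightarrow> x \<in> {a..b}" by (auto simp: O'_def)
    then show "indicator O' x *\<^sub>R f x = indicator {a..b} x *\<^sub>R f x" by (simp add: indicator_def)
  qed simp_all
  then show ?thesis using 2 by (simp add: set_integrable_def)
qed

text \<open>The simplex with a variable upper bound \<open>s\<close>: fixing the last coordinate
  leaves a simplex of the same kind, bounded by that coordinate. Coordinates from \<open>n\<close>
  on are ignored.\<close>

definition ordered_tuples :: "nat \<Rightarrow> real \<Rightarrow> (nat \<Rightarrow> real) set" where
  "ordered_tuples n s = {t. (\<forall>i<n. 0 \<le> t i \<and> t i \<le> s) \<and> (\<forall>j<n. \<forall>i<j. t i \<le> t j)}"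

lemma ordered_tuples_Suc:
  "t \<in> ordered_tuples (Suc n) s \<longleftrightarrow> t n \<in> {0..s} \<and> t \<in> ordered_tuples n (t n)"
  unfolding ordered_tuples_def by (auto simp: less_Suc_eq intro: order_trans)

lemma ordered_tuples_cong:
  "(\<And>i. i < n \<Longrightarrow> t i = u i) \<Longrightarrow> t \<in> ordered_tuples n s \<longleftrightarrow> u \<in> ordered_tuples n s"
  unfolding ordered_tuples_def by auto

lemma sets_ordered_tuples:
  "{t \<in> space (\<Pi>\<^sub>M i\<in>{..<n}. lborel). t \<in> ordered_tuples n s} \<in> sets (\<Pi>\<^sub>M i\<in>{..<n}. lborel)"
proof -
  have "{t \<in> space (\<Pi>\<^sub>M i\<in>{..<n}. lborel). (\<forall>i\<in>{..<n}. 0 \<le> t i \<and> t i \<le> s) \<and> (\<forall>j\<in>{..<n}. \<forall>i\<in>{..<j}. t i \<le> t j)}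
      \<in> sets (\<Pi>\<^sub>M i\<in>{..<n}. lborel)"
    by (intro sets.sets_Collect_conj sets.sets_Collect_finite_All borel_measurable_le
        borel_measurable_const measurable_component_singleton[where M = "\<lambda>_. borel", simplified])
      (auto simp: lborel_def)
  moreover have "t \<in> ordered_tuples n s \<longleftrightarrow>
      (\<forall>i\<in>{..<n}. 0 \<le> t i \<and> t i \<le> s) \<and> (\<forall>j\<in>{..<n}. \<forall>i\<in>{..<j}. t i \<le> t j)" for t
    by (auto simp: ordered_tuples_def)
  ultimately show ?thesis by (simp only:)
qed

text \<open>Isolates the real analysis: \<open>f k\<close> will be the coefficient of a pullback,
  \<open>y k\<close> a component of a transport and \<open>S\<close> the set of break
  points.\<close>

locale iterated_primitives =
  fixes f y :: "nat \<Rightarrow> real \<Rightarrow> complex" and S :: "real set" and B :: "nat \<Rightarrow> real"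
  assumes finite_S: "finite S"
    and f_continuous: "continuous_on ({0<..<1} - S) (f k)"
    and f_bound: "t \<in> {0<..<1} - S \<Longrightarrow> norm (f k t) \<le> B k"
    and y_0: "t \<in> {0..1} \<Longrightarrow> y 0 t = 1"
    and y_start: "y (Suc k) 0 = 0"
    and y_continuous: "continuous_on {0..1} (y k)"
    and y_deriv: "t \<in> {0<..<1} - S \<Longrightarrow> (y (Suc k) has_vector_derivative y k t * f k t) (at t)"
begin

lemma f_integrable: "set_integrable lborel {0..1} (f k)"
  using set_integrable_bounded_continuous_except_finite[OF finite_S f_continuous f_bound] .

lemma primitive_integral:
  assumes s: "s \<in> {0..1}"
  shows "(LINT u : {0..s} | lborel. y n u * f n u) = y (Suc n) s"
proof -
  have "bounded (y n ` {0..1})"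
    using compact_continuous_image[OF y_continuous] compact_imp_bounded by blast
  then obtain C where C: "\<And>u. u \<in> {0..1} \<Longrightarrow> norm (y n u) \<le> C" unfolding bounded_iff by blast
  have "set_integrable lborel {0..1} (\<lambda>u. y n u * f n u)"
  proof (rule set_integrable_bounded_continuous_except_finite[OF finite_S])
    show "continuous_on ({0<..<1} - S) (\<lambda>u. y n u * f n u)"
      by (intro continuous_on_mult f_continuous continuous_on_subset[OF y_continuous]) auto
    show "norm (y n t * f n t) \<le> C * B n" if t: "t \<in> {0<..<1} - S" for t
    proof -
      have "norm (y n t) \<le> C" using C t by auto
      moreover from this have "0 \<le> C" by (rule order_trans[OF norm_ge_zero])
      ultimately show ?thesis using f_bound[OF t] by (simp add: norm_mult mult_mono)
    qed
  qed
  then have int: "set_integrable lborel {0..s} (\<lambda>u. y n u * f n u)"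
    by (rule set_integrable_subset) (use s in auto)
  have "((\<lambda>u. y n u * f n u) has_integral (y (Suc n) s - y (Suc n) 0)) {0..s}"
  proof (rule fundamental_theorem_of_calculus_interior_strong[OF finite_S])
    show "continuous_on {0..s} (y (Suc n))" by (rule continuous_on_subset[OF y_continuous]) (use s in auto)
  qed (use s y_deriv in auto)
  then show ?thesis
    using set_borel_integral_eq_integral(2)[OF int] y_start by (simp add: integral_unique)
qed

text \<open>On the unit cube the integrand is a product of integrable functions of one variable
  each; the simplex is a measurable part of the cube. Joint integrability is what Fubini's theorem
  asks for below.\<close>

lemma integrable_ordered_tuples:
  assumes s: "s \<le> 1"
  shows "integrable (\<Pi>\<^sub>M i\<in>{..<n}. lborel) (\<lambda>t. indicator (ordered_tuples n s) t *\<^sub>R (\<Prod>i<n. f i (t i)))"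
proof -
  interpret product_sigma_finite "\<lambda>_::nat. lborel :: real measure" by standard
  let ?M = "\<Pi>\<^sub>M i\<in>{..<n}. (lborel :: real measure)"
  have "integrable ?M (\<lambda>t. \<Prod>i<n. indicator {0..1} (t i) *\<^sub>R f i (t i))"
    using f_integrable by (intro product_integrable_prod) (auto simp: set_integrable_def)
  then have "integrable ?M (\<lambda>t. indicator {t \<in> space ?M. t \<in> ordered_tuples n s} t *\<^sub>R
      (\<Prod>i<n. indicator {0..1} (t i) *\<^sub>R f i (t i)))"
    by (rule integrable_mult_indicator[OF sets_ordered_tuples])
  moreover have "indicator {t \<in> space ?M. t \<in> ordered_tuples n s} t *\<^sub>R (\<Prod>i<n. indicator {0..1} (t i) *\<^sub>R f i (t i))
      = indicator (ordered_tuples n s) t *\<^sub>R (\<Prod>i<n. f i (t i))" if "t \<in> space ?M" for t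
  proof (cases "t \<in> ordered_tuples n s")
    case True
    then have "t i \<in> {0..1}" if "i < n" for i using s that by (auto simp: ordered_tuples_def intro: order_trans)
    then show ?thesis using True that by (auto intro!: prod.cong)
  qed auto
  ultimately show ?thesis by (simp cong: Bochner_Integration.integrable_cong)
qed

text \<open>By Fubini with the largest coordinate \<open>u\<close> outermost, the inner integral
  runs over the simplex bounded by \<open>u\<close> and equals \<open>y n u\<close> by induction;
  what remains is the integral of the derivative of \<open>y (Suc n)\<close>.\<close>

lemma integral_ordered_tuples:
  assumes "s \<in> {0..1}"
  shows "(LINT t | (\<Pi>\<^sub>M i\<in>{..<n}. lborel). indicator (ordered_tuples n s) t *\<^sub>R (\<Prod>i<n. f i (t i))) = y n s"
  using assms
proof (induction n arbitrary: s)
  case 0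
  interpret product_sigma_finite "\<lambda>_::nat. lborel :: real measure" by standard
  show ?case using y_0[OF 0] by (simp add: ordered_tuples_def PiM_empty lebesgue_integral_count_space_finite)
next
  case (Suc n)
  interpret product_sigma_finite "\<lambda>_::nat. lborel :: real measure" by standard
  let ?P = "\<lambda>I. \<Pi>\<^sub>M i\<in>I. (lborel :: real measure)"
  let ?F = "\<lambda>t. indicator (ordered_tuples (Suc n) s) t *\<^sub>R (\<Prod>i<Suc n. f i (t i))"
  let ?g = "\<lambda>u. indicator {0..s} u *\<^sub>R (y n u * f n u)"
  \<comment> \<open>The singleton stands first in the union because
    \<open>product_integral_fold\<close> makes the first block the outer variable.\<close>
  have un: "{n} \<union> {..<n} = {..<Suc n}" by auto
  have int: "integrable (?P ({n} \<union> {..<n})) ?F"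
    unfolding un by (rule integrable_ordered_tuples) (use Suc.prems in auto)
  have inner: "(LINT v | ?P {..<n}. ?F (merge {n} {..<n} (x, v))) = ?g (x n)" for x
  proof -
    have "?F (merge {n} {..<n} (x, v)) = (indicator {0..s} (x n) *\<^sub>R f n (x n)) *
        (indicator (ordered_tuples n (x n)) v *\<^sub>R (\<Prod>i<n. f i (v i)))" for v
    proof -
      have "merge {n} {..<n} (x, v) \<in> ordered_tuples n (x n) \<longleftrightarrow> v \<in> ordered_tuples n (x n)"
        by (rule ordered_tuples_cong) (simp add: merge_def)
      then have "merge {n} {..<n} (x, v) \<in> ordered_tuples (Suc n) s \<longleftrightarrow> x n \<in> {0..s} \<and> v \<in> ordered_tuples n (x n)"
        by (simp add: ordered_tuples_Suc merge_def)
      moreover have "(\<Prod>i<Suc n. f i (merge {n} {..<n} (x, v) i)) = (\<Prod>i<n. f i (v i)) * f n (x n)"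
        by (simp add: merge_def)
      ultimately show ?thesis by (auto simp: indicator_def)
    qed
    then have "(LINT v | ?P {..<n}. ?F (merge {n} {..<n} (x, v))) = (indicator {0..s} (x n) *\<^sub>R f n (x n)) *
        (LINT v | ?P {..<n}. indicator (ordered_tuples n (x n)) v *\<^sub>R (\<Prod>i<n. f i (v i)))"
      by (simp only: integral_mult_right_zero)
    also have "\<dots> = ?g (x n)"
    proof (cases "x n \<in> {0..s}")
      case True
      then have "x n \<in> {0..1}" using Suc.prems by auto
      from Suc.IH[OF this] True show ?thesis by simp
    qed simp
    finally show ?thesis .
  qed
  \<comment> \<open>\<open>f n\<close> is known to be measurable only on the unit interval, so the
    outer integrand is written as a product of two truncated factors.\<close>
  have "set_integrable lborel {0..1} (f n)" by (rule f_integrable)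
  then have "(\<lambda>u. indicator {0..1} u *\<^sub>R f n u) \<in> borel_measurable borel"
    unfolding set_integrable_def using borel_measurable_integrable by force
  moreover have "(\<lambda>u. indicator {0..s} u *\<^sub>R y n u) \<in> borel_measurable borel"
    by (rule borel_measurable_continuous_on_indicator[OF _ continuous_on_subset[OF y_continuous]]) (use Suc.prems in auto)
  ultimately have "(\<lambda>u. (indicator {0..s} u *\<^sub>R y n u) * (indicator {0..1} u *\<^sub>R f n u)) \<in> borel_measurable borel"
    by (rule borel_measurable_times[rotated])
  moreover have "(\<lambda>u. (indicator {0..s} u *\<^sub>R y n u) * (indicator {0..1} u *\<^sub>R f n u)) = ?g"
    using Suc.prems by (auto simp: indicator_def fun_eq_iff)
  ultimately have meas: "?g \<in> borel_measurable lborel" by simp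
  have "(LINT t | ?P ({n} \<union> {..<n}). ?F t) = (LINT x | ?P {n}. (LINT v | ?P {..<n}. ?F (merge {n} {..<n} (x, v))))"
    by (rule product_integral_fold[OF _ _ _ int]) auto
  then have "(LINT t | ?P {..<Suc n}. ?F t) = (LINT x | ?P {n}. ?g (x n))"
    by (simp only: inner un)
  also have "\<dots> = (LINT u | lborel. ?g u)" by (rule product_integral_singleton[OF meas])
  also have "\<dots> = y (Suc n) s"
    using primitive_integral[OF Suc.prems] unfolding set_lebesgue_integral_def .
  finally show ?case .
qed

end

section \<open>Piecewise smooth representatives\<close>

definition C1_piece :: "('n::finite) proj set \<Rightarrow> (real \<Rightarrow> 'n proj) \<Rightarrow> real \<Rightarrow> real \<Rightarrow> bool" where
  "C1_piece X \<gamma> a b \<longleftrightarrow> (\<forall>k\<in>charts X. \<exists>D.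
     (\<forall>t\<in>{a..b} \<inter> \<gamma> -` fst k. (snd k \<circ> \<gamma> has_vector_derivative D t) (at t within {a..b})) \<and>
     continuous_on ({a..b} \<inter> \<gamma> -` fst k) D)"

lemma piecewise_C1_path_iff:
  "piecewise_C1_path X \<gamma> \<longleftrightarrow> path \<gamma> \<and> path_image \<gamma> \<subseteq> X \<and>
     (\<exists>N s. s 0 = 0 \<and> s N = 1 \<and> (\<forall>j<N. s j < s (Suc j) \<and> C1_piece X \<gamma> (s j) (s (Suc j))))"
  unfolding piecewise_C1_path_def C1_piece_def ..

text \<open>For use on the two halves of a join, where the affine maps have slope 2. Equality with
  the reparametrized path is asked on the closed piece only, because a join has different formulas
  on its halves.\<close>

lemma C1_piece_affine:
  assumes \<gamma>: "C1_piece X \<gamma> (m * a + c) (m * b + c)" and m: "m > 0"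
    and \<gamma>': "\<And>t. t \<in> {a..b} \<Longrightarrow> \<gamma>' t = \<gamma> (m * t + c)"
  shows "C1_piece X \<gamma>' a b"
  unfolding C1_piece_def
proof
  fix k assume k: "k \<in> charts X"
  let ?f = "\<lambda>t. m * t + c"
  obtain D where D: "\<forall>t\<in>{?f a..?f b} \<inter> \<gamma> -` fst k. (snd k \<circ> \<gamma> has_vector_derivative D t) (at t within {?f a..?f b})"
    "continuous_on ({?f a..?f b} \<inter> \<gamma> -` fst k) D"
    using \<gamma> k unfolding C1_piece_def by metis
  have f_in: "?f t \<in> {?f a..?f b}" if "t \<in> {a..b}" for t using that m by simp
  have f_im: "?f ` {a..b} \<subseteq> {?f a..?f b}" using f_in by blast
  have "(snd k \<circ> \<gamma>' has_vector_derivative m *\<^sub>R D (?f t)) (at t within {a..b})"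
    if t: "t \<in> {a..b} \<inter> \<gamma>' -` fst k" for t
  proof -
    have "?f t \<in> {?f a..?f b} \<inter> \<gamma> -` fst k" using f_in t \<gamma>' by auto
    then have 1: "(snd k \<circ> \<gamma> has_vector_derivative D (?f t)) (at (?f t) within ?f ` {a..b})"
      using D(1) has_vector_derivative_within_subset f_im by blast
    have "(?f has_vector_derivative m) (at t within {a..b})"
      by (auto intro!: derivative_eq_intros simp: has_vector_derivative_def)
    then have "((snd k \<circ> \<gamma>) \<circ> ?f has_vector_derivative m *\<^sub>R D (?f t)) (at t within {a..b})"
      using 1 by (rule vector_diff_chain_within)
    then show ?thesis
      by (rule has_vector_derivative_transform[rotated 2]) (use t \<gamma>' in auto)
  qed
  moreover have "continuous_on ({a..b} \<inter> \<gamma>' -` fst k) (\<lambda>t. m *\<^sub>R D (?f t))"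
    by (intro continuous_intros continuous_on_compose2[OF D(2)]) (use f_in \<gamma>' in auto)
  ultimately show "\<exists>D. (\<forall>t\<in>{a..b} \<inter> \<gamma>' -` fst k. (snd k \<circ> \<gamma>' has_vector_derivative D t) (at t within {a..b})) \<and>
     continuous_on ({a..b} \<inter> \<gamma>' -` fst k) D"
    by (intro exI[of _ "\<lambda>t. m *\<^sub>R D (?f t)"]) simp
qed

lemma piecewise_C1_path_join:
  assumes p: "piecewise_C1_path X p" and q: "piecewise_C1_path X q" and pq: "pathfinish p = pathstart q"
  shows "piecewise_C1_path X (p +++ q)"
proof -
  obtain N s where s: "s 0 = 0" "s N = 1" "\<forall>j<N. s j < s (Suc j) \<and> C1_piece X p (s j) (s (Suc j))"
    and pp: "path p" "path_image p \<subseteq> X"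
    using p unfolding piecewise_C1_path_iff by metis
  obtain M r where r: "r 0 = 0" "r M = 1" "\<forall>j<M. r j < r (Suc j) \<and> C1_piece X q (r j) (r (Suc j))"
    and qq: "path q" "path_image q \<subseteq> X"
    using q unfolding piecewise_C1_path_iff by metis
  have s01: "s j \<le> 1" if "j \<le> N" for j
  proof -
    have "s j \<le> s N" using that
    proof (induction rule: inc_induct)
      case (step i)
      then show ?case using s(3) by (meson less_imp_le order_trans)
    qed simp
    then show ?thesis using s(2) by simp
  qed
  have r01: "0 \<le> r j" if "j \<le> M" for j
  proof -
    show ?thesis using that
    proof (induction j)
      case (Suc j)
      then show ?case using r(3) by (meson Suc_le_eq less_imp_le order_trans)
    qed (simp add: r(1))
  qed
  \<comment> \<open>The two subdivisions, scaled to the halves of the unit interval and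
    concatenated; at index \<open>N\<close> both formulas give 1/2.\<close>
  define u where "u = (\<lambda>j. if j \<le> N then s j / 2 else (1 + r (j - N)) / 2)"
  have u2: "u (N + i) = (1 + r i) / 2" for i using s(2) r(1) by (simp add: u_def)
  have "u j < u (Suc j) \<and> C1_piece X (p +++ q) (u j) (u (Suc j))" if j: "j < N + M" for j
  proof (cases "j < N")
    case True
    then have u: "u j = s j / 2" "u (Suc j) = s (Suc j) / 2" by (auto simp: u_def)
    have "C1_piece X (p +++ q) (u j) (u (Suc j))"
    proof (rule C1_piece_affine[where m = 2 and c = 0])
      have e: "2 * u j + 0 = s j" "2 * u (Suc j) + 0 = s (Suc j)" using u by auto
      show "C1_piece X p (2 * u j + 0) (2 * u (Suc j) + 0)" unfolding e using s(3) True by blast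
      show "(p +++ q) t = p (2 * t + 0)" if "t \<in> {u j..u (Suc j)}" for t
        using that u s01[of "Suc j"] True by (auto simp: joinpaths_def)
    qed simp
    moreover have "u j < u (Suc j)" using s(3) True u by auto
    ultimately show ?thesis by blast
  next
    case False
    then obtain i where i: "j = N + i" "i < M" using j by (metis add_less_cancel_left le_iff_add not_less)
    then have u: "u j = (1 + r i) / 2" "u (Suc j) = (1 + r (Suc i)) / 2" using u2[of i] u2[of "Suc i"] by auto
    have "C1_piece X (p +++ q) (u j) (u (Suc j))"
    proof (rule C1_piece_affine[where m = 2 and c = "-1"])
      have e: "2 * u j + -1 = r i" "2 * u (Suc j) + -1 = r (Suc i)" using u by auto
      show "C1_piece X q (2 * u j + -1) (2 * u (Suc j) + -1)" unfolding e using r(3) i by blast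
      show "(p +++ q) t = q (2 * t + -1)" if "t \<in> {u j..u (Suc j)}" for t
      proof -
        have "t \<ge> 1/2" using that u r01[of i] i by auto
        show ?thesis
        proof (cases "t = 1/2")
          case True
          \<comment> \<open>A join is evaluated by \<open>p\<close> at its midpoint, so the matching
            end points are needed here.\<close>
          show ?thesis unfolding True using pq by (simp add: joinpaths_def pathfinish_def pathstart_def)
        next
          case False
          then show ?thesis using \<open>t \<ge> 1/2\<close> by (simp add: joinpaths_def)
        qed
      qed
    qed simp
    moreover have "u j < u (Suc j)" using r(3) i u by auto
    ultimately show ?thesis by blast
  qed
  moreover have "u 0 = 0" "u (N + M) = 1" using s(1) u2[of M] r(2) by (auto simp: u_def)
  ultimately show ?thesis
    unfolding piecewise_C1_path_iff using pp qq pq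
    by (intro conjI exI[of _ "N + M"] exI[of _ u]) (auto simp: subset_path_image_join path_join)
qed

text \<open>In the coordinate \<open>k\<close> the velocity is constant; in another chart it is
  multiplied by the derivative of the coordinate change, which is continuous because coordinate
  changes are holomorphic.\<close>

lemma chart_segment_C1:
  assumes k: "k \<in> charts X" and S: "closed_segment x y \<subseteq> snd k ` fst k"
  shows "piecewise_C1_path X (chart_inv k \<circ> linepath x y)"
proof -
  have lin: "linepath x y t \<in> snd k ` fst k" if "t \<in> {0..1}" for t
    using S linepath_in_path[OF that] by blast
  have "C1_piece X (chart_inv k \<circ> linepath x y) 0 1"
    unfolding C1_piece_def
  proof
    fix l assume l: "l \<in> charts X"
    define \<phi> where "\<phi> = snd l \<circ> chart_inv k"
    define V where "V = snd k ` (fst k \<inter> fst l)"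
    have V: "open V" unfolding V_def by (rule chart_image_open[OF k chart_openin[OF l]])
    have d: "(\<phi> has_field_derivative deriv \<phi> z) (at z)" if "z \<in> V" for z
      using that chart_transition_deriv[OF k l] unfolding V_def \<phi>_def by blast
    have "\<phi> holomorphic_on V" using d unfolding holomorphic_on_open[OF V] by blast
    then have "deriv \<phi> holomorphic_on V" by (rule holomorphic_deriv[OF _ V])
    then have cont: "continuous_on V (deriv \<phi>)" by (rule holomorphic_on_imp_continuous_on)
    let ?T = "{0..1} \<inter> (chart_inv k \<circ> linepath x y) -` fst l"
    have inV: "linepath x y t \<in> V" if "t \<in> ?T" for t
    proof -
      obtain p where p: "p \<in> fst k" "linepath x y t = snd k p" using lin[of t] \<open>t \<in> ?T\<close> by blast
      then have "p \<in> fst l" using \<open>t \<in> ?T\<close> k by simp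
      then show ?thesis using p by (simp add: V_def)
    qed
    have "(snd l \<circ> (chart_inv k \<circ> linepath x y) has_vector_derivative (y - x) * deriv \<phi> (linepath x y t)) (at t within {0..1})"
      if t: "t \<in> ?T" for t
    proof -
      have "(linepath x y has_vector_derivative (y - x)) (at t within {0..1})"
        by (rule has_vector_derivative_linepath_within)
      moreover have "(\<phi> has_field_derivative deriv \<phi> (linepath x y t)) (at (linepath x y t))" using d inV t by blast
      ultimately have "(\<phi> \<circ> linepath x y has_vector_derivative (y - x) * deriv \<phi> (linepath x y t)) (at t within {0..1})"
        by (rule field_vector_diff_chain_within[OF _ has_field_derivative_at_within])
      then show ?thesis by (simp add: \<phi>_def o_assoc)
    qed
    moreover have "continuous_on ?T (\<lambda>t. (y - x) * deriv \<phi> (linepath x y t))"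
      by (intro continuous_on_mult continuous_on_const continuous_on_compose2[OF cont] continuous_on_linepath) (use inV in blast)
    ultimately show "\<exists>D. (\<forall>t\<in>?T. (snd l \<circ> (chart_inv k \<circ> linepath x y) has_vector_derivative D t) (at t within {0..1})) \<and>
        continuous_on ?T D"
      by (intro exI[of _ "\<lambda>t. (y - x) * deriv \<phi> (linepath x y t)"]) simp
  qed
  moreover have "path (chart_inv k \<circ> linepath x y)"
    unfolding path_def
    by (rule continuous_on_compose[OF continuous_on_linepath continuous_on_subset[OF chart_inv_continuous[OF k]]])
      (use lin in blast)
  moreover have "path_image (chart_inv k \<circ> linepath x y) \<subseteq> X"
    using lin chart_inv_in[OF k] chart_subset[OF k] by (auto simp: path_image_def)
  ultimately show ?thesis
    \<comment> \<open>A single piece, with break points \<open>real 0\<close> and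
      \<open>real 1\<close>.\<close>
    unfolding piecewise_C1_path_iff by (intro conjI exI[of _ 1] exI[of _ real]) auto
qed

text \<open>The initial part of \<open>p\<close> up to \<open>v\<close>, stretched to the unit
  interval, is also the join of its parts before and after \<open>u\<close>. The reparametrization
  is linear on each half, reaching \<open>u / v\<close> at the midpoint.\<close>

lemma homotopic_paths_split:
  assumes p: "path p" "path_image p \<subseteq> U" and uv: "0 \<le> u" "u < v" "v \<le> 1"
  shows "homotopic_paths U (\<lambda>x. p (v * x)) ((\<lambda>x. p (u * x)) +++ (\<lambda>x. p ((v - u) * x + u)))"
proof (rule homotopic_paths_reparametrize[where f = "\<lambda>x. if x \<le> 1/2 then (u / v) * (2 * x) else (u + (v - u) * (2 * x - 1)) / v"])
  have in01: "v * x \<in> {0..1}" if "x \<in> {0..1}" for x using that uv by (auto simp: mult_le_one)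
  show "path (\<lambda>x. p (v * x))"
    using p(1) unfolding path_def by (rule continuous_on_compose2) (use in01 in \<open>auto intro!: continuous_intros\<close>)
  show "path_image (\<lambda>x. p (v * x)) \<subseteq> U" using p(2) in01 by (auto simp: path_image_def)
  let ?f = "\<lambda>x. if x \<le> 1/2 then (u / v) * (2 * x) else (u + (v - u) * (2 * x - 1)) / v"
  show "continuous_on {0..1} ?f"
    by (rule continuous_on_cases_le[where h = "\<lambda>x. x" and a = "1/2"])
      (use uv in \<open>auto intro!: continuous_intros simp: field_simps\<close>)
  show "?f \<in> {0..1} \<rightarrow> {0..1}"
  proof
    fix x :: real assume x: "x \<in> {0..1}"
    show "?f x \<in> {0..1}"
    proof (cases "x \<le> 1/2")
      case True
      have "u * (2 * x) \<le> v * 1" by (rule mult_mono) (use True x uv in auto)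
      then show ?thesis using True x uv by simp
    next
      case False
      have "0 \<le> (v - u) * (2 * x - 1)" using False uv by simp
      moreover have "u + (v - u) * (2 * x - 1) \<le> u + (v - u) * 1"
        by (intro add_left_mono mult_left_mono) (use x uv in auto)
      then have "u + (v - u) * (2 * x - 1) \<le> v" by (rule order_trans) simp
      ultimately show ?thesis using False uv by simp
    qed
  qed
  show "?f 0 = 0" "?f 1 = 1" using uv by auto
  show "((\<lambda>x. p (u * x)) +++ (\<lambda>x. p ((v - u) * x + u))) t = p (v * ?f t)" for t
    using uv by (simp add: joinpaths_def add.commute)
qed

context open_curve
begin

text \<open>The coordinate image of the path is deformed into its chord by the straight-line
  homotopy inside the convex set \<open>B\<close>, and \<open>chart_inv k\<close> carries this back
  into \<open>U\<close>.\<close>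

lemma homotopic_chart_segment:
  assumes k: "k \<in> charts X" and B: "convex B" "B \<subseteq> snd k ` (fst k \<inter> U)"
    and \<sigma>: "path \<sigma>" "path_image \<sigma> \<subseteq> chart_inv k ` B"
  shows "homotopic_paths U \<sigma> (chart_inv k \<circ> linepath (snd k (pathstart \<sigma>)) (snd k (pathfinish \<sigma>)))"
proof -
  have \<sigma>k: "\<sigma> t \<in> fst k \<and> snd k (\<sigma> t) \<in> B" if t: "t \<in> {0..1}" for t
  proof -
    have "\<sigma> t \<in> chart_inv k ` B" using \<sigma>(2) t unfolding path_image_def by blast
    then obtain z where z: "z \<in> B" "\<sigma> t = chart_inv k z" by blast
    obtain q where "q \<in> fst k" "z = snd k q" using z(1) B(2) by blast
    then show ?thesis using z k by simp
  qed
  let ?\<tau> = "snd k \<circ> \<sigma>"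
  have p\<tau>: "path ?\<tau>"
    unfolding path_def
    by (rule continuous_on_compose[OF \<sigma>(1)[unfolded path_def] continuous_on_subset[OF chart_continuous[OF k]]])
      (use \<sigma>k in blast)
  have lin: "homotopic_paths B ?\<tau> (linepath (pathstart ?\<tau>) (pathfinish ?\<tau>))"
  proof (rule homotopic_paths_linear[OF p\<tau>])
    fix t :: real assume t: "t \<in> {0..1}"
    have e: "pathstart ?\<tau> \<in> B" "pathfinish ?\<tau> \<in> B" using \<sigma>k[of 0] \<sigma>k[of 1] by (auto simp: pathstart_def pathfinish_def)
    then have "linepath (pathstart ?\<tau>) (pathfinish ?\<tau>) t \<in> B"
      using linepath_in_path[OF t] B(1) closed_segment_subset by blast
    then show "closed_segment (?\<tau> t) (linepath (pathstart ?\<tau>) (pathfinish ?\<tau>) t) \<subseteq> B"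
      using \<sigma>k[OF t] B(1) by (intro closed_segment_subset) auto
  qed auto
  have "continuous_on B (chart_inv k)"
    by (rule continuous_on_subset[OF chart_inv_continuous[OF k]]) (use B(2) in blast)
  moreover have "chart_inv k \<in> B \<rightarrow> U"
  proof
    fix z assume "z \<in> B"
    then obtain q where "q \<in> fst k" "q \<in> U" "z = snd k q" using B(2) by blast
    then show "chart_inv k z \<in> U" using k by simp
  qed
  ultimately have 1: "homotopic_paths U (chart_inv k \<circ> ?\<tau>) (chart_inv k \<circ> linepath (pathstart ?\<tau>) (pathfinish ?\<tau>))"
    by (rule homotopic_paths_continuous_image[OF lin])
  have "path (chart_inv k \<circ> ?\<tau>)" "path_image (chart_inv k \<circ> ?\<tau>) \<subseteq> U"
    using homotopic_paths_imp_path[OF 1] homotopic_paths_imp_subset[OF 1] by auto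
  then have "homotopic_paths U (chart_inv k \<circ> ?\<tau>) \<sigma>"
    by (rule homotopic_paths_eq) (use \<sigma>k k in auto)
  then show ?thesis using 1 by (simp add: pathstart_def pathfinish_def) (meson homotopic_paths_sym homotopic_paths_trans)
qed

text \<open>Ensures that the definite description in \<open>class_integral\<close> ranges over a
  nonempty set of paths. The path is replaced disc by disc by coordinate segments.\<close>

lemma homotopic_piecewise_C1:
  assumes p: "path p" "path_image p \<subseteq> U"
  shows "\<exists>\<gamma>. piecewise_C1_path X \<gamma> \<and> homotopic_paths U p \<gamma>"
proof -
  define P where "P = (\<lambda>t. \<exists>\<gamma>. piecewise_C1_path X \<gamma> \<and> homotopic_paths U (\<lambda>x. p (t * x)) \<gamma>)"
  have pU: "p t \<in> U" if "t \<in> {0..1}" for t using p(2) that by (auto simp: path_image_def)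
  have pX: "p ` {0..1} \<subseteq> X" using pU U_subset by blast
  have disc: "\<exists>D. chart_disc X U D \<and> p t \<in> D" if "t \<in> {0..1}" for t
    using chart_disc_exists[OF pU[OF that] open_U] by blast
  have piece: "\<exists>\<gamma>. piecewise_C1_path X \<gamma> \<and> homotopic_paths U (\<lambda>x. p ((v - u) * x + u)) \<gamma>"
    if uv: "0 \<le> u" "u \<le> v" "v \<le> 1" and D: "chart_disc X U D" "p ` {u..v} \<subseteq> D" for u v D
  proof -
    obtain k a r where k: "k \<in> charts X" "r > 0" "ball a r \<subseteq> snd k ` (fst k \<inter> U)" "D = chart_inv k ` ball a r"
      and Dk: "\<forall>p\<in>D. p \<in> U \<and> p \<in> fst k \<and> snd k p \<in> ball a r"
      using chart_discE[OF D(1)] .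
    let ?\<sigma> = "\<lambda>x. p ((v - u) * x + u)"
    have in_uv: "(v - u) * x + u \<in> {u..v}" if "x \<in> {0..1}" for x
    proof -
      have "(v - u) * x \<le> (v - u) * 1" by (rule mult_left_mono) (use that uv in auto)
      then show ?thesis using that uv by simp
    qed
    have "path ?\<sigma>"
      using p(1) unfolding path_def
      by (rule continuous_on_compose2) (use in_uv uv in \<open>force intro!: continuous_intros\<close>)+
    moreover have im: "path_image ?\<sigma> \<subseteq> D" unfolding path_image_def using D(2) in_uv by blast
    ultimately have "homotopic_paths U ?\<sigma> (chart_inv k \<circ> linepath (snd k (pathstart ?\<sigma>)) (snd k (pathfinish ?\<sigma>)))"
      using k(4) by (intro homotopic_chart_segment[OF k(1) convex_ball k(3)]) auto
    moreover have "piecewise_C1_path X (chart_inv k \<circ> linepath (snd k (pathstart ?\<sigma>)) (snd k (pathfinish ?\<sigma>)))"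
    proof (rule chart_segment_C1[OF k(1)])
      have "pathstart ?\<sigma> \<in> D" "pathfinish ?\<sigma> \<in> D" using im by (meson pathstart_in_path_image pathfinish_in_path_image subsetD)+
      then have "closed_segment (snd k (pathstart ?\<sigma>)) (snd k (pathfinish ?\<sigma>)) \<subseteq> ball a r"
        using Dk by (intro closed_segment_subset convex_ball) blast+
      then show "closed_segment (snd k (pathstart ?\<sigma>)) (snd k (pathfinish ?\<sigma>)) \<subseteq> snd k ` fst k" using k(3) by blast
    qed
    ultimately show ?thesis by blast
  qed
  have step: "P v" if st: "P u" "0 \<le> u" "u < v" "v \<le> 1" "chart_disc X U D" "p ` {u..v} \<subseteq> D" for u v D
  proof -
    obtain \<gamma> where \<gamma>: "piecewise_C1_path X \<gamma>" "homotopic_paths U (\<lambda>x. p (u * x)) \<gamma>"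
      using \<open>P u\<close> unfolding P_def by blast
    obtain \<delta> where \<delta>: "piecewise_C1_path X \<delta>" "homotopic_paths U (\<lambda>x. p ((v - u) * x + u)) \<delta>"
      using piece[OF st(2) _ st(4-6)] st(3) by auto
    have "pathfinish (\<lambda>x. p (u * x)) = pathstart (\<lambda>x. p ((v - u) * x + u))"
      by (simp add: pathstart_def pathfinish_def)
    then have 1: "homotopic_paths U ((\<lambda>x. p (u * x)) +++ (\<lambda>x. p ((v - u) * x + u))) (\<gamma> +++ \<delta>)"
      and 2: "pathfinish \<gamma> = pathstart \<delta>"
      using homotopic_paths_join[OF \<gamma>(2) \<delta>(2)] homotopic_paths_imp_pathfinish[OF \<gamma>(2)] homotopic_paths_imp_pathstart[OF \<delta>(2)] by auto
    show ?thesis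
      unfolding P_def
      using homotopic_paths_trans[OF homotopic_paths_split[OF p st(2-4)] 1] piecewise_C1_path_join[OF \<gamma>(1) \<delta>(1) 2] by blast
  qed
  have "\<forall>t\<in>{0..1}. P t"
  \<comment> \<open>The property covers all parameters up to \<open>v\<close>: \<open>step\<close>
    prolongs a replacement but does not shorten one, so \<open>P v\<close> alone would not pass to
    smaller parameters.\<close>
  proof (rule connected_induction_simple[where P = "\<lambda>v. \<forall>t\<in>{0..v}. P t" and a = 0 and b = 1 and S = "{0..1}"])
    show "connected {0..1::real}" "0 \<in> {0..1::real}" "1 \<in> {0..1::real}" by auto
    have "(0::real) \<in> {0..1}" by simp
    then obtain D where D: "chart_disc X U D" "p 0 \<in> D" using disc by blast
    \<comment> \<open>The degenerate piece with \<open>u = v = 0\<close> replaces the constant path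
      at \<open>p 0\<close>.\<close>
    have "P 0" using piece[of 0 0 D] D by (simp add: P_def)
    then show "\<forall>t\<in>{0..0}. P t" by simp
  next
    fix a :: real assume a: "a \<in> {0..1}"
    then obtain D where D: "chart_disc X U D" "p a \<in> D" using disc by blast
    obtain M where M: "open M" "\<forall>s\<in>{0..1}. s \<in> M \<longleftrightarrow> p s \<in> D"
      using preimage_nhd[OF p(1)[unfolded path_def] pX chart_disc_openin[OF D(1)]] by blast
    obtain \<epsilon> where \<epsilon>: "\<epsilon> > 0" "ball a \<epsilon> \<subseteq> M" using M a D open_contains_ball by metis
    show "\<exists>T. openin (top_of_set {0..1}) T \<and> a \<in> T \<and> (\<forall>x\<in>T. \<forall>y\<in>T. (\<forall>t\<in>{0..x}. P t) \<longrightarrow> (\<forall>t\<in>{0..y}. P t))"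
    proof (intro exI[of _ "{0..1} \<inter> ball a \<epsilon>"] conjI ballI impI)
      show "openin (top_of_set {0..1}) ({0..1} \<inter> ball a \<epsilon>)" by (intro openin_open_Int open_ball)
      show "a \<in> {0..1} \<inter> ball a \<epsilon>" using a \<epsilon> by auto
      fix x y t assume x: "x \<in> {0..1} \<inter> ball a \<epsilon>" and y: "y \<in> {0..1} \<inter> ball a \<epsilon>"
        and Px: "\<forall>t\<in>{0..x}. P t" and t: "t \<in> {0..y}"
      show "P t"
      proof (cases "t \<le> x")
        case True
        then show ?thesis using Px t by auto
      next
        case False
        have "p ` {x..t} \<subseteq> D"
        proof
          fix q assume "q \<in> p ` {x..t}"
          then obtain s where s: "s \<in> {x..t}" "q = p s" by blast
          then have "s \<in> ball a \<epsilon>" using x y t by (auto simp: dist_real_def)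
          then show "q \<in> D" using s \<epsilon> M(2) x y t by auto
        qed
        then show ?thesis using step[OF _ _ _ _ D(1), of x t] Px x y t False by auto
      qed
    qed
  qed
  then have "P 1" by simp
  then show ?thesis by (simp add: P_def)
qed

end

section \<open>Integrals over homotopy classes\<close>

text \<open>Neighbourhoods are required also at the points of \<open>K\<close> outside
  \<open>T\<close>, so compactness applies although \<open>T\<close> need not be compact. For an
  open piece of a path this is where differentiability up to the end points enters.\<close>

lemma bounded_image_if_locally_bounded:
  assumes K: "compact K" "T \<subseteq> K"
    and loc: "\<And>t. t \<in> K \<Longrightarrow> \<exists>M. open M \<and> t \<in> M \<and> bounded (f ` (M \<inter> T))"
  shows "bounded (f ` T)"
proof -
  let ?C = "{M. open M \<and> bounded (f ` (M \<inter> T))}"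
  have op: "\<And>M. M \<in> ?C \<Longrightarrow> open M" by simp
  have cov: "K \<subseteq> \<Union>?C" using loc by blast
  obtain C where C: "C \<subseteq> ?C" "finite C" "K \<subseteq> \<Union>C"
    using compactE[OF K(1) cov op] by metis
  have "f ` T \<subseteq> (\<Union>M\<in>C. f ` (M \<inter> T))" using C(3) K(2) by blast
  moreover have "bounded (\<Union>M\<in>C. f ` (M \<inter> T))" using C(1,2) by (intro bounded_UN) auto
  ultimately show ?thesis using bounded_subset by blast
qed

lemma breakpoint_interval:
  fixes s :: "nat \<Rightarrow> real"
  assumes "s 0 < t" "t < s N" "t \<notin> s ` {..N}"
  shows "\<exists>j<N. s j < t \<and> t < s (Suc j)"
  using assms
proof (induction N)
  case (Suc N)
  show ?case
  proof (cases "t < s N")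
    case True
    moreover have "t \<notin> s ` {..N}" using Suc.prems(3) by auto
    ultimately have "\<exists>j<N. s j < t \<and> t < s (Suc j)" using Suc.IH Suc.prems(1) by blast
    then show ?thesis using less_SucI by blast
  next
    case False
    moreover have "t \<noteq> s N" using Suc.prems(3) by auto
    ultimately show ?thesis using Suc.prems(2) by (intro exI[of _ N]) auto
  qed
qed simp

section \<open>Pullbacks of holomorphic forms\<close>

context open_curve
begin

text \<open>\<open>pullback\<close> evaluates in a chart chosen by \<open>SOME\<close>. The chain
  rule for the velocity and the transformation law of the form compensate each other, so any chart
  at \<open>\<gamma> t\<close> may be used.\<close>

lemma pullback_eq:
  assumes \<omega>: "holomorphic_form X U \<omega>" and \<gamma>: "path \<gamma>" "path_image \<gamma> \<subseteq> U" and t: "t \<in> {0<..<1}"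
    and k: "k \<in> charts X" "\<gamma> t \<in> fst k" and d: "(snd k \<circ> \<gamma> has_vector_derivative d) (at t)"
  shows "pullback X \<gamma> \<omega> t = \<omega> k (\<gamma> t) 1 * d"
proof -
  define l where "l = (SOME k. k \<in> charts X \<and> \<gamma> t \<in> fst k)"
  have l: "l \<in> charts X" "\<gamma> t \<in> fst l"
    using someI_ex[of "\<lambda>k. k \<in> charts X \<and> \<gamma> t \<in> fst k"] k unfolding l_def by blast+
  define \<phi> where "\<phi> = snd l \<circ> chart_inv k"
  have tU: "\<gamma> t \<in> U" using \<gamma>(2) t by (auto simp: path_image_def)
  have "\<gamma> ` {0..1} \<subseteq> X" using \<gamma>(2) U_subset by (auto simp: path_image_def)
  moreover have "openin (top_of_set X) (fst k \<inter> fst l)" using chart_openin k(1) l(1) by blast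
  ultimately obtain M where M: "open M" "\<forall>s\<in>{0..1}. s \<in> M \<longleftrightarrow> \<gamma> s \<in> fst k \<inter> fst l"
    using preimage_nhd[OF \<gamma>(1)[unfolded path_def]] by blast
  have "(\<phi> has_field_derivative deriv \<phi> (snd k (\<gamma> t))) (at ((snd k \<circ> \<gamma>) t))"
    using chart_transition_deriv[OF k(1) l(1) k(2) l(2)] by (simp add: \<phi>_def)
  then have "(\<phi> \<circ> (snd k \<circ> \<gamma>) has_vector_derivative d * deriv \<phi> (snd k (\<gamma> t))) (at t)"
    by (rule field_vector_diff_chain_at[OF d])
  then have "(snd l \<circ> \<gamma> has_vector_derivative d * deriv \<phi> (snd k (\<gamma> t))) (at t)"
  proof (rule has_vector_derivative_transform_within_open)
    show "open (M \<inter> {0<..<1})" using M(1) by (intro open_Int open_greaterThanLessThan)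
    show "t \<in> M \<inter> {0<..<1}" using M(2) t k(2) l(2) by simp
    show "(\<phi> \<circ> (snd k \<circ> \<gamma>)) s = (snd l \<circ> \<gamma>) s" if "s \<in> M \<inter> {0<..<1}" for s
    proof -
      have "\<gamma> s \<in> fst k" using that M(2) by auto
      then show ?thesis using k(1) by (simp add: \<phi>_def)
    qed
  qed
  then have "vector_derivative (snd l \<circ> \<gamma>) (at t) = d * deriv \<phi> (snd k (\<gamma> t))" by (rule vector_derivative_at)
  then have "pullback X \<gamma> \<omega> t = \<omega> l (\<gamma> t) (deriv \<phi> (snd k (\<gamma> t)) * d)"
    by (simp add: pullback_def l_def Let_def mult.commute)
  also have "\<dots> = \<omega> k (\<gamma> t) d"
    using holomorphic_formD(3)[OF \<omega> k(1) l(1), of "\<gamma> t" d] k(2) l(2) tU by (simp add: \<phi>_def)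
  also have "\<dots> = \<omega> k (\<gamma> t) 1 * d"
    using holomorphic_formD(1)[OF \<omega> k(1), of "\<gamma> t" d] k(2) tU by simp
  finally show ?thesis .
qed

text \<open>The continuous function \<open>g\<close> is built from the one-sided derivatives and so
  exists up to the ends of the piece. At the ends themselves the two-sided derivative in
  \<open>pullback\<close> may fail to exist, whence the comparison on the open piece only.\<close>

lemma pullback_local:
  assumes \<omega>: "holomorphic_form X U \<omega>" and \<gamma>: "path \<gamma>" "path_image \<gamma> \<subseteq> U"
    and ab: "C1_piece X \<gamma> a b" "0 \<le> a" "b \<le> 1" and t0: "t0 \<in> {a..b}"
  shows "\<exists>M g. open M \<and> t0 \<in> M \<and> continuous_on (M \<inter> {a..b}) g \<and> (\<forall>t\<in>M \<inter> {a<..<b}. pullback X \<gamma> \<omega> t = g t)"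
proof -
  have \<gamma>U: "\<gamma> t \<in> U" if "t \<in> {0..1}" for t using \<gamma>(2) that by (auto simp: path_image_def)
  have \<gamma>X: "\<gamma> ` {0..1} \<subseteq> X" using \<gamma>U U_subset by blast
  have "\<gamma> t0 \<in> U" using \<gamma>U t0 ab by auto
  then obtain k where k: "k \<in> charts X" "\<gamma> t0 \<in> fst k" using chart_at by blast
  obtain D where D: "\<forall>t\<in>{a..b} \<inter> \<gamma> -` fst k. (snd k \<circ> \<gamma> has_vector_derivative D t) (at t within {a..b})"
    "continuous_on ({a..b} \<inter> \<gamma> -` fst k) D"
    using ab(1) k unfolding C1_piece_def by metis
  obtain M where M: "open M" "\<forall>s\<in>{0..1}. s \<in> M \<longleftrightarrow> \<gamma> s \<in> fst k"
    using preimage_nhd[OF \<gamma>(1)[unfolded path_def] \<gamma>X chart_openin[OF k(1)]] by blast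
  define h where "h = (\<lambda>\<zeta>. \<omega> k (chart_inv k \<zeta>) 1)"
  have h: "continuous_on (snd k ` (fst k \<inter> U)) h"
    unfolding h_def using holomorphic_on_imp_continuous_on[OF holomorphic_formD(2)[OF \<omega> k(1)]] .
  have Mk: "\<gamma> t \<in> fst k \<inter> U" if "t \<in> M \<inter> {a..b}" for t
    using M(2) that \<gamma>U[of t] ab by auto
  have "continuous_on (M \<inter> {a..b}) (\<lambda>t. snd k (\<gamma> t))"
    by (rule continuous_on_compose2[OF chart_continuous[OF k(1)] continuous_on_subset[OF \<gamma>(1)[unfolded path_def]]])
      (use Mk ab in auto)
  then have "continuous_on (M \<inter> {a..b}) (\<lambda>t. h (snd k (\<gamma> t)))"
    by (rule continuous_on_compose2[OF h]) (use Mk in blast)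
  then have "continuous_on (M \<inter> {a..b}) (\<lambda>t. h (snd k (\<gamma> t)) * D t)"
    by (rule continuous_on_mult[OF _ continuous_on_subset[OF D(2)]]) (use Mk in blast)
  moreover have "pullback X \<gamma> \<omega> t = h (snd k (\<gamma> t)) * D t" if t: "t \<in> M \<inter> {a<..<b}" for t
  proof -
    have tk: "\<gamma> t \<in> fst k" and tab: "t \<in> {a<..<b}" using Mk[of t] t by auto
    have "(snd k \<circ> \<gamma> has_vector_derivative D t) (at t within {a..b})" using D(1) tk tab by simp
    then have "(snd k \<circ> \<gamma> has_vector_derivative D t) (at t)" using tab by (simp add: at_within_Icc_at)
    then have "pullback X \<gamma> \<omega> t = \<omega> k (\<gamma> t) 1 * D t"
      using pullback_eq[OF \<omega> \<gamma> _ k(1) tk] tab ab by simp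
    then show ?thesis using k(1) tk by (simp add: h_def)
  qed
  moreover have "t0 \<in> M" using M(2) k(2) t0 ab by auto
  ultimately show ?thesis using M(1) by blast
qed

lemma pullback_piece:
  assumes \<omega>: "holomorphic_form X U \<omega>" and \<gamma>: "path \<gamma>" "path_image \<gamma> \<subseteq> U"
    and ab: "C1_piece X \<gamma> a b" "0 \<le> a" "b \<le> 1"
  shows "t \<in> {a<..<b} \<Longrightarrow> isCont (pullback X \<gamma> \<omega>) t" and "bounded (pullback X \<gamma> \<omega> ` {a<..<b})"
proof -
  note loc = pullback_local[OF \<omega> \<gamma> ab]
  assume t: "t \<in> {a<..<b}"
  then obtain M g where M: "open M" "t \<in> M" "continuous_on (M \<inter> {a..b}) g" "\<forall>t\<in>M \<inter> {a<..<b}. pullback X \<gamma> \<omega> t = g t"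
    using loc[of t] by auto
  have "continuous_on (M \<inter> {a<..<b}) g" by (rule continuous_on_subset[OF M(3)]) auto
  then have "continuous_on (M \<inter> {a<..<b}) (pullback X \<gamma> \<omega>)"
    by (rule continuous_on_eq) (use M(4) in simp)
  moreover have "open (M \<inter> {a<..<b})" using M(1) by (intro open_Int open_greaterThanLessThan)
  ultimately show "isCont (pullback X \<gamma> \<omega>) t"
    using M(2) t by (simp add: continuous_on_eq_continuous_at)
next
  note loc = pullback_local[OF \<omega> \<gamma> ab]
  show "bounded (pullback X \<gamma> \<omega> ` {a<..<b})"
  proof (rule bounded_image_if_locally_bounded[OF compact_Icc])
    show "{a<..<b} \<subseteq> {a..b}" by auto
    fix t assume t: "t \<in> {a..b}"
    then obtain M g where M: "open M" "t \<in> M" "continuous_on (M \<inter> {a..b}) g" "\<forall>t\<in>M \<inter> {a<..<b}. pullback X \<gamma> \<omega> t = g t"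
      using loc[of t] by blast
    obtain V where V: "open V" "V \<inter> (M \<inter> {a..b}) = g -` ball (g t) 1 \<inter> (M \<inter> {a..b})"
      using M(3) open_ball[of "g t" 1] unfolding continuous_on_open_invariant by metis
    have "t \<in> g -` ball (g t) 1 \<inter> (M \<inter> {a..b})" using M(2) t by simp
    then have tV: "t \<in> V" using V(2) by blast
    have "pullback X \<gamma> \<omega> ` (M \<inter> V \<inter> {a<..<b}) \<subseteq> ball (g t) 1"
    proof
      fix z assume "z \<in> pullback X \<gamma> \<omega> ` (M \<inter> V \<inter> {a<..<b})"
      then obtain s where s: "s \<in> M" "s \<in> V" "s \<in> {a<..<b}" "z = pullback X \<gamma> \<omega> s" by blast
      then have "z = g s" using M(4) by simp
      moreover have "s \<in> V \<inter> (M \<inter> {a..b})" using s by auto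
      ultimately show "z \<in> ball (g t) 1" using V(2) by auto
    qed
    then have "bounded (pullback X \<gamma> \<omega> ` (M \<inter> V \<inter> {a<..<b}))" by (rule bounded_subset[OF bounded_ball])
    then show "\<exists>M. open M \<and> t \<in> M \<and> bounded (pullback X \<gamma> \<omega> ` (M \<inter> {a<..<b}))"
      using M(1,2) V(1) tV by (intro exI[of _ "M \<inter> V"]) auto
  qed
qed

text \<open>The break points depend on \<open>\<gamma>\<close> alone, so one exceptional set serves
  all forms and all charts; later it has to serve infinitely many \<open>\<eta> k\<close> at
  once.\<close>

lemma piecewise_C1_pullback:
  assumes \<gamma>: "piecewise_C1_path X \<gamma>" "path_image \<gamma> \<subseteq> U"
  obtains S where "finite S"
    and "\<forall>\<omega>. holomorphic_form X U \<omega> \<longrightarrow> continuous_on ({0<..<1} - S) (pullback X \<gamma> \<omega>) \<and>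
           bounded (pullback X \<gamma> \<omega> ` ({0<..<1} - S))"
    and "\<forall>t\<in>{0<..<1} - S. \<forall>k\<in>charts X. \<gamma> t \<in> fst k \<longrightarrow> (\<exists>d. (snd k \<circ> \<gamma> has_vector_derivative d) (at t))"
proof -
  obtain N s where s: "s 0 = 0" "s N = 1" "\<forall>j<N. s j < s (Suc j) \<and> C1_piece X \<gamma> (s j) (s (Suc j))"
    and p: "path \<gamma>"
    using \<gamma>(1) unfolding piecewise_C1_path_iff by metis
  have s_mono: "s i \<le> s j" if "i \<le> j" "j \<le> N" for i j
    using that
  proof (induction rule: dec_induct)
    case (step m)
    then show ?case using s(3) by (meson Suc_le_eq less_imp_le order_trans)
  qed simp
  have s01: "0 \<le> s j" "s (Suc j) \<le> 1" if "j < N" for j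
    using s_mono[of 0 j] s_mono[of "Suc j" N] that s(1,2) by auto
  define S where "S = s ` {..N}"
  have S: "finite S" by (simp add: S_def)
  have piece: "\<exists>j<N. t \<in> {s j<..<s (Suc j)}" if "t \<in> {0<..<1} - S" for t
    using breakpoint_interval[of s t N] that s(1,2) by (auto simp: S_def)
  have "continuous_on ({0<..<1} - S) (pullback X \<gamma> \<omega>) \<and> bounded (pullback X \<gamma> \<omega> ` ({0<..<1} - S))"
    if \<omega>: "holomorphic_form X U \<omega>" for \<omega>
  proof
    note pp = pullback_piece[OF \<omega> p \<gamma>(2)]
    have "isCont (pullback X \<gamma> \<omega>) t" if "t \<in> {0<..<1} - S" for t
      using piece[OF that] pp(1) s(3) s01 by blast
    then show "continuous_on ({0<..<1} - S) (pullback X \<gamma> \<omega>)"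
      by (intro continuous_at_imp_continuous_on) blast
    have "bounded (\<Union>j\<in>{..<N}. pullback X \<gamma> \<omega> ` {s j<..<s (Suc j)})"
      by (intro bounded_UN) (use pp(2) s(3) s01 in auto)
    moreover have "pullback X \<gamma> \<omega> ` ({0<..<1} - S) \<subseteq> (\<Union>j\<in>{..<N}. pullback X \<gamma> \<omega> ` {s j<..<s (Suc j)})"
    proof
      fix z assume "z \<in> pullback X \<gamma> \<omega> ` ({0<..<1} - S)"
      then obtain t where t: "t \<in> {0<..<1} - S" "z = pullback X \<gamma> \<omega> t" by blast
      then show "z \<in> (\<Union>j\<in>{..<N}. pullback X \<gamma> \<omega> ` {s j<..<s (Suc j)})" using piece[OF t(1)] by blast
    qed
    ultimately show "bounded (pullback X \<gamma> \<omega> ` ({0<..<1} - S))" by (rule bounded_subset)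
  qed
  moreover have "\<exists>d. (snd k \<circ> \<gamma> has_vector_derivative d) (at t)"
    if t: "t \<in> {0<..<1} - S" and k: "k \<in> charts X" "\<gamma> t \<in> fst k" for t k
  proof -
    obtain j where j: "j < N" "t \<in> {s j<..<s (Suc j)}" using piece[OF t] by blast
    then have "C1_piece X \<gamma> (s j) (s (Suc j))" using s(3) by blast
    then obtain D where "\<forall>t\<in>{s j..s (Suc j)} \<inter> \<gamma> -` fst k. (snd k \<circ> \<gamma> has_vector_derivative D t) (at t within {s j..s (Suc j)})"
      using k(1) unfolding C1_piece_def by metis
    then have "(snd k \<circ> \<gamma> has_vector_derivative D t) (at t within {s j..s (Suc j)})" using j(2) k(2) by auto
    then show ?thesis using j(2) by (auto simp: at_within_Icc_at)
  qed
  ultimately show ?thesis using that[OF S] by blast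
qed

section \<open>Transport as iterated integral\<close>

lemma parallel_continuous:
  assumes L: "parallel X U \<eta> {0..1} \<gamma> L" and \<gamma>: "continuous_on {0..1} \<gamma>"
  shows "continuous_on {0..1} (\<lambda>t. L t i)"
  unfolding continuous_on_eq_continuous_within
proof
  fix t :: real assume t: "t \<in> {0..1}"
  obtain D Y N where N: "chart_disc X U D" "flat X \<eta> D Y" "open N" "t \<in> N" "\<forall>s\<in>N \<inter> {0..1}. \<gamma> s \<in> D \<and> L s = Y (\<gamma> s)"
    using parallelD[OF L t] by metis
  obtain k a r where k: "k \<in> charts X" "r > 0" "ball a r \<subseteq> snd k ` (fst k \<inter> U)" "D = chart_inv k ` ball a r"
    and Dk: "\<forall>p\<in>D. p \<in> U \<and> p \<in> fst k \<and> snd k p \<in> ball a r"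
    using chart_discE[OF N(1)] .
  have Y: "continuous_on (ball a r) (\<lambda>z. Y (chart_inv k z) i)"
  proof (cases i)
    case 0
    obtain c where "\<forall>p\<in>D. Y p 0 = c" using N(2) unfolding flat_def by blast
    then have c: "c = Y (chart_inv k z) i" if "z \<in> ball a r" for z using that k(4) 0 by auto
    show ?thesis by (rule continuous_on_eq[OF continuous_on_const c])
  next
    case (Suc m)
    have "isCont (\<lambda>z. Y (chart_inv k z) i) z" if z: "z \<in> ball a r" for z
    proof -
      define q where "q = chart_inv k z"
      have q: "q \<in> D" "q \<in> fst k" "snd k q = z" using z k Dk by (auto simp: q_def)
      then have "((\<lambda>\<zeta>. Y (chart_inv k \<zeta>) (Suc m)) has_field_derivative Y q m * \<eta> m k q 1) (at (snd k q))"
        using N(2) k(1) unfolding flat_def by blast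
      then show ?thesis using q(3) Suc DERIV_isCont by blast
    qed
    then show ?thesis by (intro continuous_at_imp_continuous_on) blast
  qed
  have "continuous_on (N \<inter> {0..1}) (\<lambda>s. snd k (\<gamma> s))"
    by (rule continuous_on_compose2[OF chart_continuous[OF k(1)] continuous_on_subset[OF \<gamma>]]) (use N(5) Dk in auto)
  then have "continuous_on (N \<inter> {0..1}) (\<lambda>s. Y (chart_inv k (snd k (\<gamma> s))) i)"
    by (rule continuous_on_compose2[OF Y]) (use N(5) Dk in auto)
  then have "continuous_on (N \<inter> {0..1}) (\<lambda>s. L s i)"
    by (rule continuous_on_eq) (use N(5) Dk k(1) in simp)
  then have "continuous (at t within N \<inter> {0..1}) (\<lambda>s. L s i)"
    using t N(4) by (simp add: continuous_on_eq_continuous_within)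
  moreover have "at t within N \<inter> {0..1} = at t within {0..1}"
    by (rule at_within_nhd[OF N(4) N(3)]) blast
  ultimately show "continuous (at t within {0..1}) (\<lambda>s. L s i)" by simp
qed

lemma parallel_derivative:
  assumes \<eta>: "holomorphic_form X U (\<eta> i)" and L: "parallel X U \<eta> {0..1} \<gamma> L"
    and \<gamma>: "path \<gamma>" "path_image \<gamma> \<subseteq> U" and t: "t \<in> {0<..<1}"
    and diff: "\<forall>k\<in>charts X. \<gamma> t \<in> fst k \<longrightarrow> (\<exists>d. (snd k \<circ> \<gamma> has_vector_derivative d) (at t))"
  shows "((\<lambda>s. L s (Suc i)) has_vector_derivative L t i * pullback X \<gamma> (\<eta> i) t) (at t)"
proof -
  have "t \<in> {0..1}" using t by auto
  then obtain D Y N where N: "chart_disc X U D" "flat X \<eta> D Y" "open N" "t \<in> N" "\<forall>s\<in>N \<inter> {0..1}. \<gamma> s \<in> D \<and> L s = Y (\<gamma> s)"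
    using parallelD[OF L] by metis
  obtain k a r where k: "k \<in> charts X" "r > 0" "ball a r \<subseteq> snd k ` (fst k \<inter> U)" "D = chart_inv k ` ball a r"
    and Dk: "\<forall>p\<in>D. p \<in> U \<and> p \<in> fst k \<and> snd k p \<in> ball a r"
    using chart_discE[OF N(1)] .
  have tD: "\<gamma> t \<in> D" "L t = Y (\<gamma> t)" using N(4,5) t by auto
  have tk: "\<gamma> t \<in> fst k" using tD Dk by blast
  obtain d where d: "(snd k \<circ> \<gamma> has_vector_derivative d) (at t)" using diff k(1) tk by blast
  have "((\<lambda>\<zeta>. Y (chart_inv k \<zeta>) (Suc i)) has_field_derivative Y (\<gamma> t) i * \<eta> i k (\<gamma> t) 1) (at ((snd k \<circ> \<gamma>) t))"
    using N(2) k(1) tD(1) tk unfolding flat_def by simp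
  then have "((\<lambda>\<zeta>. Y (chart_inv k \<zeta>) (Suc i)) \<circ> (snd k \<circ> \<gamma>) has_vector_derivative d * (Y (\<gamma> t) i * \<eta> i k (\<gamma> t) 1)) (at t)"
    by (rule field_vector_diff_chain_at[OF d])
  then have "((\<lambda>s. L s (Suc i)) has_vector_derivative d * (Y (\<gamma> t) i * \<eta> i k (\<gamma> t) 1)) (at t)"
  proof (rule has_vector_derivative_transform_within_open)
    show "open (N \<inter> {0<..<1})" using N(3) by (intro open_Int open_greaterThanLessThan)
    show "t \<in> N \<inter> {0<..<1}" using N(4) t by blast
    show "((\<lambda>\<zeta>. Y (chart_inv k \<zeta>) (Suc i)) \<circ> (snd k \<circ> \<gamma>)) s = L s (Suc i)" if "s \<in> N \<inter> {0<..<1}" for s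
      using that N(5) Dk k(1) by simp
  qed
  then show ?thesis using pullback_eq[OF \<eta> \<gamma> t k(1) tk d] tD(2) by (simp add: mult_ac)
qed

text \<open>Each local section has its own constant in component 0; overlapping parameter
  neighbourhoods force these constants to coincide.\<close>

lemma parallel_constant_0:
  assumes L: "parallel X U \<eta> {0..1} \<gamma> L" and t: "t \<in> {0..1}"
  shows "L t 0 = L 0 0"
proof (rule connected_induction_simple[where P = "\<lambda>t. L t 0 = L 0 0" and a = 0 and b = t and S = "{0..1}"])
  show "connected {0..1::real}" "0 \<in> {0..1::real}" "t \<in> {0..1}" using t by auto
  fix a :: real assume a: "a \<in> {0..1}"
  obtain D Y N where N: "chart_disc X U D" "flat X \<eta> D Y" "open N" "a \<in> N" "\<forall>s\<in>N \<inter> {0..1}. \<gamma> s \<in> D \<and> L s = Y (\<gamma> s)"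
    using parallelD[OF L a] by metis
  obtain c where c: "\<forall>p\<in>D. Y p 0 = c" using N(2) unfolding flat_def by blast
  then have "L s 0 = c" if "s \<in> N \<inter> {0..1}" for s using N(5) that by simp
  then show "\<exists>T. openin (top_of_set {0..1}) T \<and> a \<in> T \<and> (\<forall>x\<in>T. \<forall>y\<in>T. L x 0 = L 0 0 \<longrightarrow> L y 0 = L 0 0)"
    using openin_open_Int[OF N(3), of "{0..1}"] a N(4) by (intro exI[of _ "{0..1} \<inter> N"]) (auto simp: Int_commute)
qed simp

text \<open>Along \<open>\<gamma>\<close> the flatness equations become those of
  \<open>iterated_primitives\<close>: component 0 is 1, every later component starts at 0 and has
  the previous one times the pullback coefficient as derivative.\<close>

lemma iterated_integral_eq_parallel:
  assumes \<eta>: "\<forall>i. holomorphic_form X U (\<eta> i)" and L: "parallel X U \<eta> {0..1} \<gamma> L" "L 0 = (\<lambda>i. if i = 0 then 1 else 0)"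
    and \<gamma>: "piecewise_C1_path X \<gamma>" "path_image \<gamma> \<subseteq> U"
  shows "iterated_integral X (map \<eta> [0..<n]) \<gamma> = L 1 n"
proof -
  have p: "path \<gamma>" using \<gamma>(1) by (simp add: piecewise_C1_path_def)
  obtain S where S: "finite S"
    "\<forall>\<omega>. holomorphic_form X U \<omega> \<longrightarrow> continuous_on ({0<..<1} - S) (pullback X \<gamma> \<omega>) \<and>
           bounded (pullback X \<gamma> \<omega> ` ({0<..<1} - S))"
    "\<forall>t\<in>{0<..<1} - S. \<forall>k\<in>charts X. \<gamma> t \<in> fst k \<longrightarrow> (\<exists>d. (snd k \<circ> \<gamma> has_vector_derivative d) (at t))"
    using piecewise_C1_pullback[OF \<gamma>] .
  have "\<exists>B. \<forall>t\<in>{0<..<1} - S. norm (pullback X \<gamma> (\<eta> k) t) \<le> B" for k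
  proof -
    have "bounded (pullback X \<gamma> (\<eta> k) ` ({0<..<1} - S))" using S(2) \<eta> by blast
    then show ?thesis unfolding bounded_iff by blast
  qed
  then obtain B where B: "\<And>k t. t \<in> {0<..<1} - S \<Longrightarrow> norm (pullback X \<gamma> (\<eta> k) t) \<le> B k" by metis
  interpret iterated_primitives "\<lambda>k. pullback X \<gamma> (\<eta> k)" "\<lambda>k t. L t k" S B
  proof
    show "finite S" by (rule S)
    show "continuous_on ({0<..<1} - S) (pullback X \<gamma> (\<eta> k))" for k using S(2) \<eta> by blast
    show "norm (pullback X \<gamma> (\<eta> k) t) \<le> B k" if "t \<in> {0<..<1} - S" for t k using B that by blast
    show "L t 0 = 1" if "t \<in> {0..1}" for t using parallel_constant_0[OF L(1) that] L(2) by simp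
    show "L 0 (Suc k) = 0" for k using L(2) by simp
    show "continuous_on {0..1} (\<lambda>t. L t k)" for k
      by (rule parallel_continuous[OF L(1) p[unfolded path_def]])
    show "((\<lambda>t. L t (Suc k)) has_vector_derivative L t k * pullback X \<gamma> (\<eta> k) t) (at t)"
      if "t \<in> {0<..<1} - S" for t k
      by (rule parallel_derivative[OF _ L(1) p \<gamma>(2)]) (use \<eta> S(3) that in auto)
  qed
  have "iterated_integral X (map \<eta> [0..<n]) \<gamma> =
      (LINT t : ordered_tuples n 1 | (\<Pi>\<^sub>M i\<in>{..<n}. lborel). \<Prod>i<n. pullback X \<gamma> (\<eta> i) (t i))"
    unfolding iterated_integral_def ordered_tuples_def by simp
  then show ?thesis using integral_ordered_tuples[of 1 n] by (simp add: set_lebesgue_integral_def)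
qed

text \<open>The representative \<open>p\<close> may be merely continuous. Homotopy invariance of
  transport gives all piecewise C^1 members the same integral, and the existence of such a member
  leaves only one possible value.\<close>

lemma class_integral_eq_parallel:
  assumes \<eta>: "\<forall>i. holomorphic_form X U (\<eta> i)" and L: "parallel X U \<eta> {0..1} p L" "L 0 = (\<lambda>i. if i = 0 then 1 else 0)"
    and p: "path p" "path_image p \<subseteq> U"
  shows "class_integral X (map \<eta> [0..<n]) (Collect (homotopic_paths U p)) = L 1 n"
proof -
  have eq: "iterated_integral X (map \<eta> [0..<n]) \<gamma> = L 1 n"
    if \<gamma>: "homotopic_paths U p \<gamma>" "piecewise_C1_path X \<gamma>" for \<gamma>
  proof -
    have g: "path \<gamma>" "path_image \<gamma> \<subseteq> U"
      using homotopic_paths_imp_path[OF \<gamma>(1)] homotopic_paths_imp_subset[OF \<gamma>(1)] by auto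
    have "\<gamma> ` {0..1} \<subseteq> U" using g(2) by (simp add: path_image_def)
    then obtain K where K: "parallel X U \<eta> {0..1} \<gamma> K" "K 0 = (\<lambda>i. if i = 0 then 1 else 0)"
      using parallel_exists[OF \<eta> g(1)[unfolded path_def]] by metis
    have "L 1 = K 1" using parallel_homotopic_paths[OF \<eta> \<gamma>(1) L(1) K(1)] L(2) K(2) by simp
    then show ?thesis using iterated_integral_eq_parallel[OF \<eta> K \<gamma>(2) g(2)] by simp
  qed
  obtain \<gamma> where \<gamma>: "piecewise_C1_path X \<gamma>" "homotopic_paths U p \<gamma>"
    using homotopic_piecewise_C1[OF p] by blast
  show ?thesis
    unfolding class_integral_def
  proof (rule the_equality)
    show "\<forall>\<gamma>\<in>Collect (homotopic_paths U p). piecewise_C1_path X \<gamma> \<longrightarrow> iterated_integral X (map \<eta> [0..<n]) \<gamma> = L 1 n"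
      using eq by simp
    fix I assume "\<forall>\<gamma>\<in>Collect (homotopic_paths U p). piecewise_C1_path X \<gamma> \<longrightarrow> iterated_integral X (map \<eta> [0..<n]) \<gamma> = I"
    then have "iterated_integral X (map \<eta> [0..<n]) \<gamma> = I" using \<gamma> by blast
    then show "I = L 1 n" using eq[OF \<gamma>(2,1)] by simp
  qed
qed

lemma zero_form: "holomorphic_form X U (\<lambda>_ _ _. 0)"
  unfolding holomorphic_form_def one_form_def by (simp add: linear_zero)

text \<open>Transport along \<open>p +++ q\<close> is transport along \<open>p\<close>, continued
  along \<open>q\<close> from the value \<open>K 1\<close>. By convolution the continuation is a
  combination, with coefficients \<open>K 1 j\<close>, of the transports \<open>M j\<close> for the
  tails of the word; its component \<open>n\<close> is the sum over all cuts of the word.\<close>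

lemma class_integral_join:
  assumes \<omega>: "\<forall>\<omega>\<in>set \<omega>s. holomorphic_form X U \<omega>"
    and p: "path p" "path_image p \<subseteq> U" and q: "path q" "path_image q \<subseteq> U" and pq: "pathfinish p = pathstart q"
  shows "class_integral X \<omega>s (Collect (homotopic_paths U (p +++ q))) =
    (\<Sum>j\<le>length \<omega>s. class_integral X (take j \<omega>s) (Collect (homotopic_paths U p)) *
                    class_integral X (drop j \<omega>s) (Collect (homotopic_paths U q)))"
proof -
  define n where "n = length \<omega>s"
  \<comment> \<open>The finite word is continued by zero forms to the infinite sequence that
    transport works with.\<close>
  define \<eta> where "\<eta> = (\<lambda>i. if i < n then \<omega>s ! i else (\<lambda>_ _ _. 0))"
  define \<epsilon> :: "nat \<Rightarrow> complex" where "\<epsilon> = (\<lambda>i. if i = 0 then 1 else 0)"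
  have \<eta>: "\<forall>i. holomorphic_form X U (\<eta> i)" using \<omega> zero_form by (simp add: \<eta>_def n_def)
  have \<eta>': "\<forall>i. holomorphic_form X U (\<eta> (j + i))" for j using \<eta> by blast
  have take: "map \<eta> [0..<j] = take j \<omega>s" if "j \<le> n" for j
    using that by (auto simp: \<eta>_def n_def intro: nth_equalityI)
  have drop: "map (\<lambda>i. \<eta> (j + i)) [0..<n - j] = drop j \<omega>s" for j
    by (auto simp: \<eta>_def n_def intro!: nth_equalityI)
  have p1: "continuous_on {0..1} p" "p ` {0..1} \<subseteq> U" and q1: "continuous_on {0..1} q" "q ` {0..1} \<subseteq> U"
    using p q by (auto simp: path_def path_image_def)
  obtain K where K: "parallel X U \<eta> {0..1} p K" "K 0 = \<epsilon>"
    using parallel_exists[OF \<eta> p1] by metis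
  have "\<exists>M. parallel X U (\<lambda>i. \<eta> (j + i)) {0..1} q M \<and> M 0 = \<epsilon>" for j
    by (rule parallel_exists[OF \<eta>' q1])
  then obtain M where M: "\<And>j. parallel X U (\<lambda>i. \<eta> (j + i)) {0..1} q (M j)" "\<And>j. M j 0 = \<epsilon>" by metis
  define R where "R = (\<lambda>t m. \<Sum>j\<le>m. K 1 j * M j t (m - j))"
  have R: "parallel X U \<eta> {0..1} q R"
    unfolding R_def by (rule parallel_convolution[OF \<eta> q1 M(1)])
  \<comment> \<open>\<open>M j\<close> starts at the unit vector, so at the start of
    \<open>q\<close> only the term \<open>j = m\<close> survives.\<close>
  have R0: "R 0 = K 1"
  proof
    fix m
    have "R 0 m = (\<Sum>j\<le>m. if j = m then K 1 j else 0)"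
      unfolding R_def by (rule sum.cong) (auto simp: M(2) \<epsilon>_def)
    then show "R 0 m = K 1 m" by simp
  qed
  define L where "L = (\<lambda>s. if s \<le> 1/2 then (K \<circ> (\<lambda>s. 2 * s)) s else (R \<circ> (\<lambda>s. 2 * s - 1)) s)"
  have "parallel X U \<eta> {0..1} (p +++ q) L"
    unfolding L_def
  proof (rule parallel_join)
    show "parallel X U \<eta> {0..1/2} (p +++ q) (K \<circ> (\<lambda>s. 2 * s))"
    proof (rule parallel_cong)
      show "parallel X U \<eta> {0..1/2} (p \<circ> (\<lambda>s. 2 * s)) (K \<circ> (\<lambda>s. 2 * s))"
        by (rule parallel_compose[OF K(1)]) (auto intro!: continuous_intros)
    qed (auto simp: joinpaths_def)
    show "parallel X U \<eta> {1/2..1} (p +++ q) (R \<circ> (\<lambda>s. 2 * s - 1))"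
    proof (rule parallel_cong)
      show "parallel X U \<eta> {1/2..1} (q \<circ> (\<lambda>s. 2 * s - 1)) (R \<circ> (\<lambda>s. 2 * s - 1))"
        by (rule parallel_compose[OF R]) (auto intro!: continuous_intros)
      show "(q \<circ> (\<lambda>s. 2 * s - 1)) s = (p +++ q) s" if "s \<in> {1/2..1}" for s
      proof (cases "s = 1/2")
        case True
        show ?thesis unfolding True using pq by (simp add: joinpaths_def pathfinish_def pathstart_def)
      next
        case False
        then show ?thesis using that by (simp add: joinpaths_def)
      qed
    qed simp
    show "(K \<circ> (\<lambda>s. 2 * s)) (1/2) = (R \<circ> (\<lambda>s. 2 * s - 1)) (1/2)" using R0 by simp
    show "continuous_on {0..1} (p +++ q)" using p q pq by (simp add: path_join path_def[symmetric])
  qed simp_all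
  moreover have "L 0 = \<epsilon>" using K(2) by (simp add: L_def)
  ultimately have "class_integral X (map \<eta> [0..<n]) (Collect (homotopic_paths U (p +++ q))) = L 1 n"
    unfolding \<epsilon>_def by (rule class_integral_eq_parallel[OF \<eta>]) (use p q pq in \<open>auto simp: path_join subset_path_image_join\<close>)
  also have "L 1 n = (\<Sum>j\<le>n. K 1 j * M j 1 (n - j))" by (simp add: L_def R_def)
  also have "\<dots> = (\<Sum>j\<le>n. class_integral X (take j \<omega>s) (Collect (homotopic_paths U p)) *
                    class_integral X (drop j \<omega>s) (Collect (homotopic_paths U q)))"
  proof (rule sum.cong[OF refl])
    fix j assume "j \<in> {..n}"
    then have "class_integral X (take j \<omega>s) (Collect (homotopic_paths U p)) = K 1 j"
      using class_integral_eq_parallel[OF \<eta> K(1) K(2)[unfolded \<epsilon>_def] p, of j] take[of j] by simp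
    moreover have "class_integral X (drop j \<omega>s) (Collect (homotopic_paths U q)) = M j 1 (n - j)"
      using class_integral_eq_parallel[OF \<eta>' M(1) M(2)[unfolded \<epsilon>_def] q, of j "n - j"] drop[of j] by simp
    ultimately show "K 1 j * M j 1 (n - j) = class_integral X (take j \<omega>s) (Collect (homotopic_paths U p)) *
                    class_integral X (drop j \<omega>s) (Collect (homotopic_paths U q))" by simp
  qed
  finally show ?thesis using take[of n] by (simp add: n_def)
qed

lemma class_integral_constant:
  assumes \<omega>: "\<forall>\<omega>\<in>set \<omega>s. holomorphic_form X U \<omega>" and e: "e \<in> U"
  shows "class_integral X \<omega>s (Collect (homotopic_paths U (\<lambda>_. e))) = (if \<omega>s = [] then 1 else 0)"
proof -
  define n where "n = length \<omega>s"
  define \<eta> where "\<eta> = (\<lambda>i. if i < n then \<omega>s ! i else (\<lambda>_ _ _. 0))"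
  have \<eta>: "\<forall>i. holomorphic_form X U (\<eta> i)" using \<omega> zero_form by (simp add: \<eta>_def n_def)
  have map: "map \<eta> [0..<n] = \<omega>s" by (auto simp: \<eta>_def n_def intro: nth_equalityI)
  obtain D where D: "chart_disc X U D" "e \<in> D" using chart_disc_exists[OF e open_U] by blast
  obtain Y where Y: "flat X \<eta> D Y" "Y e = (\<lambda>i. if i = 0 then 1 else 0)"
    using flat_exists[OF \<eta> D, where v = "\<lambda>i. if i = 0 then 1 else 0"] by blast
  have "parallel X U \<eta> {0..1} (\<lambda>_. e) (\<lambda>_. Y e)" by (rule parallel_flat[OF D(1) Y(1)]) (use D in auto)
  then have "class_integral X (map \<eta> [0..<n]) (Collect (homotopic_paths U (\<lambda>_. e))) = Y e n"
    by (rule class_integral_eq_parallel[OF \<eta> _ Y(2)]) (use e in \<open>auto simp: path_def path_image_def\<close>)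
  then show ?thesis unfolding map by (simp add: Y(2) n_def)
qed

lemma class_integral_Nil:
  assumes "path p" "path_image p \<subseteq> U"
  shows "class_integral X [] (Collect (homotopic_paths U p)) = 1"
proof -
  have z: "\<forall>i::nat. holomorphic_form X U ((\<lambda>_ _ _ _. 0) i)" using zero_form by blast
  have "p ` {0..1} \<subseteq> U" using assms(2) by (simp add: path_image_def)
  then obtain K where K: "parallel X U (\<lambda>_ _ _ _. 0) {0..1} p K" "K 0 = (\<lambda>i. if i = 0 then 1 else 0)"
    using parallel_exists[OF z assms(1)[unfolded path_def]] by metis
  show ?thesis
    using class_integral_eq_parallel[OF z K assms, of 0] parallel_constant_0[OF K(1), of 1] K(2) by simp
qed

end

section \<open>The group ring\<close>

text \<open>Elements with different supports are compared over a common one; additional keys have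
  coefficient zero.\<close>

lemma group_ring_integral_superset:
  assumes "finite S" "Poly_Mapping.keys x \<subseteq> S"
  shows "group_ring_integral X \<omega>s x = (\<Sum>\<Gamma>\<in>S. of_int (Poly_Mapping.lookup x \<Gamma>) * class_integral X \<omega>s \<Gamma>)"
  unfolding group_ring_integral_def
  by (rule sum.mono_neutral_left) (use assms in \<open>auto simp: in_keys_iff\<close>)

lemma group_ring_integral_0 [simp]: "group_ring_integral X \<omega>s 0 = 0"
  by (simp add: group_ring_integral_def)

lemma group_ring_integral_frag_of [simp]: "group_ring_integral X \<omega>s (frag_of a) = class_integral X \<omega>s a"
  by (simp add: group_ring_integral_def)

lemma group_ring_integral_add:
  "group_ring_integral X \<omega>s (x + y) = group_ring_integral X \<omega>s x + group_ring_integral X \<omega>s y"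
proof -
  let ?S = "Poly_Mapping.keys x \<union> Poly_Mapping.keys y"
  have "Poly_Mapping.keys (x + y) \<subseteq> ?S" by (rule keys_add)
  then show ?thesis
    by (simp add: group_ring_integral_superset[where S = ?S] lookup_add sum.distrib distrib_right)
qed

lemma group_ring_integral_diff:
  "group_ring_integral X \<omega>s (x - y) = group_ring_integral X \<omega>s x - group_ring_integral X \<omega>s y"
  using group_ring_integral_add[of X \<omega>s "x - y" y] by simp

lemma group_ring_integral_cmul:
  "group_ring_integral X \<omega>s (frag_cmul c x) = of_int c * group_ring_integral X \<omega>s x"
proof -
  have "Poly_Mapping.keys (frag_cmul c x) \<subseteq> Poly_Mapping.keys x" by (rule keys_cmul)
  then show ?thesis
    by (simp add: group_ring_integral_superset[where S = "Poly_Mapping.keys x"] sum_distrib_left mult.assoc)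
qed

lemma group_ring_integral_sum:
  "group_ring_integral X \<omega>s (\<Sum>i\<in>A. f i) = (\<Sum>i\<in>A. group_ring_integral X \<omega>s (f i))"
  by (induction A rule: infinite_finite_induct) (simp_all add: group_ring_integral_add)

lemma group_ring_integral_extend:
  "group_ring_integral X \<omega>s (frag_extend f x) =
    (\<Sum>a\<in>Poly_Mapping.keys x. of_int (Poly_Mapping.lookup x a) * group_ring_integral X \<omega>s (f a))"
  by (simp add: frag_extend_def group_ring_integral_sum group_ring_integral_cmul)

lemma group_ring_mult_keys:
  assumes "\<And>a b. a \<in> carrier G \<Longrightarrow> b \<in> carrier G \<Longrightarrow> a \<otimes>\<^bsub>G\<^esub> b \<in> carrier G"
    and "Poly_Mapping.keys x \<subseteq> carrier G" "Poly_Mapping.keys y \<subseteq> carrier G"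
  shows "Poly_Mapping.keys (group_ring_mult G x y) \<subseteq> carrier G"
proof
  fix c assume "c \<in> Poly_Mapping.keys (group_ring_mult G x y)"
  then have "c \<in> (\<Union>a\<in>Poly_Mapping.keys x. Poly_Mapping.keys (frag_extend (\<lambda>b. frag_of (a \<otimes>\<^bsub>G\<^esub> b)) y))"
    unfolding group_ring_mult_def by (rule subsetD[OF keys_frag_extend])
  then obtain a where a: "a \<in> Poly_Mapping.keys x"
    "c \<in> Poly_Mapping.keys (frag_extend (\<lambda>b. frag_of (a \<otimes>\<^bsub>G\<^esub> b)) y)"
    by (elim UN_E)
  have "c \<in> (\<Union>b\<in>Poly_Mapping.keys y. Poly_Mapping.keys (frag_of (a \<otimes>\<^bsub>G\<^esub> b)))"
    by (rule subsetD[OF keys_frag_extend a(2)])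
  then obtain b where "b \<in> Poly_Mapping.keys y" "c \<in> Poly_Mapping.keys (frag_of (a \<otimes>\<^bsub>G\<^esub> b))"
    by (elim UN_E)
  then show "c \<in> carrier G" using a(1) assms by auto
qed

text \<open>Both sides are biadditive in \<open>x\<close> and \<open>y\<close>, so the coproduct
  formula for group elements extends to the group ring; the support conditions confine its use to
  the carrier.\<close>

lemma group_ring_integral_mult:
  assumes mult: "\<And>a b. a \<in> carrier G \<Longrightarrow> b \<in> carrier G \<Longrightarrow> class_integral X \<omega>s (a \<otimes>\<^bsub>G\<^esub> b) =
      (\<Sum>j\<le>length \<omega>s. class_integral X (take j \<omega>s) a * class_integral X (drop j \<omega>s) b)"
    and x: "Poly_Mapping.keys x \<subseteq> carrier G" and y: "Poly_Mapping.keys y \<subseteq> carrier G"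
  shows "group_ring_integral X \<omega>s (group_ring_mult G x y) =
    (\<Sum>j\<le>length \<omega>s. group_ring_integral X (take j \<omega>s) x * group_ring_integral X (drop j \<omega>s) y)"
proof -
  let ?x = "\<lambda>a. of_int (Poly_Mapping.lookup x a) :: complex" and ?y = "\<lambda>a. of_int (Poly_Mapping.lookup y a) :: complex"
  have "group_ring_integral X \<omega>s (group_ring_mult G x y) =
      (\<Sum>a\<in>Poly_Mapping.keys x. ?x a * (\<Sum>b\<in>Poly_Mapping.keys y. ?y b * class_integral X \<omega>s (a \<otimes>\<^bsub>G\<^esub> b)))"
    by (simp add: group_ring_mult_def group_ring_integral_extend)
  also have "\<dots> = (\<Sum>a\<in>Poly_Mapping.keys x. \<Sum>b\<in>Poly_Mapping.keys y. \<Sum>j\<le>length \<omega>s.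
      (?x a * class_integral X (take j \<omega>s) a) * (?y b * class_integral X (drop j \<omega>s) b))"
    unfolding sum_distrib_left
  proof (intro sum.cong refl)
    fix a b assume "a \<in> Poly_Mapping.keys x" "b \<in> Poly_Mapping.keys y"
    then have "class_integral X \<omega>s (a \<otimes>\<^bsub>G\<^esub> b) =
      (\<Sum>j\<le>length \<omega>s. class_integral X (take j \<omega>s) a * class_integral X (drop j \<omega>s) b)" using mult x y by blast
    then show "?x a * (?y b * class_integral X \<omega>s (a \<otimes>\<^bsub>G\<^esub> b)) = (\<Sum>j\<le>length \<omega>s.
      (?x a * class_integral X (take j \<omega>s) a) * (?y b * class_integral X (drop j \<omega>s) b))"
      by (simp add: sum_distrib_left mult_ac)
  qed
  also have "\<dots> = (\<Sum>a\<in>Poly_Mapping.keys x. \<Sum>j\<le>length \<omega>s. \<Sum>b\<in>Poly_Mapping.keys y.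
      (?x a * class_integral X (take j \<omega>s) a) * (?y b * class_integral X (drop j \<omega>s) b))"
    by (intro sum.cong refl) (rule sum.swap)
  also have "\<dots> = (\<Sum>j\<le>length \<omega>s. \<Sum>a\<in>Poly_Mapping.keys x. \<Sum>b\<in>Poly_Mapping.keys y.
      (?x a * class_integral X (take j \<omega>s) a) * (?y b * class_integral X (drop j \<omega>s) b))"
    by (rule sum.swap)
  finally show ?thesis by (simp add: group_ring_integral_def sum_product)
qed

section \<open>Restriction and linear combination of holomorphic forms\<close>

lemma holomorphic_form_subset:
  assumes "holomorphic_form X S \<omega>" "T \<subseteq> S"
  shows "holomorphic_form X T \<omega>"
  unfolding holomorphic_form_def one_form_def
proof (intro conjI ballI allI)
  fix k assume k: "k \<in> charts X"
  have "(\<lambda>\<zeta>. \<omega> k (chart_inv k \<zeta>) 1) holomorphic_on (snd k ` (fst k \<inter> S))"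
    using assms(1) k unfolding holomorphic_form_def by blast
  then show "(\<lambda>\<zeta>. \<omega> k (chart_inv k \<zeta>) 1) holomorphic_on (snd k ` (fst k \<inter> T))"
    by (rule holomorphic_on_subset) (use assms(2) in blast)
  fix p v assume "p \<in> fst k \<inter> T"
  then have p: "p \<in> fst k \<inter> S" using assms(2) by blast
  show "linear (\<omega> k p)" using assms(1) k p unfolding holomorphic_form_def one_form_def by blast
  show "\<omega> k p v = \<omega> k p 1 * v" using assms(1) k p unfolding holomorphic_form_def by blast
next
  fix k l p v assume k: "k \<in> charts X" "l \<in> charts X" and "p \<in> fst k \<inter> fst l \<inter> T"
  then have p: "p \<in> fst k \<inter> fst l \<inter> S" using assms(2) by blast
  show "\<omega> k p v = \<omega> l p (deriv (snd l \<circ> chart_inv k) (snd k p) * v)"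
    using assms(1) k p unfolding holomorphic_form_def one_form_def by blast
qed

lemma holomorphic_form_comb:
  assumes \<alpha>: "\<forall>i\<in>{1..N}. holomorphic_form X S (\<alpha> i)"
  shows "holomorphic_form X S (form_comb N a \<alpha>)"
  unfolding holomorphic_form_def one_form_def
proof (intro conjI ballI allI)
  fix k p assume k: "k \<in> charts X" and p: "p \<in> fst k \<inter> S"
  have lin: "linear (\<alpha> i k p)" if "i \<in> {1..N}" for i
    using \<alpha> that k p unfolding holomorphic_form_def one_form_def by blast
  have "linear (\<lambda>v. a i * \<alpha> i k p v)" if "i \<in> {1..N}" for i
    using lin[OF that] by (intro linearI) (simp_all add: linear_add linear_scale distrib_left)
  then show "linear (form_comb N a \<alpha> k p)"
    unfolding form_comb_def by (intro linear_compose_sum) blast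
  fix v
  have "\<alpha> i k p v = \<alpha> i k p 1 * v" if "i \<in> {1..N}" for i
    using \<alpha> that k p unfolding holomorphic_form_def by blast
  then show "form_comb N a \<alpha> k p v = form_comb N a \<alpha> k p 1 * v"
    unfolding form_comb_def sum_distrib_right by (intro sum.cong refl) (metis mult.assoc)
next
  fix k l p v assume k: "k \<in> charts X" and l: "l \<in> charts X" and p: "p \<in> fst k \<inter> fst l \<inter> S"
  have "\<alpha> i k p v = \<alpha> i l p (deriv (snd l \<circ> chart_inv k) (snd k p) * v)" if "i \<in> {1..N}" for i
    using \<alpha> that k l p unfolding holomorphic_form_def one_form_def by blast
  then show "form_comb N a \<alpha> k p v = form_comb N a \<alpha> l p (deriv (snd l \<circ> chart_inv k) (snd k p) * v)"
    unfolding form_comb_def by (intro sum.cong refl) metis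
next
  fix k assume k: "k \<in> charts X"
  show "(\<lambda>\<zeta>. form_comb N a \<alpha> k (chart_inv k \<zeta>) 1) holomorphic_on (snd k ` (fst k \<inter> S))"
    unfolding form_comb_def
    by (intro holomorphic_on_sum holomorphic_on_mult holomorphic_on_const)
      (use \<alpha> k in \<open>auto simp: holomorphic_form_def\<close>)
qed

section \<open>Products in the augmentation ideal of the fundamental group\<close>

context open_curve
begin

lemma fundamental_group_carrierE:
  assumes "A \<in> carrier (fundamental_group U e)"
  obtains p where "A = Collect (homotopic_paths U p)" "path p" "path_image p \<subseteq> U" "pathstart p = e" "pathfinish p = e"
  using assms unfolding fundamental_group_def by auto

lemma fundamental_group_mult:
  assumes p: "path p" "path_image p \<subseteq> U" and q: "path q" "path_image q \<subseteq> U" and pq: "pathfinish p = pathstart q"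
  shows "Collect (homotopic_paths U p) \<otimes>\<^bsub>fundamental_group U e\<^esub> Collect (homotopic_paths U q) =
    Collect (homotopic_paths U (p +++ q))"
proof -
  have "homotopic_paths U (p +++ q) r"
    if "homotopic_paths U p p'" "homotopic_paths U q q'" "homotopic_paths U (p' +++ q') r" for p' q' r
    using homotopic_paths_trans[OF homotopic_paths_join[OF that(1,2) pq] that(3)] .
  moreover have "homotopic_paths U p p" "homotopic_paths U q q" using p q by auto
  ultimately have "(\<exists>p'\<in>Collect (homotopic_paths U p). \<exists>q'\<in>Collect (homotopic_paths U q). homotopic_paths U (p' +++ q') r) \<longleftrightarrow>
      homotopic_paths U (p +++ q) r" for r
    unfolding mem_Collect_eq Bex_def by metis
  then show ?thesis unfolding fundamental_group_def by simp
qed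

lemma fundamental_group_one_closed:
  assumes "e \<in> U"
  shows "\<one>\<^bsub>fundamental_group U e\<^esub> \<in> carrier (fundamental_group U e)"
proof -
  have "path (\<lambda>_. e) \<and> path_image (\<lambda>_. e) \<subseteq> U \<and> pathstart (\<lambda>_. e) = e \<and> pathfinish (\<lambda>_. e) = e"
    using assms by (auto simp: path_def path_image_def pathstart_def pathfinish_def)
  then show ?thesis unfolding fundamental_group_def by auto
qed

lemma fundamental_group_mult_closed:
  assumes "A \<in> carrier (fundamental_group U e)" "B \<in> carrier (fundamental_group U e)"
  shows "A \<otimes>\<^bsub>fundamental_group U e\<^esub> B \<in> carrier (fundamental_group U e)"
proof -
  obtain p where p: "A = Collect (homotopic_paths U p)" "path p" "path_image p \<subseteq> U" "pathstart p = e" "pathfinish p = e"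
    using fundamental_group_carrierE[OF assms(1)] .
  obtain q where q: "B = Collect (homotopic_paths U q)" "path q" "path_image q \<subseteq> U" "pathstart q = e" "pathfinish q = e"
    using fundamental_group_carrierE[OF assms(2)] .
  have "A \<otimes>\<^bsub>fundamental_group U e\<^esub> B = Collect (homotopic_paths U (p +++ q))"
    unfolding p(1) q(1) by (rule fundamental_group_mult) (use p q in auto)
  moreover have "path (p +++ q)" "path_image (p +++ q) \<subseteq> U" "pathstart (p +++ q) = e" "pathfinish (p +++ q) = e"
    using p q by (auto simp: path_join subset_path_image_join)
  ultimately show ?thesis by (auto simp: fundamental_group_def)
qed

lemma class_integral_mult:
  assumes \<omega>: "\<forall>\<omega>\<in>set \<omega>s. holomorphic_form X U \<omega>"
    and A: "A \<in> carrier (fundamental_group U e)" and B: "B \<in> carrier (fundamental_group U e)"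
  shows "class_integral X \<omega>s (A \<otimes>\<^bsub>fundamental_group U e\<^esub> B) =
    (\<Sum>j\<le>length \<omega>s. class_integral X (take j \<omega>s) A * class_integral X (drop j \<omega>s) B)"
proof -
  obtain p where p: "A = Collect (homotopic_paths U p)" "path p" "path_image p \<subseteq> U" "pathstart p = e" "pathfinish p = e"
    using fundamental_group_carrierE[OF A] .
  obtain q where q: "B = Collect (homotopic_paths U q)" "path q" "path_image q \<subseteq> U" "pathstart q = e" "pathfinish q = e"
    using fundamental_group_carrierE[OF B] .
  have pq: "pathfinish p = pathstart q" using p(5) q(4) by simp
  show ?thesis
    unfolding p(1) q(1) fundamental_group_mult[OF p(2,3) q(2,3) pq] by (rule class_integral_join[OF \<omega> p(2,3) q(2,3) pq])
qed

lemma class_integral_one: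
  assumes "\<forall>\<omega>\<in>set \<omega>s. holomorphic_form X U \<omega>" "e \<in> U"
  shows "class_integral X \<omega>s \<one>\<^bsub>fundamental_group U e\<^esub> = (if \<omega>s = [] then 1 else 0)"
  using class_integral_constant[OF assms] by (simp add: fundamental_group_def)

text \<open>An element of the augmentation ideal; it is the function \<open>aug\<close> inside
  \<open>f_xi\<close>.\<close>

definition loop_minus_one :: "'n proj \<Rightarrow> (real \<Rightarrow> 'n proj) set \<Rightarrow> ((real \<Rightarrow> 'n proj) set \<Rightarrow>\<^sub>0 int)" where
  "loop_minus_one e A = frag_of A - frag_of \<one>\<^bsub>fundamental_group U e\<^esub>"

lemma keys_loop_minus_one:
  assumes "e \<in> U" "A \<in> carrier (fundamental_group U e)"
  shows "Poly_Mapping.keys (loop_minus_one e A) \<subseteq> carrier (fundamental_group U e)"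
  unfolding loop_minus_one_def
  using keys_diff[of "frag_of A" "frag_of \<one>\<^bsub>fundamental_group U e\<^esub>"] fundamental_group_one_closed[OF assms(1)] assms(2) by auto

text \<open>On the empty word both classes have integral 1 and cancel; on a nonempty word the
  constant loop contributes nothing.\<close>

lemma integral_loop_minus_one:
  assumes "\<forall>\<omega>\<in>set \<omega>s. holomorphic_form X U \<omega>" "e \<in> U" "A \<in> carrier (fundamental_group U e)"
  shows "group_ring_integral X \<omega>s (loop_minus_one e A) = (if \<omega>s = [] then 0 else class_integral X \<omega>s A)"
proof -
  have "class_integral X [] A = 1"
    using assms(3) by (elim fundamental_group_carrierE) (simp add: class_integral_Nil)
  then show ?thesis
    unfolding loop_minus_one_def using class_integral_one[OF assms(1,2)] by (simp add: group_ring_integral_diff)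
qed

abbreviation loop_product :: "'n proj \<Rightarrow> (real \<Rightarrow> 'n proj) set list \<Rightarrow> ((real \<Rightarrow> 'n proj) set \<Rightarrow>\<^sub>0 int)" where
  "loop_product e bs \<equiv> group_ring_prod (fundamental_group U e) (map (loop_minus_one e) bs)"

lemma keys_loop_product:
  assumes "e \<in> U" "set bs \<subseteq> carrier (fundamental_group U e)"
  shows "Poly_Mapping.keys (loop_product e bs) \<subseteq> carrier (fundamental_group U e)"
  using assms(2)
proof (induction bs)
  case Nil
  show ?case using fundamental_group_one_closed[OF assms(1)] by (simp add: group_ring_prod_def)
next
  case (Cons b bs)
  have "Poly_Mapping.keys (group_ring_mult (fundamental_group U e) (loop_minus_one e b) (loop_product e bs))
      \<subseteq> carrier (fundamental_group U e)"
    by (rule group_ring_mult_keys[OF fundamental_group_mult_closed keys_loop_minus_one[OF assms(1)]])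
      (use Cons in auto)
  then show ?case by (simp add: group_ring_prod_def)
qed

text \<open>The coproduct formula cuts the word between the first factor and the rest. The cut
  giving the first factor the empty word drops out, and the remaining cuts are renumbered, whence
  \<open>Suc j\<close>.\<close>

lemma integral_loop_product_Cons:
  assumes \<omega>: "\<forall>\<omega>\<in>set \<omega>s. holomorphic_form X U \<omega>" and e: "e \<in> U"
    and bs: "set (b # bs) \<subseteq> carrier (fundamental_group U e)"
  shows "group_ring_integral X \<omega>s (loop_product e (b # bs)) =
    (\<Sum>j<length \<omega>s. class_integral X (take (Suc j) \<omega>s) b * group_ring_integral X (drop (Suc j) \<omega>s) (loop_product e bs))"
proof -
  have tk: "group_ring_integral X (take j \<omega>s) (loop_minus_one e b) = (if take j \<omega>s = [] then 0 else class_integral X (take j \<omega>s) b)" for j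
    by (rule integral_loop_minus_one[OF _ e]) (use \<omega> bs in \<open>auto dest: in_set_takeD\<close>)
  have "group_ring_integral X \<omega>s (loop_product e (b # bs)) =
      (\<Sum>j\<le>length \<omega>s. group_ring_integral X (take j \<omega>s) (loop_minus_one e b) * group_ring_integral X (drop j \<omega>s) (loop_product e bs))"
    unfolding group_ring_prod_def list.map foldr.simps o_apply
    unfolding group_ring_prod_def[symmetric]
    by (rule group_ring_integral_mult[OF class_integral_mult[OF \<omega>] keys_loop_minus_one[OF e] keys_loop_product[OF e]])
      (use bs in auto)
  also have "\<dots> = (\<Sum>j\<in>Suc ` {..<length \<omega>s}. group_ring_integral X (take j \<omega>s) (loop_minus_one e b) * group_ring_integral X (drop j \<omega>s) (loop_product e bs))"
  proof (rule sum.mono_neutral_right)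
    show "\<forall>j\<in>{..length \<omega>s} - Suc ` {..<length \<omega>s}.
        group_ring_integral X (take j \<omega>s) (loop_minus_one e b) * group_ring_integral X (drop j \<omega>s) (loop_product e bs) = 0"
    proof
      fix j assume "j \<in> {..length \<omega>s} - Suc ` {..<length \<omega>s}"
      then have "j = 0" by (cases j) auto
      then show "group_ring_integral X (take j \<omega>s) (loop_minus_one e b) * group_ring_integral X (drop j \<omega>s) (loop_product e bs) = 0"
        using tk[of 0] by simp
    qed
  qed auto
  also have "\<dots> = (\<Sum>j<length \<omega>s. class_integral X (take (Suc j) \<omega>s) b * group_ring_integral X (drop (Suc j) \<omega>s) (loop_product e bs))"
    by (subst sum.reindex) (auto simp: tk intro!: sum.cong)
  finally show ?thesis .
qed

text \<open>The first factor consumes at least one letter, so the rest of the word is again shorter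
  than the list of remaining factors.\<close>

lemma integral_loop_product_short:
  assumes e: "e \<in> U"
  shows "\<forall>\<omega>\<in>set \<omega>s. holomorphic_form X U \<omega> \<Longrightarrow> set bs \<subseteq> carrier (fundamental_group U e) \<Longrightarrow>
    length \<omega>s < length bs \<Longrightarrow> group_ring_integral X \<omega>s (loop_product e bs) = 0"
proof (induction bs arbitrary: \<omega>s)
  case (Cons b bs)
  have "group_ring_integral X (drop (Suc j) \<omega>s) (loop_product e bs) = 0" if "j < length \<omega>s" for j
    by (rule Cons.IH) (use Cons.prems that in \<open>auto dest: in_set_dropD\<close>)
  then show ?case unfolding integral_loop_product_Cons[OF Cons.prems(1) e Cons.prems(2)] by simp
qed simp

text \<open>If the first factor takes two or more letters, too few remain for the others and the
  term vanishes. So every factor takes exactly one.\<close>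

lemma integral_loop_product_equal:
  assumes e: "e \<in> U"
  shows "\<forall>\<omega>\<in>set \<omega>s. holomorphic_form X U \<omega> \<Longrightarrow> set bs \<subseteq> carrier (fundamental_group U e) \<Longrightarrow>
    length \<omega>s = length bs \<Longrightarrow>
    group_ring_integral X \<omega>s (loop_product e bs) = (\<Prod>l<length bs. class_integral X [\<omega>s ! l] (bs ! l))"
proof (induction bs arbitrary: \<omega>s)
  case Nil
  then show ?case using class_integral_one[of "[]", OF _ e] by (simp add: group_ring_prod_def)
next
  case (Cons b bs)
  obtain w ws where ws: "\<omega>s = w # ws" "length ws = length bs" using Cons.prems(3) by (cases \<omega>s) auto
  have \<omega>: "\<forall>\<omega>\<in>set ws. holomorphic_form X U \<omega>" "set bs \<subseteq> carrier (fundamental_group U e)" using Cons.prems ws by auto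
  have z: "group_ring_integral X (drop (Suc j) ws) (loop_product e bs) = 0" if "j < length ws" for j
    by (rule integral_loop_product_short[OF e]) (use \<omega> ws that in \<open>auto dest: in_set_dropD\<close>)
  have "group_ring_integral X \<omega>s (loop_product e (b # bs)) = class_integral X [w] b * group_ring_integral X ws (loop_product e bs)"
    unfolding integral_loop_product_Cons[OF Cons.prems(1) e Cons.prems(2)]
    using z by (simp add: ws(1) sum.lessThan_Suc_shift del: sum.lessThan_Suc)
  also have "\<dots> = class_integral X [w] b * (\<Prod>l<length bs. class_integral X [ws ! l] (bs ! l))"
    using Cons.IH[OF \<omega> ws(2)] by simp
  finally show ?case by (simp add: ws(1) prod.lessThan_Suc_shift del: prod.lessThan_Suc)
qed

text \<open>With one letter more than there are factors, exactly one factor receives two letters.\<close>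

lemma integral_loop_product_Suc:
  assumes e: "e \<in> U"
  shows "\<forall>\<omega>\<in>set \<omega>s. holomorphic_form X U \<omega> \<Longrightarrow> set bs \<subseteq> carrier (fundamental_group U e) \<Longrightarrow>
    length \<omega>s = Suc (length bs) \<Longrightarrow>
    group_ring_integral X \<omega>s (loop_product e bs) =
      (\<Sum>r<length bs. (\<Prod>l<r. class_integral X [\<omega>s ! l] (bs ! l)) *
         class_integral X [\<omega>s ! r, \<omega>s ! Suc r] (bs ! r) *
         (\<Prod>l\<in>{Suc r..<length bs}. class_integral X [\<omega>s ! Suc l] (bs ! l)))"
proof (induction bs arbitrary: \<omega>s)
  case Nil
  then have "\<omega>s \<noteq> []" by auto
  then show ?case using class_integral_one[OF Nil(1) e] by (simp add: group_ring_prod_def)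
next
  case (Cons b bs)
  obtain w \<nu>s where w: "\<omega>s = w # \<nu>s" "length \<nu>s = Suc (length bs)" using Cons.prems(3) by (cases \<omega>s) auto
  then obtain w' ws where w': "\<nu>s = w' # ws" "length ws = length bs" by (cases \<nu>s) auto
  have \<nu>: "\<forall>\<omega>\<in>set \<nu>s. holomorphic_form X U \<omega>" and \<omega>: "\<forall>\<omega>\<in>set ws. holomorphic_form X U \<omega>"
    and bs: "set bs \<subseteq> carrier (fundamental_group U e)" using Cons.prems w w' by auto
  \<comment> \<open>Three or more letters for the first factor leave too few for the others. With
    one letter the excess persists and induction applies; with two letters the rest has as many
    letters as factors.\<close>
  have z: "group_ring_integral X (drop (Suc j) ws) (loop_product e bs) = 0" if "j < length ws" for j
    by (rule integral_loop_product_short[OF e]) (use \<omega> bs w' that in \<open>auto dest: in_set_dropD\<close>)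
  let ?m = "length bs"
  have "group_ring_integral X \<omega>s (loop_product e (b # bs)) =
      class_integral X [w] b * group_ring_integral X \<nu>s (loop_product e bs) +
      class_integral X [w, w'] b * group_ring_integral X ws (loop_product e bs)"
    unfolding integral_loop_product_Cons[OF Cons.prems(1) e Cons.prems(2)]
    using z by (simp add: w(1) w'(1) sum.lessThan_Suc_shift del: sum.lessThan_Suc)
  also have "group_ring_integral X ws (loop_product e bs) = (\<Prod>l<?m. class_integral X [ws ! l] (bs ! l))"
    by (rule integral_loop_product_equal[OF e \<omega> bs w'(2)])
  also have "group_ring_integral X \<nu>s (loop_product e bs) =
      (\<Sum>r<?m. (\<Prod>l<r. class_integral X [\<nu>s ! l] (bs ! l)) * class_integral X [\<nu>s ! r, \<nu>s ! Suc r] (bs ! r) *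
         (\<Prod>l\<in>{Suc r..<?m}. class_integral X [\<nu>s ! Suc l] (bs ! l)))"
    by (rule Cons.IH[OF \<nu> bs w(2)])
  finally have gri: "group_ring_integral X \<omega>s (loop_product e (b # bs)) =
      class_integral X [w] b * (\<Sum>r<?m. (\<Prod>l<r. class_integral X [\<nu>s ! l] (bs ! l)) *
        class_integral X [\<nu>s ! r, \<nu>s ! Suc r] (bs ! r) * (\<Prod>l\<in>{Suc r..<?m}. class_integral X [\<nu>s ! Suc l] (bs ! l))) +
      class_integral X [w, w'] b * (\<Prod>l<?m. class_integral X [ws ! l] (bs ! l))" .
  \<comment> \<open>\<open>F r\<close> is the term whose factor number \<open>r\<close> takes two
    letters: \<open>F 0\<close> is the case of the first factor, and \<open>F (Suc r)\<close> is the
    \<open>r\<close>-th term for the shorter product times the one-letter integral over the first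
    factor.\<close>
  define F where "F = (\<lambda>r. (\<Prod>l<r. class_integral X [\<omega>s ! l] ((b # bs) ! l)) *
         class_integral X [\<omega>s ! r, \<omega>s ! Suc r] ((b # bs) ! r) *
         (\<Prod>l\<in>{Suc r..<Suc ?m}. class_integral X [\<omega>s ! Suc l] ((b # bs) ! l)))"
  have F0: "F 0 = class_integral X [w, w'] b * (\<Prod>l<?m. class_integral X [ws ! l] (bs ! l))"
    unfolding F_def prod.shift_bounds_Suc_ivl atLeast0LessThan by (simp add: w(1) w'(1))
  have FS: "F (Suc r) = class_integral X [w] b * ((\<Prod>l<r. class_integral X [\<nu>s ! l] (bs ! l)) *
        class_integral X [\<nu>s ! r, \<nu>s ! Suc r] (bs ! r) * (\<Prod>l\<in>{Suc r..<?m}. class_integral X [\<nu>s ! Suc l] (bs ! l)))" for r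
    unfolding F_def prod.shift_bounds_Suc_ivl prod.lessThan_Suc_shift by (simp add: w(1) mult.assoc)
  have "(\<Sum>r<Suc ?m. F r) = F 0 + (\<Sum>r<?m. F (Suc r))" by (rule sum.lessThan_Suc_shift)
  then show ?case
    unfolding gri FS F0 sum_distrib_left[symmetric] by (simp only: F_def length_Cons add.commute)
qed

end

section \<open>The formula\<close>

text \<open>Serves to merge the summation index \<open>j\<close> of \<open>f_xi\<close> with its
  multi-index of length \<open>2*n-2\<close> into the multi-index of length \<open>2*n-1\<close>
  used by \<open>mu'\<close>.\<close>

lemma sum_multi_indices_insert:
  assumes "m \<ge> 1"
  shows "(\<Sum>I\<in>multi_indices m N. F I) = (\<Sum>j\<in>{1..N}. \<Sum>I\<in>multi_indices (m - 1) N. F (I(m := j)))"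
proof -
  have m: "{1..m} = insert m {1..m - 1}" "m \<notin> {1..m - 1}" using assms by auto
  have "multi_indices m N = (\<lambda>(j, I). I(m := j)) ` ({1..N} \<times> multi_indices (m - 1) N)"
    unfolding multi_indices_def m(1) by (rule PiE_insert_eq)
  moreover have "inj_on (\<lambda>(j, I). I(m := j)) ({1..N} \<times> multi_indices (m - 1) N)"
    unfolding multi_indices_def by (rule inj_combinator[OF m(2)])
  ultimately show ?thesis by (simp add: sum.reindex sum.cartesian_product split_def o_def)
qed

text \<open>The three coordinates of \<open>I\<close> determine its fibre over
  \<open>S \<times> S \<times> S\<close>, and on a fibre the factor \<open>c\<close> is
  constant.\<close>

lemma sum_fibres:
  fixes F :: "'a \<Rightarrow> complex"
  assumes A: "finite A" and uvw: "\<And>I. I \<in> A \<Longrightarrow> u I \<in> S \<and> v I \<in> S \<and> w I \<in> S" and S: "finite S"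
  shows "(\<Sum>i\<in>S. \<Sum>j\<in>S. \<Sum>k\<in>S. (\<Sum>I\<in>{I\<in>A. u I = i \<and> v I = j \<and> w I = k}. F I) * c i j k) =
    (\<Sum>I\<in>A. F I * c (u I) (v I) (w I))"
proof -
  let ?T = "S \<times> S \<times> S"
  have "(\<Sum>I\<in>A. F I * c (u I) (v I) (w I)) =
      (\<Sum>y\<in>?T. \<Sum>I\<in>{I\<in>A. (u I, v I, w I) = y}. F I * c (u I) (v I) (w I))"
    by (rule sum.group[symmetric]) (use A S uvw in auto)
  also have "\<dots> = (\<Sum>y\<in>?T. (\<Sum>I\<in>{I\<in>A. (u I, v I, w I) = y}. F I) * c (fst y) (fst (snd y)) (snd (snd y)))"
    unfolding sum_distrib_right by (intro sum.cong refl) auto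
  finally show ?thesis
    by (simp add: sum.cartesian_product[symmetric] split_def prod_eq_iff) (simp add: sum.cartesian_product split_def prod_eq_iff)
qed

lemma finite_multi_indices [simp]: "finite (multi_indices m N)"
  unfolding multi_indices_def by (intro finite_PiE) auto

lemma sum_swap_out:
  "(\<Sum>r\<in>R. \<Sum>i\<in>A. \<Sum>j\<in>B. \<Sum>k\<in>C. F r i j k) = (\<Sum>i\<in>A. \<Sum>j\<in>B. \<Sum>k\<in>C. \<Sum>r\<in>R. F r i j k)"
proof -
  have "(\<Sum>r\<in>R. \<Sum>i\<in>A. \<Sum>j\<in>B. \<Sum>k\<in>C. F r i j k) = (\<Sum>i\<in>A. \<Sum>r\<in>R. \<Sum>j\<in>B. \<Sum>k\<in>C. F r i j k)"
    by (rule sum.swap)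
  also have "\<dots> = (\<Sum>i\<in>A. \<Sum>j\<in>B. \<Sum>r\<in>R. \<Sum>k\<in>C. F r i j k)"
    by (intro sum.cong refl) (rule sum.swap)
  also have "\<dots> = (\<Sum>i\<in>A. \<Sum>j\<in>B. \<Sum>k\<in>C. \<Sum>r\<in>R. F r i j k)"
    by (intro sum.cong refl) (rule sum.swap)
  finally show ?thesis .
qed

lemma nth_map_interval: "l < b - a \<Longrightarrow> map h [a..<b] ! l = h (a + l)"
  by simp

theorem proposition12p3p3:
  fixes X U :: "('n::finite) proj set" and e infty :: "'n proj" and g n :: nat
    and \<alpha> d \<omega> :: "nat \<Rightarrow> 'n form"
    and \<beta> :: "nat \<Rightarrow> (real \<Rightarrow> 'n proj) set"
    and \<xi> :: "(nat \<Rightarrow> nat) \<Rightarrow> complex" and c :: "'n form"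
  assumes "smooth_connected_projective_curve X" and "has_genus X g"
    and "e \<in> X" and "infty \<in> X" and "e \<noteq> infty" and "n \<ge> 2"
    and U: "U = X - {infty}"
    and "\<forall>i\<in>{1..g}. holomorphic_form X X (\<alpha> i)"
    and "\<forall>i\<in>{g+1..2*g}. meromorphic_form X (\<alpha> i) \<and> holomorphic_form X U (\<alpha> i)"
    and "cohomology_basis X U (2*g) \<alpha>"
    and "integral_cohomology_basis X (2*g) d"
    and "\<forall>i\<in>{1..2*g}. (\<exists>a. \<omega> i = form_comb (2*g) a \<alpha>) \<and> cohomologous X U (\<omega> i) (d i)"
    and "\<forall>i\<in>{1..2*g}. \<beta> i \<in> carrier (fundamental_group U e) \<and>
           (\<forall>\<eta>. closed_form X X \<eta> \<longrightarrow>
              class_integral X [\<eta>] (\<beta> i) = surface_integral X (wedge (d i) \<eta>))"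
    and "hodge_class X (2*g) d (2*n-2) \<xi>"
    and "closed_form X X c"
  shows "f_xi X U e g n d \<omega> \<beta> \<xi> c =
     (\<Sum>i\<in>{1..2*g}. \<Sum>j\<in>{1..2*g}. \<Sum>k\<in>{1..2*g}.
        mu' X g n d \<omega> \<beta> \<xi> c i j k * class_integral X [\<omega> i, \<omega> j] (\<beta> k))"
proof -
  interpret open_curve X U
  proof
    show "(\<Union>k\<in>charts X. fst k) = X"
      using assms(1) unfolding smooth_connected_projective_curve_def by blast
    have "U = X \<inter> - {infty}" using U by blast
    moreover have "open (- {infty})" by (intro open_Compl closed_proj_point)
    ultimately show "openin (top_of_set X) U" using openin_open_Int[of "- {infty}" X] by simp
  qed
  have e: "e \<in> U" using assms(3,5) U by blast
  have \<alpha>: "\<forall>i\<in>{1..2*g}. holomorphic_form X U (\<alpha> i)"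
  proof
    fix i assume i: "i \<in> {1..2*g}"
    show "holomorphic_form X U (\<alpha> i)"
    proof (cases "i \<le> g")
      case True
      then have "holomorphic_form X X (\<alpha> i)" using assms(8) i by simp
      then show ?thesis by (rule holomorphic_form_subset[OF _ U_subset])
    next
      case False
      then show ?thesis using assms(9) i by simp
    qed
  qed
  \<comment> \<open>The equality of \<open>\<omega> i\<close> with a combination of the
    \<open>\<alpha> j\<close> is used as an equality of forms: for words of two or more letters the
    integral depends on the forms and not only on their classes.\<close>
  have \<omega>: "holomorphic_form X U (\<omega> i)" if i: "i \<in> {1..2*g}" for i
  proof -
    obtain a where "\<omega> i = form_comb (2*g) a \<alpha>" using assms(12) i by blast
    then show ?thesis using holomorphic_form_comb[OF \<alpha>] by simp
  qed
  have \<beta>: "\<beta> i \<in> carrier (fundamental_group U e)" if "i \<in> {1..2*g}" for i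
    using assms(13) that by blast
  \<comment> \<open>There are \<open>m + 2\<close> forms and \<open>m + 1\<close> loops, so the word
    exceeds the product by exactly one letter.\<close>
  obtain m where n: "n = Suc (Suc m)" using \<open>n \<ge> 2\<close> by (metis add_2_eq_Suc le_Suc_ex)
  let ?A = "multi_indices (2*n-1) (2*g)"
  let ?C = "\<lambda>i k. class_integral X [\<omega> i] (\<beta> k)"
  \<comment> \<open>\<open>T I r\<close> is the term in which the \<open>r\<close>-th loop, with
    index \<open>I (r+n)\<close>, receives the forms \<open>r\<close> and \<open>r+1\<close>. An
    earlier loop receives the form with its own number, a later one the form with the next
    number.\<close>
  define T where "T = (\<lambda>I r. (\<Prod>l\<in>{1..r-1}. ?C (I l) (I (l+n))) *
      class_integral X [\<omega> (I r), \<omega> (I (r+1))] (\<beta> (I (r+n))) * (\<Prod>l\<in>{r+2..n}. ?C (I l) (I (l+n-1))))"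
  \<comment> \<open>A multi-index in \<open>?A\<close> consists of the indices for
    \<open>\<xi>\<close> followed, in place \<open>2*n-1\<close>, by the index for \<open>c\<close>;
    the restriction recovers the first part as an extensional function.\<close>
  define Q where "Q = (\<lambda>I. \<xi> (restrict I {1..2*n-2}) * coords X (2*g) d c (I (2*n-1)))"
  have word: "group_ring_integral X (map (\<lambda>l. \<omega> (I l)) [1..<n+1]) (loop_product e (map (\<lambda>l. \<beta> (I l)) [n+1..<2*n])) =
      (\<Sum>r\<in>{1..n-1}. T I r)" if I: "I \<in> ?A" for I
  proof -
    define ws where "ws = map (\<lambda>l. \<omega> (I l)) [1..<n+1]"
    define bs where "bs = map (\<lambda>l. \<beta> (I l)) [n+1..<2*n]"
    have Il: "I l \<in> {1..2*g}" if "l \<in> {1..2*n-1}" for l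
      using I that unfolding multi_indices_def by blast
    have len: "length ws = Suc (Suc m)" "length bs = Suc m" by (simp_all only: ws_def bs_def length_map length_upt n) auto
    \<comment> \<open>List positions count from 0 and places of a multi-index from 1; the loops
      begin at place \<open>n+1\<close>.\<close>
    have ws_nth: "ws ! l = \<omega> (I (Suc l))" if "l < Suc (Suc m)" for l
    proof -
      have "l < n+1 - 1" using that n by simp
      then show ?thesis unfolding ws_def by (subst nth_map_interval) simp_all
    qed
    have bs_nth: "bs ! l = \<beta> (I (Suc l + n))" if "l < Suc m" for l
    proof -
      have "l < 2*n - (n+1)" using that n by simp
      then show ?thesis unfolding bs_def by (subst nth_map_interval) (simp_all add: add.commute)
    qed
    have "group_ring_integral X ws (loop_product e bs) =
      (\<Sum>r<length bs. (\<Prod>l<r. class_integral X [ws ! l] (bs ! l)) * class_integral X [ws ! r, ws ! Suc r] (bs ! r) *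
         (\<Prod>l\<in>{Suc r..<length bs}. class_integral X [ws ! Suc l] (bs ! l)))"
    proof (rule integral_loop_product_Suc[OF e])
      have "\<omega> (I l) \<in> {w. holomorphic_form X U w}" if "l \<in> {1..<n+1}" for l
        using \<omega>[OF Il[of l]] that n by auto
      then show "\<forall>w\<in>set ws. holomorphic_form X U w" unfolding ws_def set_map set_upt by blast
      have "\<beta> (I l) \<in> carrier (fundamental_group U e)" if "l \<in> {n+1..<2*n}" for l
        using \<beta>[OF Il[of l]] that by auto
      then show "set bs \<subseteq> carrier (fundamental_group U e)" unfolding bs_def set_map set_upt by blast
    qed (simp add: len)
    also have "\<dots> = (\<Sum>r<Suc m. T I (Suc r))"
      unfolding len(2)
    proof (intro sum.cong refl)
      fix r assume "r \<in> {..<Suc m}"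
      then have r: "r < Suc m" by simp
      have "(\<Prod>l<r. class_integral X [ws ! l] (bs ! l)) = (\<Prod>l<r. ?C (I (Suc l)) (I (Suc l + n)))"
        using r by (intro prod.cong refl) (simp add: ws_nth bs_nth)
      also have "\<dots> = (\<Prod>l\<in>{1..Suc r - 1}. ?C (I l) (I (l+n)))"
        by (rule prod.reindex_bij_witness[of _ "\<lambda>l. l - 1" Suc]) auto
      finally have 1: "(\<Prod>l<r. class_integral X [ws ! l] (bs ! l)) = \<dots>" .
      \<comment> \<open>The product over the later loops is renumbered by the form that each
        receives; with 0-based \<open>l\<close> that form is number \<open>l + 2\<close>.\<close>
      have "(\<Prod>l\<in>{Suc r..<Suc m}. class_integral X [ws ! Suc l] (bs ! l)) =
          (\<Prod>l\<in>{Suc r..<Suc m}. ?C (I (Suc (Suc l))) (I (Suc l + n)))"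
        by (intro prod.cong refl) (simp add: ws_nth bs_nth)
      also have "\<dots> = (\<Prod>l\<in>{Suc r+2..n}. ?C (I l) (I (l+n-1)))"
        by (rule prod.reindex_bij_witness[of _ "\<lambda>l. l - 2" "\<lambda>l. Suc (Suc l)"]) (auto simp: n)
      finally have 2: "(\<Prod>l\<in>{Suc r..<Suc m}. class_integral X [ws ! Suc l] (bs ! l)) = \<dots>" .
      show "(\<Prod>l<r. class_integral X [ws ! l] (bs ! l)) * class_integral X [ws ! r, ws ! Suc r] (bs ! r) *
         (\<Prod>l\<in>{Suc r..<Suc m}. class_integral X [ws ! Suc l] (bs ! l)) = T I (Suc r)"
        unfolding 1 2 T_def using r by (simp add: ws_nth bs_nth)
    qed
    also have "\<dots> = (\<Sum>r\<in>{1..n-1}. T I r)"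
      by (rule sum.reindex_bij_witness[of _ "\<lambda>l. l - 1" Suc]) (auto simp: n)
    finally show ?thesis unfolding ws_def bs_def .
  qed
  \<comment> \<open>The coordinate of \<open>c\<close> and the last loop share the index
    \<open>j\<close>, which becomes place \<open>2*n-1\<close> of a single multi-index.\<close>
  have "f_xi X U e g n d \<omega> \<beta> \<xi> c = (\<Sum>j\<in>{1..2*g}. \<Sum>I\<in>multi_indices (2*n-2) (2*g).
      (\<lambda>I. Q I * (\<Sum>r\<in>{1..n-1}. T I r)) (I(2*n-1 := j)))"
    unfolding f_xi_def Let_def
  proof (intro sum.cong refl)
    fix j I assume j: "j \<in> {1..2*g}" and I: "I \<in> multi_indices (2*n-2) (2*g)"
    let ?J = "I(2*n-1 := j)"
    have "?J \<in> {1..2*n-1} \<rightarrow>\<^sub>E {1..2*g}"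
    proof (rule PiE_I)
      fix l assume "l \<in> {1..2*n-1}"
      then show "?J l \<in> {1..2*g}" using I j unfolding multi_indices_def by (cases "l = 2*n-1") (auto simp: PiE_iff)
    next
      fix l assume "l \<notin> {1..2*n-1}"
      then show "?J l = undefined" using I n unfolding multi_indices_def by (auto simp: PiE_iff extensional_def)
    qed
    then have J: "?J \<in> ?A" by (simp add: multi_indices_def)
    have "restrict ?J {1..2*n-2} = I"
      using I unfolding multi_indices_def by (auto simp: fun_eq_iff restrict_def n dest: PiE_arb)
    then have Q: "Q ?J = coords X (2*g) d c j * \<xi> I" by (simp add: Q_def)
    have split: "[n+1..<2*n] = [n+1..<2*n-1] @ [2*n-1]"
      using upt_Suc_append[of "n+1" "2*n-1"] by (simp add: n)
    have words: "map (\<lambda>l. \<omega> (I l)) [1..<n+1] = map (\<lambda>l. \<omega> (?J l)) [1..<n+1]"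
      by (intro map_cong refl) (auto simp: n)
    have loops: "map (\<lambda>l. frag_of (\<beta> (I l)) - frag_of \<one>\<^bsub>fundamental_group U e\<^esub>) [n+1..<2*n-1] @
        [frag_of (\<beta> j) - frag_of \<one>\<^bsub>fundamental_group U e\<^esub>] = map (loop_minus_one e) (map (\<lambda>l. \<beta> (?J l)) [n+1..<2*n])"
    proof -
      have "map (\<lambda>l. frag_of (\<beta> (I l)) - frag_of \<one>\<^bsub>fundamental_group U e\<^esub>) [n+1..<2*n-1] =
          map (loop_minus_one e) (map (\<lambda>l. \<beta> (?J l)) [n+1..<2*n-1])"
        unfolding map_map o_def loop_minus_one_def by (intro map_cong refl) auto
      then show ?thesis unfolding split map_append by (simp add: loop_minus_one_def)
    qed
    show "coords X (2*g) d c j * \<xi> I * group_ring_integral X (map (\<lambda>l. \<omega> (I l)) [1..<n+1])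
        (group_ring_prod (fundamental_group U e)
          (map (\<lambda>l. frag_of (\<beta> (I l)) - frag_of \<one>\<^bsub>fundamental_group U e\<^esub>) [n+1..<2*n-1] @
            [frag_of (\<beta> j) - frag_of \<one>\<^bsub>fundamental_group U e\<^esub>])) =
        Q ?J * (\<Sum>r\<in>{1..n-1}. T ?J r)"
      unfolding words loops word[OF J] Q ..
  qed
  also have "\<dots> = (\<Sum>I\<in>?A. Q I * (\<Sum>r\<in>{1..n-1}. T I r))"
  proof -
    have m1: "2*n-1-1 = 2*n-2" "2*n-1 \<ge> 1" using n by auto
    show ?thesis using sum_multi_indices_insert[OF m1(2), of "\<lambda>I. Q I * (\<Sum>r\<in>{1..n-1}. T I r)" "2*g"] unfolding m1(1) by simp
  qed
  also have "\<dots> = (\<Sum>r\<in>{1..n-1}. \<Sum>I\<in>?A. Q I * T I r)"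
    unfolding sum_distrib_left by (rule sum.swap)
  \<comment> \<open>The integral of length two depends only on the triple
    \<open>(I r, I (r+1), I (r+n))\<close>; collecting the multi-indices with a given triple leaves
    the \<open>r\<close>-th summand of \<open>mu'\<close>.\<close>
  also have "\<dots> = (\<Sum>r\<in>{1..n-1}. \<Sum>i\<in>{1..2*g}. \<Sum>j\<in>{1..2*g}. \<Sum>k\<in>{1..2*g}.
      (\<Sum>I\<in>{I\<in>?A. I r = i \<and> I (r+1) = j \<and> I (r+n) = k}. Q I *
        (\<Prod>l\<in>{1..r-1}. ?C (I l) (I (l+n))) * (\<Prod>l\<in>{r+2..n}. ?C (I l) (I (l+n-1)))) *
      class_integral X [\<omega> i, \<omega> j] (\<beta> k))"
  proof (intro sum.cong refl)
    fix r assume r: "r \<in> {1..n-1}"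
    have "(\<Sum>I\<in>?A. Q I * T I r) = (\<Sum>I\<in>?A. (Q I * (\<Prod>l\<in>{1..r-1}. ?C (I l) (I (l+n))) *
        (\<Prod>l\<in>{r+2..n}. ?C (I l) (I (l+n-1)))) * class_integral X [\<omega> (I r), \<omega> (I (r+1))] (\<beta> (I (r+n))))"
      unfolding T_def by (intro sum.cong refl) (simp only: mult_ac)
    also have "\<dots> = (\<Sum>i\<in>{1..2*g}. \<Sum>j\<in>{1..2*g}. \<Sum>k\<in>{1..2*g}.
      (\<Sum>I\<in>{I\<in>?A. I r = i \<and> I (r+1) = j \<and> I (r+n) = k}. Q I *
        (\<Prod>l\<in>{1..r-1}. ?C (I l) (I (l+n))) * (\<Prod>l\<in>{r+2..n}. ?C (I l) (I (l+n-1)))) *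
      class_integral X [\<omega> i, \<omega> j] (\<beta> k))"
    proof (rule sum_fibres[symmetric])
      fix I assume I: "I \<in> ?A"
      have "r \<in> {1..2*n-1}" "r+1 \<in> {1..2*n-1}" "r+n \<in> {1..2*n-1}" using r n by auto
      then show "I r \<in> {1..2*g} \<and> I (r+1) \<in> {1..2*g} \<and> I (r+n) \<in> {1..2*g}"
        using I unfolding multi_indices_def by blast
    qed auto
    finally show "(\<Sum>I\<in>?A. Q I * T I r) = \<dots>" .
  qed
  also have "\<dots> = (\<Sum>i\<in>{1..2*g}. \<Sum>j\<in>{1..2*g}. \<Sum>k\<in>{1..2*g}. \<Sum>r\<in>{1..n-1}.
      (\<Sum>I\<in>{I\<in>?A. I r = i \<and> I (r+1) = j \<and> I (r+n) = k}. Q I *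
        (\<Prod>l\<in>{1..r-1}. ?C (I l) (I (l+n))) * (\<Prod>l\<in>{r+2..n}. ?C (I l) (I (l+n-1)))) *
      class_integral X [\<omega> i, \<omega> j] (\<beta> k))"
    by (rule sum_swap_out)
  also have "\<dots> = (\<Sum>i\<in>{1..2*g}. \<Sum>j\<in>{1..2*g}. \<Sum>k\<in>{1..2*g}.
        mu' X g n d \<omega> \<beta> \<xi> c i j k * class_integral X [\<omega> i, \<omega> j] (\<beta> k))"
    unfolding mu'_def Q_def sum_distrib_right ..
  finally show ?thesis .
qed

end
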